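(* Let $\Omega\subset\mathbb{C}$ be an unbounded quasidisk with boundary $\Gamma=\partial\Omega\subset\mathbb{C}$, let $G\colon\mathbb{H}\to\Omega$ be a conformal mapping of $\mathbb{H}$ onto $\Omega$ with $G(\infty)=\lim_{z\to\infty}G(z)=\infty$, and let $g\colon\mathbb{R}\to\Gamma$ be its homeomorphic boundary extension. Then the following conditions are equivalent: (1) $\log G'\in B_0(\mathbb{H})$; (2) $\Gamma$ is an asymptotically conformal quasicircle relative to $g\colon\mathbb{R}\to\Gamma$; (3) $g\colon\mathbb{R}\to\mathbb{C}$ is an asymptotically symmetric embedding with image $\Gamma$.
   Context: $\mathbb{H}=\{z\in\mathbb{C}:\operatorname{Im}z>0\}$. A quasidisk is a domain bounded by a quasicircle; a quasicircle through $\infty$ is the image of the (extended) real line under a quasiconformal self-homeomorphism of $\mathbb{C}$. The conformal mapping $G$ extends to a homeomorphism of closures and $g$ is its restriction to $\mathbb{R}$. $B_0(\mathbb{H})$ (little Bloch space): holomorphic functions $F$ on $\mathbb{H}$ with $\sup_{z\in\mathbb{H}}(\operatorname{Im}z)|F'(z)|<\infty$ and $\lim_{\operatorname{Im}z\to0_+}(\operatorname{Im}z)|F'(z)|=0$ uniformly in $\operatorname{Re}z\in\mathbb{R}$. For $z_1,z_2\in\Gamma$, $\overset{\frown}{z_1z_2}$ denotes the (bounded) subarc of $\Gamma$ joining $z_1$ and $z_2$. The quasicircle $\Gamma$ is asymptotically conformal relative to a parametrization $\gamma\colon\mathbb{R}\to\Gamma$ if $$\lim_{t\to0}\ \sup_{z_1,z_2\in\Gamma}\left\{\max_{z\in\overset{\frown}{z_1z_2}}\frac{|z_1-z|+|z-z_2|}{|z_1-z_2|}:\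 0<|\gamma^{-1}(z_1)-\gamma^{-1}(z_2)|\le t\right\}=1.$$ An embedding $\gamma\colon\mathbb{R}\to\mathbb{C}$ is quasisymmetric if there is an increasing homeomorphism $\eta\colon[0,\infty)\to[0,\infty)$ such that $\frac{|x-a|}{|x-b|}\le t$ implies $\frac{|\gamma(x)-\gamma(a)|}{|\gamma(x)-\gamma(b)|}\le\eta(t)$ for all distinct $x,a,b\in\mathbb{R}$. A quasisymmetric embedding $\gamma\colon\mathbb{R}\to\mathbb{C}$ is asymptotically symmetric if for every $\varepsilon>0$ and every $t>0$ there exists $\delta>0$ such that $$\frac{|x-a|}{|x-b|}\le t\implies\frac{|\gamma(x)-\gamma(a)|}{|\gamma(x)-\gamma(b)|}\le(1+\varepsilon)t$$ whenever $x,a,b\in\mathbb{R}$ are distinct points lying in an interval of length less than $\delta$. *)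

theory Defs
  imports "HOL-Complex_Analysis.Complex_Analysis"
begin

definition upper_half_plane :: "complex set" where
  "upper_half_plane = {z. Im z > 0}"


section \<open>Quasicircles and quasidisks\<close>

text \<open>Metric definition of quasiconformality: the linear dilatation
  $\limsup_{r \to 0} \max_{|w-z|=r}|f(w)-f(z)| / \min_{|w-z|=r}|f(w)-f(z)|$ is bounded on the plane.
  Preservation of orientation is not demanded. This does not affect the class of images of the
  real line, because complex conjugation fixes the real line pointwise.\<close>

definition quasiconformal_plane :: "(complex \<Rightarrow> complex) \<Rightarrow> bool" where
  "quasiconformal_plane f \<longleftrightarrow>
     (\<exists>h. homeomorphism UNIV UNIV f h) \<and>
     (\<exists>K::real. \<forall>z. Limsup (at_right 0)
        (\<lambda>r. ereal ((SUP w\<in>sphere z r. cmod (f w - f z)) / (INF w\<in>sphere z r. cmod (f w - f z))))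
        \<le> ereal K)"

text \<open>The point at infinity is left out of the set representing the quasicircle.\<close>

definition quasicircle_through_infinity :: "complex set \<Rightarrow> bool" where
  "quasicircle_through_infinity \<Gamma> \<longleftrightarrow> (\<exists>f. quasiconformal_plane f \<and> \<Gamma> = f ` \<real>)"

text \<open>An open connected set whose boundary is $f(\mathbb{R})$, with $f$ a self-homeomorphism of the
  plane, is one of the two components of the complement of $f(\mathbb{R})$. It is therefore
  automatically nonempty, simply connected and unbounded.\<close>

definition unbounded_quasidisk :: "complex set \<Rightarrow> bool" where
  "unbounded_quasidisk \<Omega> \<longleftrightarrow>
     open \<Omega> \<and> connected \<Omega> \<and> quasicircle_through_infinity (frontier \<Omega>)"


section \<open>Conformal mappings of the upper half-plane and their boundary values\<close>

definition conformal_onto :: "(complex \<Rightarrow> complex) \<Rightarrow> complex set \<Rightarrow> complex set \<Rightarrow> bool" where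
  "conformal_onto G U V \<longleftrightarrow> G holomorphic_on U \<and> inj_on G U \<and> G ` U = V"

definition homeomorphic_boundary_extension ::
    "(complex \<Rightarrow> complex) \<Rightarrow> complex set \<Rightarrow> (real \<Rightarrow> complex) \<Rightarrow> bool" where
  "homeomorphic_boundary_extension G \<Omega> g \<longleftrightarrow>
     (\<exists>E h. homeomorphism (closure upper_half_plane) (closure \<Omega>) E h \<and>
            (\<forall>z\<in>upper_half_plane. E z = G z) \<and>
            (\<forall>x. g x = E (complex_of_real x)))"


section \<open>The little Bloch space\<close>

definition little_bloch :: "(complex \<Rightarrow> complex) set" where
  "little_bloch = {F. F holomorphic_on upper_half_plane \<and>
     bdd_above ((\<lambda>z. Im z * cmod (deriv F z)) ` upper_half_plane) \<and>
     uniform_limit UNIV (\<lambda>y x. y * cmod (deriv F (Complex x y))) (\<lambda>x. 0) (at_right 0)}"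

text \<open>Two branches on the half-plane differ by a constant, so membership of a branch in
  \<^const>\<open>little_bloch\<close> does not depend on the branch. The principal logarithm \<^const>\<open>Ln\<close> of the
  derivative would not do, as it may be discontinuous.\<close>

definition log_branch :: "(complex \<Rightarrow> complex) \<Rightarrow> (complex \<Rightarrow> complex) \<Rightarrow> bool" where
  "log_branch L f \<longleftrightarrow> L holomorphic_on upper_half_plane \<and> (\<forall>z\<in>upper_half_plane. exp (L z) = f z)"


section \<open>Asymptotically conformal quasicircles\<close>

text \<open>The subarc is unique when the curve is homeomorphic to the real line and the two points are
  distinct; the lemma below identifies it.\<close>

definition subarc :: "complex set \<Rightarrow> complex \<Rightarrow> complex \<Rightarrow> complex set" where
  "subarc \<Gamma> z1 z2 = (THE A. \<exists>p. arc p \<and> pathstart p = z1 \<and> pathfinish p = z2 \<and>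
                                path_image p = A \<and> A \<subseteq> \<Gamma>)"

lemma subarc_parametrization:
  fixes \<gamma> :: "real \<Rightarrow> complex"
  assumes hom: "homeomorphism UNIV \<Gamma> \<gamma> h" and "s \<noteq> t"
  shows "subarc \<Gamma> (\<gamma> s) (\<gamma> t) = \<gamma> ` closed_segment s t"
  unfolding subarc_def
proof (rule the_equality)
  have inj: "inj_on \<gamma> X" for X
    using hom by (metis UNIV_I homeomorphism_apply1 inj_onI)
  have cont: "continuous_on X \<gamma>" for X
    using hom by (meson continuous_on_subset homeomorphism_cont1 top_greatest)
  have "arc (linepath s t)"
    using \<open>s \<noteq> t\<close> by (rule arc_linepath)
  then have "arc (\<gamma> \<circ> linepath s t)"
    unfolding arc_def path_def
    by (intro conjI continuous_on_compose comp_inj_on cont inj; simp)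
  moreover have "path_image (\<gamma> \<circ> linepath s t) = \<gamma> ` closed_segment s t"
    by (simp add: path_image_compose)
  moreover have "\<gamma> ` closed_segment s t \<subseteq> \<Gamma>"
    using hom by (auto simp: homeomorphism_def)
  ultimately show "\<exists>p. arc p \<and> pathstart p = \<gamma> s \<and> pathfinish p = \<gamma> t \<and>
       path_image p = \<gamma> ` closed_segment s t \<and> \<gamma> ` closed_segment s t \<subseteq> \<Gamma>"
    by (intro exI[of _ "\<gamma> \<circ> linepath s t"]) (auto simp: pathstart_compose pathfinish_compose)
next
  fix A
  assume "\<exists>p. arc p \<and> pathstart p = \<gamma> s \<and> pathfinish p = \<gamma> t \<and> path_image p = A \<and> A \<subseteq> \<Gamma>"
  then obtain p where p: "arc p" "p 0 = \<gamma> s" "p 1 = \<gamma> t" "p ` {0..1} = A" "A \<subseteq> \<Gamma>"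
    by (auto simp: pathstart_def pathfinish_def path_image_def)
  have "continuous_on {0..1} p" "continuous_on A h"
    using p hom by (auto simp: arc_def path_def homeomorphism_def intro: continuous_on_subset)
  then have "continuous_on {0..1} (h \<circ> p)"
    using p(4) by (intro continuous_on_compose) auto
  moreover have "inj_on h A"
    using hom p(5) by (metis homeomorphism_apply2 inj_onI subsetD)
  then have "inj_on (h \<circ> p) {0..1}"
    using p by (auto simp: arc_def intro!: comp_inj_on)
  ultimately have "(h \<circ> p) ` closed_segment 0 1 = closed_segment ((h \<circ> p) 0) ((h \<circ> p) 1)"
    by (intro continuous_injective_image_segment_1) (auto simp: closed_segment_eq_real_ivl)
  moreover have "(h \<circ> p) ` closed_segment 0 1 = h ` A"
    using p(4) by (simp only: image_comp[symmetric] closed_segment_eq_real_ivl) simp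
  moreover have "(h \<circ> p) 0 = s" "(h \<circ> p) 1 = t"
    using p(2,3) homeomorphism_apply1[OF hom] by auto
  ultimately have hA: "h ` A = closed_segment s t"
    by simp
  have "\<gamma> ` h ` A = A"
    using hom p(5) by (force simp: homeomorphism_def image_iff)
  with hA show "A = \<gamma> ` closed_segment s t"
    by simp
qed

text \<open>The suprema are taken in \<^typ>\<open>ereal\<close> because they may be infinite; the inner one, over a
  compact arc, is a maximum.\<close>

definition asymptotically_conformal_quasicircle :: "complex set \<Rightarrow> (real \<Rightarrow> complex) \<Rightarrow> bool" where
  "asymptotically_conformal_quasicircle \<Gamma> \<gamma> \<longleftrightarrow>
     quasicircle_through_infinity \<Gamma> \<and>
     (\<exists>h. homeomorphism UNIV \<Gamma> \<gamma> h \<and>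
       ((\<lambda>t. SUP (z1, z2) \<in> {(z1, z2). z1 \<in> \<Gamma> \<and> z2 \<in> \<Gamma> \<and> 0 < \<bar>h z1 - h z2\<bar> \<and> \<bar>h z1 - h z2\<bar> \<le> t}.
               SUP z\<in>subarc \<Gamma> z1 z2. ereal ((cmod (z1 - z) + cmod (z - z2)) / cmod (z1 - z2)))
         \<longlongrightarrow> 1) (at_right 0))"


section \<open>Asymptotically symmetric embeddings\<close>

definition quasisymmetric_embedding :: "(real \<Rightarrow> complex) \<Rightarrow> bool" where
  "quasisymmetric_embedding \<gamma> \<longleftrightarrow>
     embedding_map euclidean euclidean \<gamma> \<and>
     (\<exists>\<eta> :: real \<Rightarrow> real. strict_mono_on {0..} \<eta> \<and> (\<exists>\<theta>. homeomorphism {0..} {0..} \<eta> \<theta>) \<and>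
       (\<forall>t\<ge>0. \<forall>x a b. distinct [x, a, b] \<longrightarrow> \<bar>x - a\<bar> / \<bar>x - b\<bar> \<le> t \<longrightarrow>
          cmod (\<gamma> x - \<gamma> a) / cmod (\<gamma> x - \<gamma> b) \<le> \<eta> t))"

definition asymptotically_symmetric_embedding :: "(real \<Rightarrow> complex) \<Rightarrow> bool" where
  "asymptotically_symmetric_embedding \<gamma> \<longleftrightarrow>
     quasisymmetric_embedding \<gamma> \<and>
     (\<forall>\<epsilon>>0. \<forall>t>0. \<exists>\<delta>>0. \<forall>x a b. distinct [x, a, b] \<longrightarrow>
        (\<exists>c d. d - c < \<delta> \<and> {x, a, b} \<subseteq> {c..d}) \<longrightarrow>
        \<bar>x - a\<bar> / \<bar>x - b\<bar> \<le> t \<longrightarrow>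
        cmod (\<gamma> x - \<gamma> a) / cmod (\<gamma> x - \<gamma> b) \<le> (1 + \<epsilon>) * t)"

end

theory Submission
  imports Defs
begin

text \<open>The boundary arc is \<open>f(\<real>)\<close> for a quasiconformal homeomorphism \<open>f\<close> of the plane. A discrete length-area
  argument, which uses nothing but the metric definition, shows that this curve has bounded turning.
  The same argument, applied to the conformal map \<open>G\<close> and to contours around boundary points,
  then shows that \<open>g\<close> is quasisymmetric, whether or not any of the three conditions holds.

  If \<open>(Im z) \<bar>(log G')'\<bar>\<close> tends to \<open>0\<close>, integration of \<open>G'\<close> from height \<open>h\<close> down to the real line shows that
  \<open>g\<close> is affine up to an error \<open>o(h) \<bar>G'\<bar>\<close> on intervals of length comparable to \<open>h\<close>; this gives asymptotic
  symmetry. Asymptotic symmetry, used for finitely many ratios, bounds the sum of the two chords over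
  a subarc.

  Finally, if \<open>\<Gamma>\<close> is asymptotically conformal, then at a small scale \<open>y\<close> the directions of the chords of \<open>\<Gamma>\<close>
  are almost constant along many multiples of \<open>y\<close>. Hence the imaginary part of \<open>log (G(z + a) - G(z))\<close> is
  almost constant on a long real interval, while a Koebe-type distortion theorem bounds its derivative
  by a multiple of \<open>1 / Im z\<close>. Cauchy's formula and reflection in the real line turn this into smallness of the
  derivative at height \<open>y\<close>, which approximates \<open>G'' / G'\<close> there when \<open>a\<close> is a small multiple of \<open>y\<close>.\<close>

section \<open>A length-area estimate\<close>

text \<open>The length-area inequality bounds the square of \<open>ln (L / l)\<close> by a constant
  times the logarithmic area of the ring between the radii \<open>l\<close> and \<open>L\<close>,
  which is itself comparable to \<open>ln (L / l)\<close>. One factor cancels, so a ratio of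
  distances in the image is bounded as soon as the topology forces each contour of a family to pass
  through all intermediate distances. The bound on the dilatation is used nowhere else.

  The way back from the curve to the derivative meets the obstacle that \<open>G'\<close> need not
  have boundary values. The difference \<open>G(z + a) - G(z)\<close> extends continuously and
  without zeros to the real line, and its argument there is the direction of a chord. Directions are
  what the hypothesis on arcs controls: if a detour is almost as short as the chord, its two parts
  have almost the same direction. How close they are depends on the ratio of the two parts, and only
  quasisymmetry bounds this ratio.\<close>

text \<open>This replaces the continuity from below of the outer measure; the sets \<open>A k\<close> of the length-area
  argument need not be measurable.\<close>

lemma increasing_cover_half:
  fixes A :: "nat \<Rightarrow> real set"
  assumes inc: "incseq A" and cov: "{a<..<b} \<subseteq> (\<Union>k. A k)" and ab: "a < b"
  obtains k where "\<And>V. V \<in> sets lborel \<Longrightarrow> A k \<subseteq> V \<Longrightarrow> ennreal ((b - a) / 2) \<le> emeasure lborel V"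
proof (rule ccontr)
  assume neg: "\<not> thesis"
  have "\<forall>k. \<exists>V. V \<in> sets lborel \<and> A k \<subseteq> V \<and> emeasure lborel V < ennreal ((b - a) / 2)"
    using neg that by (meson not_le)
  then obtain V where V: "\<And>k. V k \<in> sets lborel" "\<And>k. A k \<subseteq> V k"
      "\<And>k. emeasure lborel (V k) < ennreal ((b - a) / 2)"
    by metis
  \<comment> \<open>Intersecting the later sets makes the sequence increasing. The intersection
    still contains \<open>A k\<close>, because \<open>A k\<close> lies in every later
    \<open>A j\<close>; continuity from below is then applied to measurable sets only.\<close>
  define W where "W k = (\<Inter>j\<in>{k..}. V j)" for k
  have Ws: "W k \<in> sets lborel" for k
    unfolding W_def using V(1) by (intro sets.countable_INT'') auto
  have Winc: "incseq W"
    by (force simp: incseq_def W_def)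
  have AW: "A k \<subseteq> W k" for k
    unfolding W_def using V(2) inc by (fastforce simp: incseq_def)
  have Wle: "emeasure lborel (W k) \<le> ennreal ((b - a) / 2)" for k
  proof -
    have "emeasure lborel (W k) \<le> emeasure lborel (V k)"
      by (intro emeasure_mono V) (auto simp: W_def)
    then show ?thesis
      using V(3)[of k] by simp
  qed
  have "ennreal (b - a) = emeasure lborel {a<..<b}"
    using ab by simp
  also have "\<dots> \<le> emeasure lborel (\<Union>k. W k)"
    using cov AW Ws by (intro emeasure_mono sets.countable_UN) blast+
  also have "\<dots> = (SUP k. emeasure lborel (W k))"
    using Ws Winc by (intro SUP_emeasure_incseq[symmetric]) auto
  also have "\<dots> \<le> ennreal ((b - a) / 2)"
    using Wle by (rule SUP_least)
  finally show False
    using ab by simp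
qed

text \<open>Area comparison: the sum of the indicator functions of the discs is at most
  \<open>N\<close> and vanishes outside \<open>ball p R\<close>, so its integral is at most
  \<open>N\<close> times the area of that disc.\<close>

lemma ball_packing:
  fixes w :: "'i \<Rightarrow> complex"
  assumes fin: "finite I" and lam: "\<And>i. i \<in> I \<Longrightarrow> 0 \<le> r i"
    and sub: "\<And>i. i \<in> I \<Longrightarrow> ball (w i) (r i) \<subseteq> ball p R" and R: "0 \<le> R"
    and N: "\<And>q. card {i \<in> I. q \<in> ball (w i) (r i)} \<le> N"
  shows "(\<Sum>i\<in>I. (r i)\<^sup>2) \<le> N * R\<^sup>2"
proof -
  define V where "V = unit_ball_vol (real DIM(complex))"
  have V0: "V > 0"
    unfolding V_def by (rule unit_ball_vol_pos) simp
  have cb: "measure lborel (ball x t) = V * t\<^sup>2" if "t \<ge> 0" for x :: complex and t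
    using content_ball[OF that, of x] by (simp add: V_def)
  have ind: "integrable lborel (indicat_real (ball x t))" for x :: complex and t
    by (rule integrable_real_indicator) (use emeasure_bounded_finite[OF bounded_ball, of x t] in auto)
  have "V * (\<Sum>i\<in>I. (r i)\<^sup>2) = (\<Sum>i\<in>I. measure lborel (ball (w i) (r i)))"
    using lam by (simp add: sum_distrib_left cb)
  also have "\<dots> = (\<Sum>i\<in>I. integral\<^sup>L lborel (indicat_real (ball (w i) (r i))))"
    by simp
  also have "\<dots> = integral\<^sup>L lborel (\<lambda>q. \<Sum>i\<in>I. indicat_real (ball (w i) (r i)) q)"
    by (rule Bochner_Integration.integral_sum[symmetric]) (rule ind)
  also have "\<dots> \<le> integral\<^sup>L lborel (\<lambda>q. real N * indicat_real (ball p R) q)"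
  proof (rule integral_mono)
    show "integrable lborel (\<lambda>q. \<Sum>i\<in>I. indicat_real (ball (w i) (r i)) q)"
      by (rule Bochner_Integration.integrable_sum) (rule ind)
    show "integrable lborel (\<lambda>q. real N * indicat_real (ball p R) q)"
      using ind by (rule integrable_mult_right)
    fix q
    have eq: "(\<Sum>i\<in>I. indicat_real (ball (w i) (r i)) q) = real (card {i \<in> I. q \<in> ball (w i) (r i)})"
      using fin by (simp add: indicator_def sum.If_cases Int_def)
    show "(\<Sum>i\<in>I. indicat_real (ball (w i) (r i)) q) \<le> real N * indicat_real (ball p R) q"
    proof (cases "q \<in> ball p R")
      case True
      then show ?thesis using N[of q] by (simp add: eq)
    next
      case False
      then have "{i \<in> I. q \<in> ball (w i) (r i)} = {}" using sub by blast
      then show ?thesis by (simp only: eq) simp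
    qed
  qed
  also have "\<dots> = V * (N * R\<^sup>2)"
    using R by (simp add: cb)
  finally show ?thesis
    using V0 by simp
qed

text \<open>The sum is a discrete logarithmic area, so the annulus is cut dyadically. At distance
  about \<open>2 ^ j * l\<close> from \<open>p\<close> the denominators are constant up to a factor
  \<open>2\<close>, and \<open>ball_packing\<close> bounds the contribution of such a piece
  independently of \<open>j\<close>.\<close>

lemma log_packing:
  fixes w :: "'i \<Rightarrow> complex"
  assumes fin: "finite I" and l: "0 < l" "l < L"
    and wl: "\<And>i. i \<in> I \<Longrightarrow> l < cmod (w i - p) \<and> cmod (w i - p) < L"
    and lam: "\<And>i. i \<in> I \<Longrightarrow> 0 \<le> r i \<and> r i \<le> cmod (w i - p) / 2"
    and N: "\<And>q. card {i \<in> I. q \<in> ball (w i) (r i)} \<le> N"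
  shows "(\<Sum>i\<in>I. (r i / cmod (w i - p))\<^sup>2) \<le> 9 * N * (log 2 (L / l) + 1)"
proof -
  define J where "J i = nat \<lfloor>log 2 (cmod (w i - p) / l)\<rfloor>" for i
  define m where "m = nat \<lfloor>log 2 (L / l)\<rfloor>"
  have Jm: "J i \<le> m" if "i \<in> I" for i
    unfolding J_def m_def using wl[OF that, THEN conjunct1] wl[OF that, THEN conjunct2] l
    by (intro nat_mono floor_mono log_mono divide_pos_pos divide_right_mono) linarith+
  have Jb: "2 ^ J i * l \<le> cmod (w i - p) \<and> cmod (w i - p) < 2 ^ Suc (J i) * l" if "i \<in> I" for i
  proof -
    define x where "x = cmod (w i - p) / l"
    have x1: "x > 1" using wl[OF that] l by (simp add: x_def)
    have 1: "real (J i) = of_int \<lfloor>log 2 x\<rfloor>"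
      using x1 by (simp add: J_def x_def)
    have "2 powr real (J i) \<le> x" "x < 2 powr (real (J i) + 1)"
      using x1 unfolding 1 by (auto simp: le_log_iff[symmetric] log_less_iff[symmetric])
    then have "2 ^ J i \<le> x" "x < 2 ^ Suc (J i)"
      by (auto simp: powr_realpow powr_add)
    then show ?thesis
      using l by (simp add: x_def field_simps)
  qed
  have "(\<Sum>i\<in>I. (r i / cmod (w i - p))\<^sup>2) = (\<Sum>j\<in>{..m}. \<Sum>i\<in>{i \<in> I. J i = j}. (r i / cmod (w i - p))\<^sup>2)"
    using fin Jm by (intro sum.group[symmetric]) auto
  also have "\<dots> \<le> (\<Sum>j\<in>{..m}. real (9 * N))"
  proof (rule sum_mono)
    fix j
    define Ij where "Ij = {i \<in> I. J i = j}"
    \<comment> \<open>A centre is closer than \<open>2 * 2 ^ j * l\<close> to \<open>p\<close> and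
      its radius is at most half its distance, whence \<open>3 * 2 ^ j * l\<close>. The
      \<open>9\<close> of the conclusion is the square of this \<open>3\<close>.\<close>
    have sq: "(\<Sum>i\<in>Ij. (r i)\<^sup>2) \<le> N * (3 * 2 ^ j * l)\<^sup>2"
    proof (rule ball_packing)
      show "finite Ij" using fin by (simp add: Ij_def)
      show "0 \<le> r i" if "i \<in> Ij" for i using lam that by (simp add: Ij_def)
      show "ball (w i) (r i) \<subseteq> ball p (3 * 2 ^ j * l)" if "i \<in> Ij" for i
      proof
        fix q assume q: "q \<in> ball (w i) (r i)"
        have "cmod (p - q) \<le> cmod (w i - p) + cmod (w i - q)"
          using norm_triangle_ineq[of "p - w i" "w i - q"] by (simp add: norm_minus_commute)
        moreover have "cmod (w i - q) < r i" using q by (simp add: dist_norm)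
        moreover have "r i \<le> cmod (w i - p) / 2" "cmod (w i - p) < 2 ^ Suc j * l"
          using lam[of i] Jb[of i] that by (auto simp: Ij_def)
        ultimately show "q \<in> ball p (3 * 2 ^ j * l)" by (simp add: dist_norm)
      qed
      show "0 \<le> 3 * 2 ^ j * l" using l by simp
      show "card {i \<in> Ij. q \<in> ball (w i) (r i)} \<le> N" for q
        by (rule order_trans[OF _ N[of q]], rule card_mono) (auto simp: Ij_def fin)
    qed
    have "(\<Sum>i\<in>Ij. (r i / cmod (w i - p))\<^sup>2) \<le> (\<Sum>i\<in>Ij. (r i)\<^sup>2 / (2 ^ j * l)\<^sup>2)"
    proof (rule sum_mono)
      fix i assume i: "i \<in> Ij"
      have "2 ^ j * l \<le> cmod (w i - p)" using Jb[of i] i by (simp add: Ij_def)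
      moreover have "0 < cmod (w i - p) * (2 ^ j * l)"
        using wl[of i] i l by (intro mult_pos_pos) (auto simp: Ij_def)
      ultimately have "(r i / cmod (w i - p)) \<le> r i / (2 ^ j * l)"
        using lam[of i] i by (intro divide_left_mono) (auto simp: Ij_def)
      then have "(r i / cmod (w i - p))\<^sup>2 \<le> (r i / (2 ^ j * l))\<^sup>2"
        using lam[of i] i by (intro power_mono) (auto simp: Ij_def)
      then show "(r i / cmod (w i - p))\<^sup>2 \<le> (r i)\<^sup>2 / (2 ^ j * l)\<^sup>2" by (simp add: power_divide)
    qed
    also have "\<dots> = (\<Sum>i\<in>Ij. (r i)\<^sup>2) / (2 ^ j * l)\<^sup>2" by (rule sum_divide_distrib[symmetric])
    also have "\<dots> \<le> N * (3 * 2 ^ j * l)\<^sup>2 / (2 ^ j * l)\<^sup>2" using sq by (rule divide_right_mono) simp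
    also have "\<dots> = 9 * N" using l by (simp add: power_mult_distrib)
    finally show "(\<Sum>i\<in>{i \<in> I. J i = j}. (r i / cmod (w i - p))\<^sup>2) \<le> real (9 * N)" by (simp add: Ij_def)
  qed
  also have "\<dots> = 9 * N * (real m + 1)" by (simp add: algebra_simps)
  also have "\<dots> \<le> 9 * N * (log 2 (L / l) + 1)"
  proof (intro mult_left_mono)
    show "real m + 1 \<le> log 2 (L / l) + 1" using l by (simp add: m_def)
  qed auto
  finally show ?thesis by simp
qed

section \<open>Length and area along square contours\<close>

text \<open>The inclusions follow from a bound on the linear dilatation but avoid its suprema and infima.\<close>

definition quasiround_at :: "real \<Rightarrow> (complex \<Rightarrow> complex) \<Rightarrow> complex \<Rightarrow> bool" where
  "quasiround_at K f z \<longleftrightarrow> (\<exists>r0>0. \<forall>r. 0 < r \<and> r < r0 \<longrightarrow>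
     (\<exists>s>0. ball (f z) s \<subseteq> f ` ball z r \<and> f ` ball z r \<subseteq> cball (f z) (K * s)))"

text \<open>The boundary of the square with centre \<open>c\<close> and half-side \<open>r\<close>,
  as four quarter turns of its right side. Each side thus has a single coordinate \<open>t\<close>,
  which \<open>length_area\<close> cuts into cells.\<close>

definition square_contour :: "complex \<Rightarrow> real \<Rightarrow> complex set" where
  "square_contour c r = {c + \<i> ^ s * Complex r t |s t. s < (4::nat) \<and> \<bar>t\<bar> \<le> r}"

lemma floor_divide_close:
  fixes a b d :: real
  assumes "\<bar>a - b\<bar> < d"
  shows "\<lfloor>b / d\<rfloor> \<in> {\<lfloor>a / d\<rfloor> - 1..\<lfloor>a / d\<rfloor> + 1}"
proof -
  have d: "d > 0" using assms by linarith
  have "\<bar>a / d - b / d\<bar> < 1"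
    using assms d by (simp add: diff_divide_distrib[symmetric] abs_divide)
  then have "a / d - 1 < b / d" "b / d < a / d + 1" by linarith+
  then show ?thesis
    unfolding atLeastAtMost_iff by linarith
qed

lemma norm_ii_power [simp]: "cmod (\<i> ^ s) = 1"
  by (simp add: norm_power)

text \<open>The contours are squares instead of circles because square contours are covered by cells of equal
  side length with an explicitly bounded overlap. The radius below which the dilatation is controlled
  depends on the point, but \<open>increasing_cover_half\<close>, applied first to the values of \<open>ln \<bar>f - p\<bar>\<close> on each
  contour and then to the radii, leaves a single radius for half of the contours. For these, the
  Cauchy-Schwarz inequality compares the logarithmic lengths with the logarithmic area of the image.\<close>

lemma length_area:
  fixes f :: "complex \<Rightarrow> complex"
  assumes U: "open U" and inj: "inj_on f U" and cont: "continuous_on U f" and K: "1 \<le> K"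
    and qr: "\<And>z. z \<in> U \<Longrightarrow> quasiround_at K f z"
    and r12: "0 \<le> r1" "r1 < r2" and l: "0 < l" "l < L"
    and meet: "\<And>r v. r1 < r \<Longrightarrow> r < r2 \<Longrightarrow> l < v \<Longrightarrow> v < L \<Longrightarrow>
                 \<exists>z\<in>U \<inter> square_contour c r. cmod (f z - p) = v"
  shows "ln (L / l) \<le> 2500000 * K\<^sup>2 * (r2 / (r2 - r1))"
proof -
  \<comment> \<open>The requirement \<open>K * s \<le> l / 2\<close> keeps the image discs small
    compared with their distance from \<open>p\<close>, so that \<open>ln\<close> is nearly linear
    on them and \<open>log_packing\<close> applies.\<close>
  define good where "good k z \<longleftrightarrow> ball z (1 / real (Suc k)) \<subseteq> U \<and>
    (\<forall>r. 0 < r \<and> r \<le> 1 / real (Suc k) \<longrightarrow> (\<exists>s>0. K * s \<le> l / 2 \<and>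
      ball (f z) s \<subseteq> f ` ball z r \<and> f ` ball z r \<subseteq> cball (f z) (K * s)))" for k z
  have good_mono: "good k' z" if "good k z" "k \<le> k'" for k k' z
  proof -
    have le: "1 / real (Suc k') \<le> 1 / real (Suc k)"
      using that(2) by (simp add: frac_le)
    have "ball z (1 / real (Suc k')) \<subseteq> ball z (1 / real (Suc k))"
      using le by (rule subset_ball)
    then show ?thesis
      using that(1) le unfolding good_def by (meson order_trans)
  qed
  have good_ex: "\<exists>k. good k z" if z: "z \<in> U" for z
  proof -
    obtain r0 where r0: "r0 > 0" and r0': "\<And>r. 0 < r \<Longrightarrow> r < r0 \<Longrightarrow>
       (\<exists>s>0. ball (f z) s \<subseteq> f ` ball z r \<and> f ` ball z r \<subseteq> cball (f z) (K * s))"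
      using qr[OF z] unfolding quasiround_at_def by blast
    obtain e1 where e1: "e1 > 0" "ball z e1 \<subseteq> U"
      using U z open_contains_ball by blast
    have "isCont f z"
      using cont U z by (simp add: continuous_on_eq_continuous_at)
    moreover have "l / (2 * K) > 0"
      using l K by simp
    ultimately obtain e2 where e2: "e2 > 0" "f ` ball z e2 \<subseteq> ball (f z) (l / (2 * K))"
      unfolding continuous_at_ball by blast
    obtain k where k: "1 / real (Suc k) < min r0 (min e1 e2)"
      using nat_approx_posE[of "min r0 (min e1 e2)"] r0 e1 e2 by auto
    have "good k z"
      unfolding good_def
    proof (intro conjI allI impI)
      show "ball z (1 / real (Suc k)) \<subseteq> U"
        using e1(2) subset_ball[of "1 / real (Suc k)" e1 z] k by auto
    next
      fix r assume r: "0 < r \<and> r \<le> 1 / real (Suc k)"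
      then obtain s where s: "s > 0" "ball (f z) s \<subseteq> f ` ball z r" "f ` ball z r \<subseteq> cball (f z) (K * s)"
        using r0'[of r] k by force
      have "ball z r \<subseteq> ball z e2"
        using r k by (intro subset_ball) linarith
      then have "ball (f z) s \<subseteq> ball (f z) (l / (2 * K))"
        using s(2) e2(2) by blast
      then have "s \<le> l / (2 * K)"
        using s(1) by (simp add: ball_subset_ball_iff)
      then have "K * s \<le> l / 2"
        using K by (simp add: field_simps)
      then show "\<exists>s>0. K * s \<le> l / 2 \<and> ball (f z) s \<subseteq> f ` ball z r \<and> f ` ball z r \<subseteq> cball (f z) (K * s)"
        using s by blast
    qed
    then show ?thesis ..
  qed
  define \<Lambda> where "\<Lambda> = ln L - ln l"
  have \<Lambda>0: "\<Lambda> > 0" using l by (simp add: \<Lambda>_def)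
  define A where "A k r = {ln (cmod (f z - p)) |z. z \<in> U \<and> z \<in> square_contour c r \<and> good k z \<and>
     l < cmod (f z - p) \<and> cmod (f z - p) < L}" for k r
  have Ainc: "incseq (\<lambda>k. A k r)" for r
    unfolding incseq_def A_def using good_mono by blast
  have Acov: "{ln l<..<ln L} \<subseteq> (\<Union>k. A k r)" if "r1 < r" "r < r2" for r
  proof
    fix x assume x: "x \<in> {ln l<..<ln L}"
    have "exp (ln l) < exp x" "exp x < exp (ln L)"
      using x by auto
    then have "l < exp x" "exp x < L"
      using l by auto
    then obtain z where z: "z \<in> U \<inter> square_contour c r" "cmod (f z - p) = exp x"
      using meet[OF \<open>r1 < r\<close> \<open>r < r2\<close>] by blast
    obtain k where "good k z"
      using good_ex z by blast
    then have "x \<in> A k r"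
      unfolding A_def using z \<open>l < exp x\<close> \<open>exp x < L\<close> by (intro CollectI exI[of _ z]) auto
    then show "x \<in> (\<Union>k. A k r)" by blast
  qed
  \<comment> \<open>A condition on outer measure, phrased through measurable supersets: half of the
    logarithmic range is already attained at points that are good for \<open>k\<close>.\<close>
  define Rk where "Rk k = {r \<in> {r1<..<r2}. \<forall>V\<in>sets lborel. A k r \<subseteq> V \<longrightarrow> ennreal (\<Lambda> / 2) \<le> emeasure lborel V}" for k
  have "incseq Rk"
    unfolding incseq_def Rk_def using Ainc by (force simp: incseq_def)
  moreover have "{r1<..<r2} \<subseteq> (\<Union>k. Rk k)"
  proof
    fix r assume r: "r \<in> {r1<..<r2}"
    obtain k where "\<And>V. V \<in> sets lborel \<Longrightarrow> A k r \<subseteq> V \<Longrightarrow> ennreal ((ln L - ln l) / 2) \<le> emeasure lborel V"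
      using increasing_cover_half[OF Ainc Acov, of r] r \<Lambda>0 unfolding \<Lambda>_def by auto
    then have "r \<in> Rk k" using r by (auto simp: Rk_def \<Lambda>_def)
    then show "r \<in> (\<Union>k. Rk k)" by blast
  qed
  ultimately obtain k where k: "\<And>V. V \<in> sets lborel \<Longrightarrow> Rk k \<subseteq> V \<Longrightarrow> ennreal ((r2 - r1) / 2) \<le> emeasure lborel V"
    using increasing_cover_half r12(2) by blast
  \<comment> \<open>The number of strips of radii is so large that their width
    \<open>\<delta>\<close> is an admissible radius at all points that are good for
    \<open>k\<close>. By \<open>cardM\<close>, at least half of the strips contain a radius from
    \<open>Rk k\<close>.\<close>
  define n where "n = Suc (nat \<lceil>(r2 - r1) * real (Suc k)\<rceil>)"
  define \<delta> where "\<delta> = (r2 - r1) / real n"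
  have n0: "real n > 0" by (simp add: n_def)
  have \<delta>0: "\<delta> > 0" using r12 n0 by (simp add: \<delta>_def)
  have n\<delta>: "real n * \<delta> = r2 - r1" using n0 by (simp add: \<delta>_def)
  have \<delta>k: "\<delta> \<le> 1 / real (Suc k)"
  proof -
    have "(r2 - r1) * real (Suc k) \<le> real n"
      unfolding n_def by linarith
    then show ?thesis
      unfolding \<delta>_def using n0 by (simp add: field_simps)
  qed
  define M where "M = {m \<in> {0..<int n}. \<exists>r\<in>Rk k. \<lfloor>(r - r1) / \<delta>\<rfloor> = m}"
  have finM: "finite M" by (rule finite_subset[of _ "{0..<int n}"]) (auto simp: M_def)
  have inM: "\<lfloor>(r - r1) / \<delta>\<rfloor> \<in> M" if "r \<in> Rk k" for r
  proof -
    have "r1 < r" "r < r2" using that by (auto simp: Rk_def)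
    then have "0 \<le> (r - r1) / \<delta>" "(r - r1) / \<delta> < real n"
      using \<delta>0 n\<delta> by (auto simp: field_simps)
    then have "0 \<le> \<lfloor>(r - r1) / \<delta>\<rfloor>" "\<lfloor>(r - r1) / \<delta>\<rfloor> < int n"
      by (auto simp: floor_less_iff)
    then show ?thesis using that by (auto simp: M_def)
  qed
  have cardM: "real n \<le> 2 * real (card M)"
  proof -
    define V where "V = (\<Union>m\<in>M. {r1 + m * \<delta>..r1 + (m + 1) * \<delta>})"
    have Vs: "V \<in> sets lborel" unfolding V_def using finM by auto
    have "Rk k \<subseteq> V"
    proof
      fix r assume r: "r \<in> Rk k"
      define m where "m = \<lfloor>(r - r1) / \<delta>\<rfloor>"
      have "m \<le> (r - r1) / \<delta>" "(r - r1) / \<delta> \<le> m + 1"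
        unfolding m_def by linarith+
      then have "r \<in> {r1 + m * \<delta>..r1 + (m + 1) * \<delta>}"
        using \<delta>0 by (simp add: field_simps)
      then show "r \<in> V" using inM[OF r] unfolding V_def m_def by blast
    qed
    then have "ennreal ((r2 - r1) / 2) \<le> emeasure lborel V"
      using k Vs by blast
    also have "\<dots> \<le> (\<Sum>m\<in>M. emeasure lborel {r1 + m * \<delta>..r1 + (m + 1) * \<delta>})"
      unfolding V_def using finM by (intro emeasure_subadditive_finite) auto
    also have "\<dots> = (\<Sum>m\<in>M. ennreal \<delta>)"
      using \<delta>0 by (intro sum.cong) (auto simp: algebra_simps)
    also have "\<dots> = ennreal (card M * \<delta>)"
      using \<delta>0 by (simp add: ennreal_mult'' ennreal_of_nat_eq_real_of_nat mult.commute)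
    finally have "(r2 - r1) / 2 \<le> card M * \<delta>"
      using \<delta>0 by (simp add: ennreal_le_iff)
    then have "real n * \<delta> \<le> (2 * real (card M)) * \<delta>"
      using n\<delta> by simp
    then show ?thesis using \<delta>0 by simp
  qed
  have "\<forall>m\<in>M. \<exists>r. r \<in> Rk k \<and> \<lfloor>(r - r1) / \<delta>\<rfloor> = m" by (auto simp: M_def)
  then obtain rr where rr: "\<And>m. m \<in> M \<Longrightarrow> rr m \<in> Rk k" "\<And>m. m \<in> M \<Longrightarrow> \<lfloor>(rr m - r1) / \<delta>\<rfloor> = m"
    by metis
  \<comment> \<open>\<open>P m s j z\<close> puts a good point \<open>z\<close> into cell
    \<open>j\<close> of side \<open>s\<close> of the contour chosen in strip \<open>m\<close>. One
    such point \<open>\<zeta> m s j\<close> represents the cell, since the ball of radius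
    \<open>\<delta>\<close> about it contains the whole cell.\<close>
  define P where "P m s j z \<longleftrightarrow> good k z \<and> l < cmod (f z - p) \<and> cmod (f z - p) < L \<and>
     (\<exists>t. z = c + \<i> ^ s * Complex (rr m) t \<and> \<bar>t\<bar> \<le> rr m \<and> \<lfloor>t / \<delta>\<rfloor> = j)" for m s j z
  define q where "q = \<lceil>r2 / \<delta>\<rceil>"
  define J where "J = {- q..q}"
  define \<zeta> where "\<zeta> m s j = (SOME z. P m s j z)" for m s j
  have \<zeta>: "P m s j (\<zeta> m s j)" if "\<exists>z. P m s j z" for m s j
    unfolding \<zeta>_def using that by (rule someI_ex)
  have "\<exists>d. \<forall>m s j. (\<exists>z. P m s j z) \<longrightarrow> 0 < d m s j \<and> K * d m s j \<le> l / 2 \<and>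
      ball (f (\<zeta> m s j)) (d m s j) \<subseteq> f ` ball (\<zeta> m s j) \<delta> \<and> f ` ball (\<zeta> m s j) \<delta> \<subseteq> cball (f (\<zeta> m s j)) (K * d m s j)"
  proof -
    have "\<exists>d. (\<exists>z. P m s j z) \<longrightarrow> 0 < d \<and> K * d \<le> l / 2 \<and>
      ball (f (\<zeta> m s j)) d \<subseteq> f ` ball (\<zeta> m s j) \<delta> \<and> f ` ball (\<zeta> m s j) \<delta> \<subseteq> cball (f (\<zeta> m s j)) (K * d)" for m s j
    proof (cases "\<exists>z. P m s j z")
      case True
      then have "good k (\<zeta> m s j)" using \<zeta> by (simp add: P_def)
      then show ?thesis using \<delta>0 \<delta>k unfolding good_def by blast
    qed auto
    then show ?thesis by metis
  qed
  then obtain d where d: "\<And>m s j. \<exists>z. P m s j z \<Longrightarrow> 0 < d m s j"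
      "\<And>m s j. \<exists>z. P m s j z \<Longrightarrow> K * d m s j \<le> l / 2"
      "\<And>m s j. \<exists>z. P m s j z \<Longrightarrow> ball (f (\<zeta> m s j)) (d m s j) \<subseteq> f ` ball (\<zeta> m s j) \<delta>"
      "\<And>m s j. \<exists>z. P m s j z \<Longrightarrow> f ` ball (\<zeta> m s j) \<delta> \<subseteq> cball (f (\<zeta> m s j)) (K * d m s j)"
    by blast
  have Usub: "ball (\<zeta> m s j) \<delta> \<subseteq> U" if "\<exists>z. P m s j z" for m s j
    using \<zeta>[OF that] subset_ball[OF \<delta>k, of "\<zeta> m s j"] unfolding P_def good_def by blast
  define X where "X m s j = d m s j / cmod (f (\<zeta> m s j) - p)" for m s j
  have X0: "X m s j \<ge> 0" if "\<exists>z. P m s j z" for m s j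
    using d(1)[OF that] by (simp add: X_def)
  define D where "D m = {(s, j). s < 4 \<and> j \<in> J \<and> (\<exists>z. P m s j z)}" for m
  have Dsub: "D m \<subseteq> {..<4} \<times> J" for m by (auto simp: D_def)
  have finD: "finite (D m)" for m
    by (rule finite_subset[OF Dsub]) (auto simp: J_def)
  \<comment> \<open>The images of the chosen balls cover the attained values, so the corresponding
    intervals on the logarithmic axis have total length at least \<open>\<Lambda> / 2\<close>. The
    \<open>2\<close> in \<open>2 * K * X m s j\<close> comes from \<open>a \<ge> b / 2\<close>, that
    is, from the smallness of the discs.\<close>
  have step1: "\<Lambda> / 2 \<le> (\<Sum>(s, j)\<in>D m. 4 * K * X m s j)" if m: "m \<in> M" for m
  proof -
    define B where "B = (\<lambda>(s, j). {ln (cmod (f (\<zeta> m s j) - p)) - 2 * K * X m s j..ln (cmod (f (\<zeta> m s j) - p)) + 2 * K * X m s j})"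
    have "A k (rr m) \<subseteq> (\<Union>i\<in>D m. B i)"
    proof
      fix x assume "x \<in> A k (rr m)"
      then obtain z where z: "x = ln (cmod (f z - p))" "z \<in> square_contour c (rr m)" "good k z"
         "l < cmod (f z - p)" "cmod (f z - p) < L" by (auto simp: A_def)
      then obtain s t where st: "z = c + \<i> ^ s * Complex (rr m) t" "s < 4" "\<bar>t\<bar> \<le> rr m"
        by (auto simp: square_contour_def)
      define j where "j = \<lfloor>t / \<delta>\<rfloor>"
      have P: "P m s j z" unfolding P_def using z st j_def by blast
      have "rr m < r2" using rr(1)[OF m] by (auto simp: Rk_def)
      then have "\<bar>t / \<delta>\<bar> \<le> r2 / \<delta>" using st(3) \<delta>0 by (simp add: abs_divide divide_right_mono)
      then have "j \<in> J" unfolding J_def j_def q_def atLeastAtMost_iff by linarith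
      then have sj: "(s, j) \<in> D m" using P st by (auto simp: D_def)
      have ex: "\<exists>z. P m s j z" using P by blast
      obtain t' where t': "\<zeta> m s j = c + \<i> ^ s * Complex (rr m) t'" "\<lfloor>t' / \<delta>\<rfloor> = j"
        using \<zeta>[OF ex] by (auto simp: P_def)
      have "\<bar>t / \<delta> - t' / \<delta>\<bar> < 1" using t'(2) j_def by linarith
      then have tt: "\<bar>t' - t\<bar> < \<delta>" using \<delta>0 by (simp add: diff_divide_distrib[symmetric] abs_divide abs_minus_commute)
      have "\<zeta> m s j - z = \<i> ^ s * Complex 0 (t' - t)"
        unfolding t' st by (simp add: ring_distribs[symmetric] complex_eq_iff del: distrib_left_numeral)
      then have "cmod (\<zeta> m s j - z) = cmod (Complex 0 (t' - t))"
        by (simp only: norm_mult norm_ii_power mult_1)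
      also have "\<dots> = \<bar>t' - t\<bar>"
        by (simp add: cmod_def)
      finally have "z \<in> ball (\<zeta> m s j) \<delta>"
        using tt by (simp add: dist_norm)
      then have fz: "f z \<in> cball (f (\<zeta> m s j)) (K * d m s j)" using d(4)[OF ex] by blast
      define a where "a = cmod (f z - p)"
      define b where "b = cmod (f (\<zeta> m s j) - p)"
      have lb: "l < b" using \<zeta>[OF ex] by (simp add: P_def b_def)
      have "\<bar>a - b\<bar> \<le> cmod (f z - f (\<zeta> m s j))"
        unfolding a_def b_def using norm_triangle_ineq3[of "f z - p" "f (\<zeta> m s j) - p"] by simp
      also have "\<dots> \<le> K * d m s j" using fz by (simp add: dist_norm norm_minus_commute)
      finally have ab: "\<bar>a - b\<bar> \<le> K * d m s j" .
      have Kd: "K * d m s j \<le> l / 2" by (rule d(2)[OF ex])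
      have a2: "a \<ge> b / 2" and a0: "a > 0" using ab Kd lb l by linarith+
      have b0: "b > 0" using lb l by linarith
      have u1: "ln a - ln b \<le> (a - b) / b" and u2: "ln b - ln a \<le> (b - a) / a"
        using a0 b0 by (auto intro!: ln_diff_le)
      have "(a - b) / b \<le> K * d m s j / b" using ab b0 by (intro divide_right_mono) auto
      also have "\<dots> \<le> 2 * (K * d m s j / b)"
      proof -
        have "0 \<le> K * d m s j / b" using K d(1)[OF ex] b0 by simp
        then show ?thesis by linarith
      qed
      finally have v1: "(a - b) / b \<le> 2 * (K * d m s j / b)" .
      have "(b - a) / a \<le> K * d m s j / a" using ab a0 by (intro divide_right_mono) auto
      also have "\<dots> \<le> K * d m s j / (b / 2)" using a2 b0 K d(1)[OF ex] by (intro divide_left_mono) auto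
      also have "\<dots> = 2 * (K * d m s j / b)" by (simp add: mult.commute)
      finally have v2: "(b - a) / a \<le> 2 * (K * d m s j / b)" .
      have "2 * (K * d m s j / b) = 2 * K * X m s j" by (simp add: X_def b_def)
      then have "\<bar>ln a - ln b\<bar> \<le> 2 * K * X m s j" using u1 u2 v1 v2 by linarith
      moreover have "x = ln a" by (simp add: z a_def)
      moreover have "B (s, j) = {ln b - 2 * K * X m s j..ln b + 2 * K * X m s j}"
        by (simp add: B_def b_def)
      ultimately have "x \<in> B (s, j)" by auto
      then show "x \<in> (\<Union>i\<in>D m. B i)" using sj by blast
    qed
    moreover have "(\<Union>i\<in>D m. B i) \<in> sets lborel"
      using finD[of m] by (intro sets.finite_UN) (auto simp: B_def)
    ultimately have "ennreal (\<Lambda> / 2) \<le> emeasure lborel (\<Union>i\<in>D m. B i)"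
      using rr(1)[OF m] unfolding Rk_def by blast
    also have "\<dots> \<le> (\<Sum>i\<in>D m. emeasure lborel (B i))"
      using finD by (intro emeasure_subadditive_finite) (auto simp: B_def)
    also have "\<dots> = (\<Sum>i\<in>D m. ennreal (case i of (s, j) \<Rightarrow> 4 * K * X m s j))"
    proof (intro sum.cong refl)
      fix i assume "i \<in> D m"
      then obtain s j where i: "i = (s, j)" "\<exists>z. P m s j z" by (auto simp: D_def)
      have "0 \<le> K * X m s j" using X0[OF i(2)] K by simp
      then show "emeasure lborel (B i) = ennreal (case i of (s, j) \<Rightarrow> 4 * K * X m s j)"
        by (simp add: i B_def)
    qed
    also have "\<dots> = ennreal (\<Sum>(s, j)\<in>D m. 4 * K * X m s j)"
      using K by (intro sum_ennreal) (auto simp: D_def intro!: mult_nonneg_nonneg X0)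
    finally have *: "ennreal (\<Lambda> / 2) \<le> ennreal (\<Sum>(s, j)\<in>D m. 4 * K * X m s j)" .
    have "0 \<le> (\<Sum>(s, j)\<in>D m. 4 * K * X m s j)"
      using K by (intro sum_nonneg) (auto simp: D_def intro!: mult_nonneg_nonneg X0)
    then show ?thesis using * by (simp add: ennreal_le_iff)
  qed
  have "0 < r2 / \<delta>" using r12 \<delta>0 by simp
  then have q0: "q \<ge> 0" unfolding q_def by linarith
  have cardD: "real (card (D m)) \<le> 4 * (2 * q + 1)" for m
  proof -
    have "card (D m) \<le> card ({..<4::nat} \<times> J)"
      by (rule card_mono[OF _ Dsub]) (simp add: J_def)
    also have "\<dots> = 4 * nat (2 * q + 1)"
      by (simp add: J_def card_cartesian_product)
    finally have "real (card (D m)) \<le> real (4 * nat (2 * q + 1))"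
      by (rule of_nat_mono)
    then show ?thesis using q0 by simp
  qed
  have step2: "(\<Lambda> / (8 * K))\<^sup>2 \<le> 4 * (2 * q + 1) * (\<Sum>(s, j)\<in>D m. (X m s j)\<^sup>2)" if m: "m \<in> M" for m
  proof -
    define S where "S = (\<Sum>(s, j)\<in>D m. X m s j)"
    have "(\<Sum>(s, j)\<in>D m. 4 * K * X m s j) = 4 * K * S"
      unfolding S_def by (simp add: sum_distrib_left case_prod_unfold)
    then have "\<Lambda> / (8 * K) \<le> S"
      using step1[OF m] K by (simp add: field_simps)
    then have "(\<Lambda> / (8 * K))\<^sup>2 \<le> S\<^sup>2"
      using \<Lambda>0 K by (intro power_mono) auto
    also have "S\<^sup>2 \<le> (\<Sum>i\<in>D m. (case i of (s, j) \<Rightarrow> X m s j)\<^sup>2) * card (D m)"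
      unfolding S_def by (rule sum_squared_le_sum_of_squares)
    also have "\<dots> \<le> (\<Sum>i\<in>D m. (case i of (s, j) \<Rightarrow> X m s j)\<^sup>2) * (4 * (2 * q + 1))"
      using cardD by (intro mult_left_mono sum_nonneg) auto
    finally show ?thesis by (simp add: mult.commute case_prod_unfold)
  qed
  define E where "E s = {(m, j). m \<in> M \<and> j \<in> J \<and> (\<exists>z. P m s j z)}" for s
  have finE: "finite (E s)" for s
    by (rule finite_subset[of _ "M \<times> J"]) (auto simp: E_def finM J_def)
  \<comment> \<open>The overlap is counted before \<open>f\<close> is applied: by injectivity a
    common point of several image discs comes from a single \<open>x\<close>, and on a fixed side
    the centres within \<open>\<delta>\<close> of \<open>x\<close> allow three strips and three
    cells, hence \<open>9\<close>.\<close>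
  have step3: "(\<Sum>(m, j)\<in>E s. (X m s j)\<^sup>2) \<le> 9 * 9 * (log 2 (L / l) + 1)" for s
  proof -
    have "(\<Sum>i\<in>E s. ((case i of (m, j) \<Rightarrow> d m s j) / cmod ((case i of (m, j) \<Rightarrow> f (\<zeta> m s j)) - p))\<^sup>2) \<le> 9 * real 9 * (log 2 (L / l) + 1)"
    proof (rule log_packing[OF finE l])
      fix i assume "i \<in> E s"
      then obtain m j where i: "i = (m, j)" "\<exists>z. P m s j z" by (auto simp: E_def)
      have P: "P m s j (\<zeta> m s j)" using \<zeta>[OF i(2)] .
      then show "l < cmod ((case i of (m, j) \<Rightarrow> f (\<zeta> m s j)) - p) \<and> cmod ((case i of (m, j) \<Rightarrow> f (\<zeta> m s j)) - p) < L"
        by (simp add: P_def i)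
      have "1 * d m s j \<le> K * d m s j" using K d(1)[OF i(2)] by (intro mult_right_mono) auto
      then have "2 * d m s j \<le> l" using d(2)[OF i(2)] by linarith
      then show "0 \<le> (case i of (m, j) \<Rightarrow> d m s j) \<and> (case i of (m, j) \<Rightarrow> d m s j) \<le> cmod ((case i of (m, j) \<Rightarrow> f (\<zeta> m s j)) - p) / 2"
        using P d(1,2)[OF i(2)] by (simp add: P_def i)
    next
      fix y
      let ?S = "{i \<in> E s. y \<in> ball (case i of (m, j) \<Rightarrow> f (\<zeta> m s j)) (case i of (m, j) \<Rightarrow> d m s j)}"
      have pre: "\<exists>x. x \<in> U \<and> y = f x \<and> x \<in> ball (\<zeta> m s j) \<delta>" if "(m, j) \<in> ?S" for m j
      proof -
        have ex: "\<exists>z. P m s j z" using that by (auto simp: E_def)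
        have "y \<in> f ` ball (\<zeta> m s j) \<delta>" using that d(3)[OF ex] by auto
        then show ?thesis using Usub[OF ex] by blast
      qed
      show "card ?S \<le> 9"
      proof (cases "?S = {}")
        case False
        then obtain x where x: "x \<in> U" "y = f x" using pre by fast
        define \<xi> where "\<xi> = (x - c) / \<i> ^ s"
        define M0 where "M0 = \<lfloor>(Re \<xi> - r1) / \<delta>\<rfloor>"
        define J0 where "J0 = \<lfloor>Im \<xi> / \<delta>\<rfloor>"
        have "?S \<subseteq> {M0 - 1..M0 + 1} \<times> {J0 - 1..J0 + 1}"
        proof
          fix i assume i: "i \<in> ?S"
          obtain m j where mj: "i = (m, j)" by force
          have ex: "\<exists>z. P m s j z" and mM: "m \<in> M" using i by (auto simp: E_def mj)
          have "x \<in> ball (\<zeta> m s j) \<delta>"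
            using pre[of m j] i x inj unfolding mj by (metis inj_onD)
          obtain t where t: "\<zeta> m s j = c + \<i> ^ s * Complex (rr m) t" "\<lfloor>t / \<delta>\<rfloor> = j"
            using \<zeta>[OF ex] by (auto simp: P_def)
          have "x - \<zeta> m s j = \<i> ^ s * (\<xi> - Complex (rr m) t)"
            unfolding t \<xi>_def by (simp add: right_diff_distrib diff_divide_distrib)
          then have "cmod (x - \<zeta> m s j) = cmod (\<xi> - Complex (rr m) t)"
            by (simp add: norm_mult)
          then have lt: "cmod (\<xi> - Complex (rr m) t) < \<delta>"
            using \<open>x \<in> ball (\<zeta> m s j) \<delta>\<close> by (simp add: dist_norm norm_minus_commute)
          have "\<bar>(Re \<xi> - r1) - (rr m - r1)\<bar> < \<delta>" "\<bar>Im \<xi> - t\<bar> < \<delta>"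
            using lt abs_Re_le_cmod[of "\<xi> - Complex (rr m) t"] abs_Im_le_cmod[of "\<xi> - Complex (rr m) t"] by auto
          then have "m \<in> {M0 - 1..M0 + 1}" "j \<in> {J0 - 1..J0 + 1}"
            using floor_divide_close rr(2)[OF mM] t(2) unfolding M0_def J0_def by metis+
          then show "i \<in> {M0 - 1..M0 + 1} \<times> {J0 - 1..J0 + 1}" by (simp add: mj)
        qed
        then have "card ?S \<le> card ({M0 - 1..M0 + 1} \<times> {J0 - 1..J0 + 1})"
          by (intro card_mono) auto
        then show ?thesis by (simp add: card_cartesian_product)
      next
        case True
        show ?thesis unfolding True by simp
      qed
    qed
    then show ?thesis by (simp add: X_def case_prod_unfold)
  qed
  have swap: "(\<Sum>m\<in>M. \<Sum>(s, j)\<in>D m. (X m s j)\<^sup>2) = (\<Sum>s<4. \<Sum>(m, j)\<in>E s. (X m s j)\<^sup>2)"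
  proof -
    define Y where "Y m s j = (if \<exists>z. P m s j z then (X m s j)\<^sup>2 else 0)" for m s j
    have finJ: "finite J" by (simp add: J_def)
    have 1: "(\<Sum>(s, j)\<in>D m. (X m s j)\<^sup>2) = (\<Sum>s<4. \<Sum>j\<in>J. Y m s j)" for m
      unfolding sum.cartesian_product
      by (rule sum.mono_neutral_cong_left) (auto simp: D_def Y_def finJ split: if_splits)
    have 2: "(\<Sum>(m, j)\<in>E s. (X m s j)\<^sup>2) = (\<Sum>m\<in>M. \<Sum>j\<in>J. Y m s j)" for s
      unfolding sum.cartesian_product
      by (rule sum.mono_neutral_cong_left) (auto simp: E_def Y_def finJ finM split: if_splits)
    show ?thesis unfolding 1 2 by (rule sum.swap)
  qed
  define \<rho> where "\<rho> = r2 / (r2 - r1)"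
  have \<rho>1: "\<rho> \<ge> 1" using r12 by (simp add: \<rho>_def)
  define T where "T = log 2 (L / l) + 1"
  have n1: "real n \<ge> 1" by (simp add: n_def)
  have "real n / 2 * (\<Lambda> / (8 * K))\<^sup>2 \<le> card M * (\<Lambda> / (8 * K))\<^sup>2"
    using cardM by (intro mult_right_mono) auto
  also have "\<dots> = (\<Sum>m\<in>M. (\<Lambda> / (8 * K))\<^sup>2)" by simp
  also have "\<dots> \<le> (\<Sum>m\<in>M. 4 * (2 * q + 1) * (\<Sum>(s, j)\<in>D m. (X m s j)\<^sup>2))"
    by (rule sum_mono) (rule step2)
  also have "\<dots> = 4 * (2 * q + 1) * (\<Sum>s<4. \<Sum>(m, j)\<in>E s. (X m s j)\<^sup>2)"
    by (simp add: sum_distrib_left[symmetric] swap)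
  also have "\<dots> \<le> 4 * (2 * q + 1) * (\<Sum>s<(4::nat). 81 * T)"
    using q0 step3 by (intro mult_left_mono sum_mono) (auto simp: T_def)
  also have "\<dots> = 1296 * T * (2 * q + 1)" by simp
  also have "\<dots> \<le> 1296 * T * (5 * real n * \<rho>)"
  proof (intro mult_left_mono)
    have "r2 / \<delta> = real n * \<rho>" using n0 r12 by (simp add: \<delta>_def \<rho>_def)
    moreover have "real n * \<rho> \<ge> 1" using mult_mono[OF n1 \<rho>1] n1 by simp
    moreover have "q \<le> r2 / \<delta> + 1" unfolding q_def by linarith
    ultimately show "2 * q + 1 \<le> 5 * real n * \<rho>" by simp
    show "0 \<le> 1296 * T" using l by (simp add: T_def)
  qed
  finally have "real n * (\<Lambda>\<^sup>2 / (128 * K\<^sup>2)) \<le> real n * (6480 * T * \<rho>)"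
    by (simp add: power_divide power_mult_distrib algebra_simps)
  then have "\<Lambda>\<^sup>2 / (128 * K\<^sup>2) \<le> 6480 * T * \<rho>" using n0 by (rule mult_left_le_imp_le)
  then have main: "\<Lambda>\<^sup>2 \<le> 829440 * K\<^sup>2 * \<rho> * T" using K by (simp add: field_simps)
  have lnL: "ln (L / l) = \<Lambda>" using l by (simp add: \<Lambda>_def ln_div)
  have T2: "T \<le> 2 * \<Lambda> + 1"
  proof -
    have ln2: "ln 2 \<ge> (1/2 :: real)" using ln2_ge_two_thirds by linarith
    have "log 2 (L / l) = \<Lambda> / ln 2" by (simp add: log_def lnL)
    also have "\<dots> \<le> \<Lambda> / (1/2)" using ln2 \<Lambda>0 by (intro divide_left_mono) auto
    finally show ?thesis by (simp add: T_def)
  qed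
  have KR: "K\<^sup>2 * \<rho> \<ge> 1" using K \<rho>1 mult_mono[of 1 "K\<^sup>2" 1 \<rho>] by (simp add: one_le_power)
  \<comment> \<open>The area bound \<open>T\<close> is at most \<open>3 * \<Lambda>\<close> when
    \<open>\<Lambda> \<ge> 1\<close>, and one factor cancels: \<open>3 * 829440 = 2488320\<close>.
    For \<open>\<Lambda> < 1\<close> it suffices that
    \<open>K\<^sup>2 * \<rho> \<ge> 1\<close>.\<close>
  show ?thesis
  proof (cases "\<Lambda> \<ge> 1")
    case True
    have "\<Lambda> * \<Lambda> \<le> 829440 * (K\<^sup>2 * \<rho>) * T" using main by (simp add: power2_eq_square mult.assoc)
    also have "\<dots> \<le> 829440 * (K\<^sup>2 * \<rho>) * (3 * \<Lambda>)" using T2 True KR by (intro mult_left_mono) auto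
    finally have "\<Lambda> * \<Lambda> \<le> (2488320 * (K\<^sup>2 * \<rho>)) * \<Lambda>" by simp
    then have "\<Lambda> \<le> 2488320 * (K\<^sup>2 * \<rho>)" using \<Lambda>0 by simp
    then show ?thesis using KR unfolding lnL \<rho>_def[symmetric] by simp
  next
    case False
    then show ?thesis using KR unfolding lnL \<rho>_def[symmetric] by simp
  qed
qed

section \<open>Bounded turning of quasicircles\<close>

text \<open>By invariance of domain the image of the open ball is open, so its frontier lies in the
  image of the sphere. A connected set disjoint from this frontier lies on one side of it; this is
  used for the disc of radius \<open>a\<close> and for the complement of the disc of radius
  \<open>b\<close>.\<close>

lemma ball_image_bounds:
  fixes f :: "complex \<Rightarrow> complex"
  assumes U: "open U" and cont: "continuous_on U f" and inj: "inj_on f U"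
    and sub: "cball z r \<subseteq> U" and r: "0 < r"
    and ab: "\<And>w. w \<in> sphere z r \<Longrightarrow> a \<le> cmod (f w - f z) \<and> cmod (f w - f z) \<le> b"
  shows "ball (f z) a \<subseteq> f ` ball z r" and "f ` ball z r \<subseteq> cball (f z) b"
proof -
  have cb: "continuous_on (cball z r) f" "inj_on f (cball z r)"
    by (rule continuous_on_subset[OF cont sub], rule inj_on_subset[OF inj sub])
  have bo: "open (f ` ball z r)"
    by (intro invariance_of_domain continuous_on_subset[OF cb(1)] inj_on_subset[OF cb(2)]) auto
  have cpt: "compact (f ` cball z r)"
    using cb by (intro compact_continuous_image) auto
  have "closure (f ` ball z r) \<subseteq> f ` cball z r"
    by (rule closure_minimal) (use cpt compact_imp_closed in auto)
  then have "frontier (f ` ball z r) \<subseteq> f ` cball z r - f ` ball z r"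
    using bo unfolding frontier_def by (simp add: interior_open Diff_mono)
  also have "\<dots> \<subseteq> f ` sphere z r"
    by force
  finally have fr: "frontier (f ` ball z r) \<subseteq> f ` sphere z r" .
  show "ball (f z) a \<subseteq> f ` ball z r"
  proof (rule ccontr)
    assume n: "\<not> ?thesis"
    have "ball (f z) a \<inter> frontier (f ` ball z r) \<noteq> {}"
    proof (rule connected_Int_frontier)
      have "ball (f z) a \<noteq> {}" using n by blast
      then have "f z \<in> ball (f z) a" by (simp add: ball_eq_empty)
      moreover have "f z \<in> f ` ball z r" using r by auto
      ultimately show "ball (f z) a \<inter> f ` ball z r \<noteq> {}" by (metis IntI empty_iff)
    qed (use n in auto)
    then obtain w where "w \<in> sphere z r" "f w \<in> ball (f z) a" using fr by blast
    then show False using ab[of w] by (simp add: dist_norm norm_minus_commute)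
  qed
  show "f ` ball z r \<subseteq> cball (f z) b"
  proof (rule ccontr)
    assume n: "\<not> ?thesis"
    have bd: "bounded (f ` ball z r)"
      by (rule bounded_subset[OF compact_imp_bounded[OF cpt]]) auto
    have "- cball (f z) b \<inter> frontier (f ` ball z r) \<noteq> {}"
    proof (rule connected_Int_frontier)
      show "connected (- cball (f z) b)"
        by (rule connected_complement_bounded_convex) auto
      show "- cball (f z) b \<inter> f ` ball z r \<noteq> {}" using n by blast
      have "\<not> bounded (- cball (f z) b)"
        by (rule cobounded_imp_unbounded) auto
      then show "- cball (f z) b - f ` ball z r \<noteq> {}"
        using bounded_subset[OF bd] by (metis Diff_eq_empty_iff)
    qed
    then obtain w where "w \<in> sphere z r" "f w \<in> - cball (f z) b" using fr by blast
    then show False using ab[of w] by (simp add: dist_norm norm_minus_commute)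
  qed
qed

text \<open>Close to \<open>z\<close> the error of the linear approximation is at most half of the
  linear term, so the distances on a small circle lie between one half and three halves of
  \<open>cmod c * r\<close>.\<close>

lemma quasiround_conformal:
  assumes U: "open U" and hol: "f holomorphic_on U" and inj: "inj_on f U" and z: "z \<in> U"
  shows "quasiround_at 3 f z"
proof -
  define c where "c = deriv f z"
  have c0: "c \<noteq> 0"
    unfolding c_def using holomorphic_injective_imp_regular[OF hol U inj z] .
  have "(f has_field_derivative c) (at z)"
    using holomorphic_derivI[OF hol U z] by (simp add: c_def)
  then have "(f has_derivative (\<lambda>h. c * h)) (at z)"
    by (simp add: has_field_derivative_def)
  then obtain e where e: "e > 0" "\<And>y. norm (y - z) < e \<Longrightarrow> norm (f y - f z - c * (y - z)) \<le> cmod c / 2 * norm (y - z)"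
    unfolding has_derivative_at_alt using c0 by (meson half_gt_zero zero_less_norm_iff)
  obtain e' where e': "e' > 0" "ball z e' \<subseteq> U" using U z open_contains_ball by blast
  show ?thesis
    unfolding quasiround_at_def
  proof (rule exI[of _ "min e e'"], intro conjI allI impI)
    fix r assume r: "0 < r \<and> r < min e e'"
    have sub: "cball z r \<subseteq> U" using e'(2) r by (auto simp: subset_eq)
    have ab: "cmod c * r / 2 \<le> cmod (f w - f z) \<and> cmod (f w - f z) \<le> 3 * (cmod c * r / 2)" if w: "w \<in> sphere z r" for w
    proof -
      have rw: "cmod (w - z) = r" using w by (simp add: dist_norm norm_minus_commute)
      have 1: "norm (f w - f z - c * (w - z)) \<le> cmod c / 2 * r" using e(2)[of w] r rw by auto
      have 2: "cmod (c * (w - z)) = cmod c * r" by (simp add: norm_mult rw)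
      have 3: "cmod (c * (w - z)) \<le> cmod (f w - f z) + norm (f w - f z - c * (w - z))"
        using norm_triangle_ineq4[of "f w - f z" "f w - f z - c * (w - z)"] by simp
      have 4: "cmod (f w - f z) \<le> cmod (c * (w - z)) + norm (f w - f z - c * (w - z))"
        using norm_triangle_ineq[of "c * (w - z)" "f w - f z - c * (w - z)"] by simp
      show ?thesis using 1 2 3 4 by linarith
    qed
    show "\<exists>s>0. ball (f z) s \<subseteq> f ` ball z r \<and> f ` ball z r \<subseteq> cball (f z) (3 * s)"
      using ball_image_bounds[OF U holomorphic_on_imp_continuous_on[OF hol] inj sub _ ab] r c0
      by (intro exI[of _ "cmod c * r / 2"]) auto
  qed (use e e' in auto)
qed

lemma quasiround_quasiconformal:
  assumes "quasiconformal_plane f"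
  obtains K where "1 \<le> K" "\<And>z. quasiround_at K f z"
proof -
  obtain h K0 where h: "homeomorphism UNIV UNIV f h" and K0: "\<And>z. Limsup (at_right 0)
        (\<lambda>r. ereal ((SUP w\<in>sphere z r. cmod (f w - f z)) / (INF w\<in>sphere z r. cmod (f w - f z)))) \<le> ereal K0"
    using assms unfolding quasiconformal_plane_def by blast
  have cont: "continuous_on UNIV f" using h by (rule homeomorphism_cont1)
  have inj: "inj_on f UNIV" using h by (metis homeomorphism_apply1 inj_onI)
  \<comment> \<open>The limit superior is only known to be at most \<open>K0\<close>; the added
    \<open>1\<close> gives a strict bound at all small radii, and the maximum ensures
    \<open>1 \<le> K\<close>.\<close>
  define K where "K = max 1 (K0 + 1)"
  have "quasiround_at K f z" for z
  proof -
    have "Limsup (at_right 0) (\<lambda>r. ereal ((SUP w\<in>sphere z r. cmod (f w - f z)) / (INF w\<in>sphere z r. cmod (f w - f z)))) < ereal (K0 + 1)"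
      using K0[of z] by (rule le_less_trans) simp
    then have "\<forall>\<^sub>F r in at_right 0. ereal ((SUP w\<in>sphere z r. cmod (f w - f z)) / (INF w\<in>sphere z r. cmod (f w - f z))) < ereal (K0 + 1)"
      by (rule Limsup_lessD)
    then obtain r0 where r0: "r0 > 0" "\<And>r. 0 < r \<Longrightarrow> r < r0 \<Longrightarrow>
       (SUP w\<in>sphere z r. cmod (f w - f z)) / (INF w\<in>sphere z r. cmod (f w - f z)) < K0 + 1"
      unfolding eventually_at_right_field by auto
    show ?thesis
      unfolding quasiround_at_def
    proof (rule exI[of _ r0], intro conjI allI impI)
      fix r assume r: "0 < r \<and> r < r0"
      define a where "a = (INF w\<in>sphere z r. cmod (f w - f z))"
      define b where "b = (SUP w\<in>sphere z r. cmod (f w - f z))"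
      have ne: "sphere z r \<noteq> {}" using r by simp
      have cs: "continuous_on (sphere z r) (\<lambda>w. cmod (f w - f z))"
        by (intro continuous_intros continuous_on_subset[OF cont]) auto
      have bdd: "bdd_above ((\<lambda>w. cmod (f w - f z)) ` sphere z r)" "bdd_below ((\<lambda>w. cmod (f w - f z)) ` sphere z r)"
        using compact_imp_bounded[OF compact_continuous_image[OF cs]]
        by (auto intro: bounded_imp_bdd_above bounded_imp_bdd_below)
      have ab: "a \<le> cmod (f w - f z) \<and> cmod (f w - f z) \<le> b" if "w \<in> sphere z r" for w
        unfolding a_def b_def using that bdd by (auto intro!: cINF_lower cSUP_upper)
      obtain w0 where w0: "w0 \<in> sphere z r" "\<And>w. w \<in> sphere z r \<Longrightarrow> cmod (f w0 - f z) \<le> cmod (f w - f z)"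
        using continuous_attains_inf[OF _ ne cs] by auto
      have "cmod (f w0 - f z) \<le> a"
        unfolding a_def using w0 ne by (intro cINF_greatest) auto
      moreover have "f w0 \<noteq> f z"
        using inj w0(1) r by (auto simp: inj_on_def dist_norm)
      ultimately have a0: "a > 0" by (meson less_le_trans zero_less_norm_iff right_minus_eq)
      have "b / a < K0 + 1" using r0(2)[of r] r by (simp add: a_def b_def)
      then have "b < (K0 + 1) * a" using a0 by (simp add: field_simps)
      also have "\<dots> \<le> K * a" using a0 by (intro mult_right_mono) (auto simp: K_def)
      finally have bK: "b \<le> K * a" by simp
      have "ball (f z) a \<subseteq> f ` ball z r" "f ` ball z r \<subseteq> cball (f z) b"
        using ball_image_bounds[OF open_UNIV cont inj _ _ ab] r by auto
      then show "\<exists>s>0. ball (f z) s \<subseteq> f ` ball z r \<and> f ` ball z r \<subseteq> cball (f z) (K * s)"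
        using a0 bK subset_cball[OF bK, of "f z"] by blast
    qed (use r0 in auto)
  qed
  then show thesis using that[of K] by (simp add: K_def)
qed

section \<open>The maximum norm, whose spheres are the square contours, and the turning of
  quasicircles\<close>

definition supn :: "complex \<Rightarrow> real" where
  "supn z = max \<bar>Re z\<bar> \<bar>Im z\<bar>"

lemma continuous_supn [continuous_intros]: "continuous_on A f \<Longrightarrow> continuous_on A (\<lambda>x. supn (f x))"
  unfolding supn_def by (intro continuous_on_max continuous_on_rabs continuous_on_Re continuous_on_Im)

lemma supn_of_real [simp]: "supn (of_real x) = \<bar>x\<bar>"
  by (simp add: supn_def)

lemma norm_le_supn: "cmod z \<le> 2 * supn z"
  using cmod_le[of z] unfolding supn_def by linarith

lemma supn_square_contour: "supn (z - c) = r \<Longrightarrow> z \<in> square_contour c r"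
proof -
  assume r: "supn (z - c) = r"
  define x where "x = Re z - Re c"
  define y where "y = Im z - Im c"
  have m: "max \<bar>x\<bar> \<bar>y\<bar> = r" using r by (simp add: supn_def x_def y_def)
  consider "x = r" | "x = - r" | "y = r" | "y = - r" using m by linarith
  then obtain s t where "s < (4::nat)" "\<bar>t\<bar> \<le> r" "z = c + \<i> ^ s * Complex r t"
  proof cases
    case 1 then show ?thesis using m by (intro that[of 0 y]) (auto simp: complex_eq_iff x_def y_def)
  next
    case 2 then show ?thesis using m by (intro that[of 2 "- y"]) (auto simp: complex_eq_iff x_def y_def)
  next
    case 3 then show ?thesis using m by (intro that[of 1 "- x"]) (auto simp: complex_eq_iff x_def y_def)
  next
    case 4 then show ?thesis using m by (intro that[of 3 x]) (auto simp: complex_eq_iff x_def y_def power3_eq_cube)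
  qed
  then show ?thesis unfolding square_contour_def by blast
qed

lemma connected_supn_sphere:
  assumes "0 < r"
  shows "connected {z. supn (z - c) = r}"
proof -
  have eq: "{z. supn (z - c) = r} = path_image (rectpath (c - Complex r r) (c + Complex r r))"
  proof (rule set_eqI)
    fix z
    define x where "x = Re z - Re c"
    define y where "y = Im z - Im c"
    have "z \<in> path_image (rectpath (c - Complex r r) (c + Complex r r)) \<longleftrightarrow>
      (x = - r \<or> x = r) \<and> - r \<le> y \<and> y \<le> r \<or> - r \<le> x \<and> x \<le> r \<and> (y = - r \<or> y = r)"
      using assms by (subst path_image_rectpath) (auto simp: x_def y_def algebra_simps)
    also have "\<dots> \<longleftrightarrow> max \<bar>x\<bar> \<bar>y\<bar> = r"
      using assms by linarith
    finally show "z \<in> {z. supn (z - c) = r} \<longleftrightarrow> z \<in> path_image (rectpath (c - Complex r r) (c + Complex r r))"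
      by (simp add: supn_def x_def y_def)
  qed
  show ?thesis
    unfolding eq by (rule connected_path_image[OF path_rectpath])
qed

lemma connected_attains:
  fixes u :: "'a::topological_space \<Rightarrow> real"
  assumes "connected S" "continuous_on S u" "a \<in> S" "b \<in> S" "u a \<le> v" "v \<le> u b"
  shows "\<exists>z\<in>S. u z = v"
proof -
  have "v \<in> u ` S"
    by (rule connectedD_interval[OF connected_continuous_image[OF assms(2,1)], of "u a" "u b"]) (use assms in auto)
  then show ?thesis by auto
qed

text \<open>The set \<open>E\<close> joins \<open>x\<close> to \<open>b\<close> where
  \<open>f\<close> is close to \<open>f x\<close>, and \<open>F\<close> joins \<open>w\<close> to
  infinity where \<open>f\<close> is far from it. Each square contour about \<open>x\<close> with
  half-side between \<open>\<bar>w - x\<bar>\<close> and \<open>\<bar>b - x\<bar>\<close> meets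
  both, so the distance to \<open>f x\<close> takes all values between \<open>l\<close> and
  \<open>L\<close> on it. Since these half-sides extend over a factor of at least two,
  \<open>length_area\<close> bounds \<open>L / l\<close>.\<close>

lemma quasicircle_half_turning:
  assumes hom: "homeomorphism UNIV UNIV f h" and K: "1 \<le> K" and qr: "\<And>z. quasiround_at K f z"
    and w: "\<bar>w - x\<bar> \<le> \<bar>b - x\<bar> / 2"
  shows "cmod (f (of_real w) - f (of_real x)) \<le> exp (5000000 * K\<^sup>2) * cmod (f (of_real b) - f (of_real x))"
proof -
  have cont: "continuous_on A f" "continuous_on A h" for A
    using hom by (auto simp: homeomorphism_def intro: continuous_on_subset)
  have hf: "h (f z) = z" and fh: "f (h z) = z" for z
    using hom by (auto simp: homeomorphism_def)
  have inj: "inj_on f UNIV" using hf by (metis inj_onI)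
  define l where "l = cmod (f (of_real b) - f (of_real x))"
  define L where "L = cmod (f (of_real w) - f (of_real x))"
  show ?thesis
  proof (cases "L \<le> l")
    case True
    have "1 * l \<le> exp (5000000 * K\<^sup>2) * l" by (intro mult_right_mono) (auto simp: l_def)
    then show ?thesis using True by (simp add: l_def L_def)
  next
    case False
    have xb: "x \<noteq> b" using w False by (auto simp: l_def L_def)
    then have l0: "l > 0" unfolding l_def using hf by (metis of_real_eq_iff right_minus_eq zero_less_norm_iff)
    define E where "E = h ` cball (f (of_real x)) l"
    define F where "F = h ` (- ball (f (of_real x)) L)"
    have connE: "connected E" unfolding E_def by (intro connected_continuous_image cont) auto
    have connF: "connected F" unfolding F_def
      by (intro connected_continuous_image cont connected_complement_bounded_convex) auto
    have xE: "of_real x \<in> E" unfolding E_def using l0 hf by (metis centre_in_cball image_eqI less_imp_le)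
    have bE: "of_real b \<in> E"
      unfolding E_def by (rule image_eqI[of _ _ "f (of_real b)"]) (auto simp: hf l_def dist_norm norm_minus_commute)
    have wF: "of_real w \<in> F"
      unfolding F_def by (rule image_eqI[of _ _ "f (of_real w)"]) (auto simp: hf L_def dist_norm norm_minus_commute)
    have unbF: "\<not> bounded F"
    proof
      assume "bounded F"
      then have "compact (f ` closure F)" by (intro compact_continuous_image cont) (simp add: compact_closure)
      then have "bounded (f ` closure F)" by (rule compact_imp_bounded)
      moreover have "- ball (f (of_real x)) L \<subseteq> f ` closure F"
      proof
        fix y assume "y \<in> - ball (f (of_real x)) L"
        then have "h y \<in> F" unfolding F_def by (rule imageI)
        then have "h y \<in> closure F" using closure_subset[of F] by (rule subsetD[rotated])
        then show "y \<in> f ` closure F" using fh by (metis image_eqI)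
      qed
      ultimately have "bounded (- ball (f (of_real x)) L)" using bounded_subset by blast
      moreover have "\<not> bounded (- ball (f (of_real x)) L)" by (rule cobounded_imp_unbounded) auto
      ultimately show False by blast
    qed
    have meet: "\<exists>z\<in>UNIV \<inter> square_contour (of_real x) r. cmod (f z - f (of_real x)) = v"
      if r: "\<bar>w - x\<bar> < r" "r < \<bar>b - x\<bar>" and v: "l < v" "v < L" for r v
    proof -
      have cn: "continuous_on S (\<lambda>z. supn (z - of_real x))" for S by (intro continuous_intros)
      have "supn (of_real b - of_real x) = \<bar>b - x\<bar>" "supn (of_real w - of_real x) = \<bar>w - x\<bar>"
        by (metis of_real_diff supn_of_real)+
      note sn = this
      have "0 < r" using r by linarith
      obtain z1 where z1: "z1 \<in> E" "supn (z1 - of_real x) = r"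
        using connected_attains[OF connE cn xE bE, of r] \<open>0 < r\<close> r sn by (auto simp: supn_def)
      have "\<exists>z\<in>F. r \<le> supn (z - of_real x)"
      proof (rule ccontr)
        assume n: "\<not> (\<exists>z\<in>F. r \<le> supn (z - of_real x))"
        have "F \<subseteq> cball (of_real x) (2 * r)"
        proof (intro subsetI)
          fix z assume "z \<in> F"
          then have "supn (z - of_real x) \<le> r" using n by force
          then show "z \<in> cball (of_real x) (2 * r)"
            using norm_le_supn[of "z - of_real x"] by (simp add: dist_norm norm_minus_commute)
        qed
        then show False using unbF bounded_cball bounded_subset by blast
      qed
      then obtain z3 where z3: "z3 \<in> F" "r \<le> supn (z3 - of_real x)" by blast
      obtain z2 where z2: "z2 \<in> F" "supn (z2 - of_real x) = r"
        using connected_attains[OF connF cn wF z3(1), of r] r sn z3 by auto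
      have "cmod (f z1 - f (of_real x)) \<le> l" using z1(1) fh by (auto simp: E_def dist_norm norm_minus_commute)
      moreover have "L \<le> cmod (f z2 - f (of_real x))" using z2(1) fh by (auto simp: F_def dist_norm norm_minus_commute)
      moreover have "continuous_on S (\<lambda>z. cmod (f z - f (of_real x)))" for S
        by (intro continuous_intros cont)
      ultimately obtain z where "supn (z - of_real x) = r" "cmod (f z - f (of_real x)) = v"
        using connected_attains[OF connected_supn_sphere[OF \<open>0 < r\<close>, of "of_real x"], of "\<lambda>z. cmod (f z - f (of_real x))" z1 z2 v]
          z1(2) z2(2) v by auto
      then show ?thesis using supn_square_contour by blast
    qed
    define u where "u = \<bar>w - x\<bar>"
    define t where "t = \<bar>b - x\<bar>"
    have ut: "0 \<le> u" "0 < t" "2 * u \<le> t" using w xb by (auto simp: u_def t_def)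
    have "ln (L / l) \<le> 2500000 * K\<^sup>2 * (t / (t - u))"
    proof (rule length_area[OF open_UNIV inj cont(1) K qr _ _ l0])
      show "\<exists>z\<in>UNIV \<inter> square_contour (of_real x) r. cmod (f z - f (of_real x)) = v"
        if "u < r" "r < t" "l < v" "v < L" for r v
        using meet that by (simp only: u_def t_def)
    qed (use ut False in auto)
    also have "\<dots> \<le> 2500000 * K\<^sup>2 * 2"
    proof (rule mult_left_mono)
      show "t / (t - u) \<le> 2" using ut by (simp add: pos_divide_le_eq)
    qed simp
    finally have "ln (L / l) \<le> 5000000 * K\<^sup>2" by simp
    moreover have "L / l > 0" using False l0 by simp
    ultimately have "L / l \<le> exp (5000000 * K\<^sup>2)"
      by (metis exp_le_cancel_iff exp_ln)
    then show ?thesis using l0 by (simp add: field_simps l_def L_def)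
  qed
qed

text \<open>For points in the half of the segment near \<open>b\<close> the roles of
  \<open>x\<close> and \<open>b\<close> are exchanged; the triangle inequality then adds the
  \<open>1\<close> to \<open>D\<close>.\<close>

lemma quasiconformal_bounded_turning:
  assumes "quasiconformal_plane f"
  obtains C where "1 \<le> C" "\<And>x b w :: real. w \<in> closed_segment x b \<Longrightarrow>
     cmod (f (of_real w) - f (of_real x)) \<le> C * cmod (f (of_real b) - f (of_real x))"
proof -
  obtain h where h: "homeomorphism UNIV UNIV f h" using assms quasiconformal_plane_def by blast
  obtain K where K: "1 \<le> K" "\<And>z. quasiround_at K f z"
    using quasiround_quasiconformal[OF assms] by blast
  define D where "D = exp (5000000 * K\<^sup>2)"
  have *: "cmod (f (of_real w) - f (of_real x)) \<le> (1 + D) * cmod (f (of_real b) - f (of_real x))"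
    if w: "w \<in> closed_segment x b" for x b w :: real
  proof (cases "\<bar>w - x\<bar> \<le> \<bar>b - x\<bar> / 2")
    case True
    have "D * cmod (f (of_real b) - f (of_real x)) \<le> (1 + D) * cmod (f (of_real b) - f (of_real x))"
      by (intro mult_right_mono) auto
    then show ?thesis using quasicircle_half_turning[OF h K True] by (simp add: D_def)
  next
    case False
    then have "\<bar>w - b\<bar> \<le> \<bar>x - b\<bar> / 2"
      using w by (auto simp: closed_segment_eq_real_ivl split: if_splits)
    from quasicircle_half_turning[OF h K this]
    have "cmod (f (of_real w) - f (of_real b)) \<le> D * cmod (f (of_real b) - f (of_real x))"
      by (simp add: D_def norm_minus_commute)
    then show ?thesis
      using norm_triangle_ineq[of "f (of_real w) - f (of_real b)" "f (of_real b) - f (of_real x)"]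
      by (simp add: algebra_simps)
  qed
  show thesis by (rule that[OF _ *]) (auto simp: D_def)
qed

section \<open>Quasisymmetry of the boundary values\<close>

locale half_plane_map =
  fixes E :: "complex \<Rightarrow> complex"
  assumes cont: "continuous_on {z. 0 \<le> Im z} E"
    and inj: "inj_on E {z. 0 \<le> Im z}"
    and hol: "E holomorphic_on {z. 0 < Im z}"
begin

abbreviation bv :: "real \<Rightarrow> complex" where
  "bv s \<equiv> E (of_real s)"

text \<open>A half-square joins \<open>c - r\<close> to \<open>c + r\<close> through the upper
  half-plane, so opposite bounds at its ends force all intermediate distances on it. A conformal map
  is quasiround with constant \<open>3\<close>, and
  \<open>22500000 = 2500000 * 3\<^sup>2\<close>.\<close>

lemma crossing:
  assumes r12: "0 \<le> r1" "r1 < r2" and l: "0 < l" "l < L"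
    and ends: "\<And>r. r1 < r \<Longrightarrow> r < r2 \<Longrightarrow>
      cmod (bv (c + r) - p) \<le> l \<and> L \<le> cmod (bv (c - r) - p) \<or>
      cmod (bv (c - r) - p) \<le> l \<and> L \<le> cmod (bv (c + r) - p)"
  shows "ln (L / l) \<le> 22500000 * (r2 / (r2 - r1))"
proof -
  let ?H = "{z. 0 < Im z}"
  have oH: "open ?H" by (rule open_halfspace_Im_gt)
  have injH: "inj_on E ?H" by (rule inj_on_subset[OF inj]) auto
  have "ln (L / l) \<le> 2500000 * 3\<^sup>2 * (r2 / (r2 - r1))"
  proof (rule length_area[OF oH injH holomorphic_on_imp_continuous_on[OF hol] _ _ r12 l])
    show "quasiround_at 3 E z" if "z \<in> ?H" for z
      by (rule quasiround_conformal[OF oH hol injH that])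
    fix r v assume r: "r1 < r" "r < r2" and v: "l < v" "v < L"
    define S where "S = {z. supn (z - of_real c) = r \<and> 0 \<le> Im z}"
    define \<phi> where "\<phi> z = Complex (Re z) \<bar>Im z\<bar>" for z
    have r0: "0 < r" using r r12 by linarith
    \<comment> \<open>Folding the full contour onto the closed upper half-plane shows that the
      half-contour is connected.\<close>
    have "S = \<phi> ` {z. supn (z - of_real c) = r}"
    proof (intro equalityI subsetI)
      fix z assume "z \<in> S"
      then show "z \<in> \<phi> ` {z. supn (z - of_real c) = r}"
        by (intro image_eqI[of _ _ z]) (auto simp: S_def \<phi>_def complex_eq_iff)
    qed (auto simp: S_def \<phi>_def supn_def)
    moreover have "continuous_on A \<phi>" for A
    proof -
      have "\<phi> = (\<lambda>z. of_real (Re z) + \<i> * of_real \<bar>Im z\<bar>)"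
        by (auto simp: \<phi>_def complex_eq_iff)
      then show ?thesis by (auto intro!: continuous_intros)
    qed
    ultimately have connS: "connected S"
      using connected_continuous_image connected_supn_sphere[OF r0] by metis
    have cu: "continuous_on S (\<lambda>z. cmod (E z - p))"
      by (intro continuous_intros continuous_on_subset[OF cont]) (auto simp: S_def)
    have S1: "of_real (c + r) \<in> S" "of_real (c - r) \<in> S"
      using r0 by (auto simp: S_def supn_def)
    have "\<exists>z\<in>S. cmod (E z - p) = v"
      using ends[OF r] connected_attains[OF connS cu S1, of v] connected_attains[OF connS cu S1(2,1), of v] v by auto
    then obtain z where z: "z \<in> S" "cmod (E z - p) = v" by blast
    \<comment> \<open>At the real ends the distance is at most \<open>l\<close> or at least
      \<open>L\<close>; the strict bounds on \<open>v\<close> therefore place the point in the open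
      half-plane, where \<open>E\<close> is conformal.\<close>
    have "Im z \<noteq> 0"
    proof
      assume im: "Im z = 0"
      then have "\<bar>Re z - c\<bar> = r" using z(1) by (auto simp: S_def supn_def)
      then have "Re z = c + r \<or> Re z = c - r" by linarith
      then have "z = of_real (c + r) \<or> z = of_real (c - r)"
        using im by (simp only: complex_eq_iff Re_complex_of_real Im_complex_of_real simp_thms)
      then show False using ends[OF r] v z(2) by auto
    qed
    then have "z \<in> ?H \<inter> square_contour (of_real c) r"
      using z(1) supn_square_contour by (auto simp: S_def)
    then show "\<exists>z\<in>?H \<inter> square_contour (of_real c) r. cmod (E z - p) = v"
      using z(2) by blast
  qed simp_all
  then show ?thesis by simp
qed

end

locale turning_half_plane_map = half_plane_map +
  fixes C :: real
  assumes C1: "1 \<le> C"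
    and turning: "\<And>x b w :: real. w \<in> closed_segment x b \<Longrightarrow>
      cmod (bv w - bv x) \<le> C * cmod (bv b - bv x)"
begin

lemma E_real_eq_iff: "bv s = bv t \<longleftrightarrow> s = t"
  using inj_onD[OF inj, of "of_real s" "of_real t"] by auto

text \<open>Squares centred at \<open>a\<close> separate the arc between \<open>x\<close> and \<open>b\<close> from the ray that starts at \<open>a\<close>;
  bounded turning keeps the image of the former close to the image of \<open>x\<close> and that of the latter away
  from it.\<close>

lemma weak_quasisymmetry:
  assumes xab: "distinct [x, a, b]" and t: "\<bar>x - a\<bar> \<le> t * \<bar>x - b\<bar>"
  shows "cmod (bv x - bv a)
    \<le> C\<^sup>2 * exp (22500000 * (t + 1)) * cmod (bv x - bv b)"
proof -
  define l where "l = cmod (bv b - bv x)"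
  define L where "L = cmod (bv a - bv x)"
  define B where "B = exp (22500000 * (t + 1))"
  have l0: "l > 0" unfolding l_def using xab E_real_eq_iff by simp
  have "0 < \<bar>x - a\<bar>" "0 < \<bar>x - b\<bar>" using xab by auto
  then have t0: "t > 0" using t by (smt (verit) zero_less_mult_pos2)
  have B1: "B \<ge> 1" using t0 by (simp add: B_def)
  have C2: "C \<le> C\<^sup>2" "1 \<le> C\<^sup>2" using C1 by (auto simp: power2_eq_square) (smt (verit) mult_le_cancel_left1 C1)
  have "L \<le> C\<^sup>2 * B * l"
  proof (cases "a \<in> closed_segment x b")
    case True
    then have "L \<le> C * l" using turning by (simp add: L_def l_def)
    also have "\<dots> \<le> C\<^sup>2 * B * l"
      using C2 B1 l0 C1 mult_mono[of C "C\<^sup>2" 1 B] by (intro mult_right_mono) auto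
    finally show ?thesis .
  next
    case False
    show ?thesis
    proof (cases "L / C \<le> C * l")
      case True
      then have "L \<le> C\<^sup>2 * l" using C1 by (simp add: field_simps power2_eq_square)
      also have "\<dots> \<le> C\<^sup>2 * B * l"
        using C2 B1 l0 mult_left_mono[of 1 B "C\<^sup>2"] by (intro mult_right_mono) auto
      finally show ?thesis .
    next
      case nle: False
      define r1 where "r1 = min \<bar>a - x\<bar> \<bar>a - b\<bar>"
      define r2 where "r2 = max \<bar>a - x\<bar> \<bar>a - b\<bar>"
      have out: "a < x \<and> a < b \<or> x < a \<and> b < a"
        using False xab by (auto simp: closed_segment_eq_real_ivl split: if_splits)
      have r12: "0 \<le> r1" "r1 < r2" "r2 - r1 = \<bar>x - b\<bar>"
        using out xab by (auto simp: r1_def r2_def)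
      \<comment> \<open>The radii differ by \<open>\<bar>x - b\<bar>\<close> and the larger one is
        at most \<open>(t + 1) * \<bar>x - b\<bar>\<close>; this is the origin of
        \<open>t + 1\<close> in the exponent.\<close>
      have r2t: "r2 \<le> (t + 1) * \<bar>x - b\<bar>"
        using t out by (auto simp: r2_def algebra_simps)
      have inner: "cmod (bv y - bv x) \<le> C * l" if "y \<in> closed_segment x b" for y
        using turning[OF that] by (simp add: l_def)
      have outer: "L / C \<le> cmod (bv y - bv x)" if "a \<in> closed_segment x y" for y
        using turning[OF that] C1 by (simp add: L_def field_simps)
      have "ln ((L / C) / (C * l)) \<le> 22500000 * (r2 / (r2 - r1))"
      proof (rule crossing[OF r12(1,2), where c = a and p = "bv x"])
        show "0 < C * l" using l0 C1 by simp
        show "C * l < L / C" using nle by simp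
        fix r assume r: "r1 < r" "r < r2"
        show "cmod (bv (a + r) - bv x) \<le> C * l \<and> L / C \<le> cmod (bv (a - r) - bv x) \<or>
          cmod (bv (a - r) - bv x) \<le> C * l \<and> L / C \<le> cmod (bv (a + r) - bv x)"
        proof (cases "a < x")
          case True
          then have "a + r \<in> closed_segment x b" "a \<in> closed_segment x (a - r)"
            using out r by (auto simp: r1_def r2_def closed_segment_eq_real_ivl min_def max_def split: if_splits)
          then show ?thesis using inner outer by blast
        next
          case False
          then have "a - r \<in> closed_segment x b" "a \<in> closed_segment x (a + r)"
            using out r by (auto simp: r1_def r2_def closed_segment_eq_real_ivl min_def max_def split: if_splits)
          then show ?thesis using inner outer by blast
        qed
      qed
      also have "\<dots> \<le> 22500000 * (t + 1)"
      proof (rule mult_left_mono)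
        show "r2 / (r2 - r1) \<le> t + 1"
          using r2t r12 by (simp add: pos_divide_le_eq)
      qed simp
      finally have "(L / C) / (C * l) \<le> B"
        unfolding B_def using nle l0 C1
        by (smt (verit) divide_pos_pos exp_le_cancel_iff exp_ln mult_pos_pos)
      then show ?thesis using C1 l0 by (simp add: field_simps power2_eq_square)
    qed
  qed
  then show ?thesis by (simp add: L_def l_def B_def norm_minus_commute)
qed

text \<open>The constant of \<open>weak_quasisymmetry\<close> at \<open>t = 1\<close>.\<close>

definition qs_const :: real where
  "qs_const = C\<^sup>2 * exp 45000000"

lemma qs_const_ge_1: "1 \<le> qs_const"
proof -
  have "1 \<le> C\<^sup>2" using C1 by simp
  moreover have "1 \<le> exp (45000000 :: real)" by simp
  ultimately have "1 * 1 \<le> C\<^sup>2 * exp (45000000 :: real)" by (intro mult_mono) auto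
  then show ?thesis by (simp add: qs_const_def)
qed

lemma weak_quasisymmetry_1:
  assumes "x \<noteq> b" and "\<bar>x - a\<bar> \<le> \<bar>x - b\<bar>"
  shows "cmod (bv x - bv a) \<le> qs_const * cmod (bv x - bv b)"
proof (cases "x = a \<or> a = b")
  case True
  then show ?thesis
    using qs_const_ge_1 mult_right_mono[OF qs_const_ge_1, of "cmod (bv x - bv b)"] by auto
next
  case False
  then show ?thesis using weak_quasisymmetry[of x a b 1] assms by (simp add: qs_const_def)
qed

text \<open>The images of the points \<open>x + (b - x) / 2\<^sup>i\<close>, \<open>i \<le> s\<close>, are separated by a multiple of the distance
  of the images of \<open>x\<close> and \<open>a\<close>, and only few such points fit into a disc.\<close>

lemma quasisymmetry_decay:
  assumes xab: "distinct [x, a, b]" and s: "2 ^ s * \<bar>x - a\<bar> \<le> \<bar>x - b\<bar>"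
  shows "cmod (bv x - bv a) \<le> 3 * qs_const ^ 3 / sqrt (real s + 1) * cmod (bv x - bv b)"
proof -
  define P where "P = cmod (bv x - bv a)"
  define Q where "Q = cmod (bv x - bv b)"
  define bb where "bb i = x + (b - x) / 2 ^ i" for i :: nat
  define w where "w i = bv (bb i)" for i
  \<comment> \<open>One factor \<open>qs_const\<close> is lost in comparing \<open>P\<close> with
    the distance of \<open>w j\<close> from the image of \<open>x\<close>, the other in comparing
    that distance with the one between \<open>w i\<close> and \<open>w j\<close>.\<close>
  define q where "q = P / qs_const\<^sup>2"
  have N0: "qs_const > 0" using qs_const_ge_1 by simp
  have P0: "P \<ge> 0" and Q0: "Q \<ge> 0" by (auto simp: P_def Q_def)
  have bx: "\<bar>x - bb i\<bar> = \<bar>x - b\<bar> / 2 ^ i" for i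
    by (simp add: bb_def abs_divide abs_minus_commute)
  have ne: "bb i \<noteq> x" for i using xab by (simp add: bb_def)
  have up: "cmod (bv x - w i) \<le> qs_const * Q" for i
  proof -
    have "\<bar>x - bb i\<bar> \<le> \<bar>x - b\<bar>" unfolding bx
      using divide_left_mono[of 1 "2 ^ i" "\<bar>x - b\<bar>"] by simp
    then show ?thesis unfolding w_def Q_def using xab by (intro weak_quasisymmetry_1) auto
  qed
  have low: "P \<le> qs_const * cmod (bv x - w i)" if "i \<le> s" for i
  proof -
    have "2 ^ i * \<bar>x - a\<bar> \<le> 2 ^ s * \<bar>x - a\<bar>" using that by (intro mult_right_mono power_increasing) auto
    then have "\<bar>x - a\<bar> \<le> \<bar>x - bb i\<bar>" using s unfolding bx by (simp add: field_simps)
    then show ?thesis unfolding P_def w_def using ne[of i] by (intro weak_quasisymmetry_1) auto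
  qed
  have sep: "q \<le> cmod (w i - w j)" if ij: "i < j" "j \<le> s" for i j
  proof -
    have "2 * 2 ^ i \<le> (2 ^ j :: real)"
      using ij power_increasing[of "Suc i" j "2::real"] by simp
    then have "\<bar>x - b\<bar> / 2 ^ j \<le> \<bar>x - b\<bar> / (2 * 2 ^ i)"
      by (intro divide_left_mono) auto
    then have h: "2 * \<bar>x - bb j\<bar> \<le> \<bar>x - bb i\<bar>" unfolding bx by simp
    have "\<bar>x - bb i\<bar> \<le> \<bar>x - bb j\<bar> + \<bar>bb j - bb i\<bar>"
      using abs_triangle_ineq[of "x - bb j" "bb j - bb i"] by simp
    then have "\<bar>bb j - x\<bar> \<le> \<bar>bb j - bb i\<bar>" using h by (simp add: abs_minus_commute)
    moreover have "bb j \<noteq> bb i" using h ne[of j] by auto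
    ultimately have "cmod (w j - bv x) \<le> qs_const * cmod (w j - w i)"
      unfolding w_def by (intro weak_quasisymmetry_1) auto
    then have "qs_const * cmod (bv x - w j) \<le> qs_const * (qs_const * cmod (w i - w j))"
      using N0 by (simp add: norm_minus_commute)
    then have "P \<le> qs_const\<^sup>2 * cmod (w i - w j)"
      using low[OF ij(2)] by (simp add: power2_eq_square mult.assoc)
    then show ?thesis unfolding q_def using N0 by (simp add: field_simps)
  qed
  have qQ: "q \<le> qs_const * Q"
  proof -
    have "P \<le> qs_const * Q" using low[of 0] by (simp add: w_def bb_def Q_def)
    moreover have "q \<le> P" unfolding q_def using P0 qs_const_ge_1 by (simp add: divide_le_eq mult_le_cancel_left1)
    ultimately show ?thesis by simp
  qed
  have q0: "q \<ge> 0" using P0 by (simp add: q_def)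
  \<comment> \<open>The discs of radius \<open>q / 2\<close> about the \<open>s + 1\<close> points
    are disjoint and fit into one disc of radius comparable to \<open>Q\<close>; comparing areas
    gives the decay \<open>1 / sqrt (real s + 1)\<close>.\<close>
  have "(\<Sum>i\<in>{..s}. (q / 2)\<^sup>2) \<le> real 1 * (3/2 * qs_const * Q)\<^sup>2"
  proof (rule ball_packing[where w = w and p = "bv x"])
    fix i
    show "ball (w i) (q / 2) \<subseteq> ball (bv x) (3/2 * qs_const * Q)"
    proof
      fix y assume "y \<in> ball (w i) (q / 2)"
      then have "dist (bv x) y < dist (bv x) (w i) + q / 2"
        using dist_triangle[of "bv x" y "w i"] by (simp add: dist_commute)
      then show "y \<in> ball (bv x) (3/2 * qs_const * Q)"
        using up[of i] qQ by (simp add: dist_norm)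
    qed
  next
    fix y
    have "i = j" if "i \<le> s" "j \<le> s" "y \<in> ball (w i) (q / 2)" "y \<in> ball (w j) (q / 2)" for i j
    proof (rule ccontr)
      assume "i \<noteq> j"
      then have "q \<le> cmod (w i - w j)"
        using sep[of i j] sep[of j i] that by (cases "i < j") (auto simp: norm_minus_commute)
      moreover have "dist (w i) (w j) \<le> dist (w i) y + dist (w j) y" by (rule dist_triangle2)
      ultimately show False using that by (simp add: dist_norm)
    qed
    then show "card {i \<in> {..s}. y \<in> ball (w i) (q / 2)} \<le> 1"
      by (intro card_le_Suc0_iff_eq[THEN iffD2, simplified One_nat_def[symmetric]]) auto
  qed (use q0 N0 Q0 in auto)
  then have "(real s + 1) * (P / (2 * qs_const\<^sup>2))\<^sup>2 \<le> (3/2 * qs_const * Q)\<^sup>2"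
    by (simp add: q_def algebra_simps)
  then have "sqrt ((real s + 1) * (P / (2 * qs_const\<^sup>2))\<^sup>2) \<le> sqrt ((3/2 * qs_const * Q)\<^sup>2)"
    by (rule real_sqrt_le_mono)
  then have "sqrt (real s + 1) * (P / (2 * qs_const\<^sup>2)) \<le> 3/2 * qs_const * Q"
    using P0 Q0 N0 by (simp add: real_sqrt_mult real_sqrt_abs abs_mult)
  then have "sqrt (real s + 1) * P \<le> 3/2 * qs_const * Q * (2 * qs_const\<^sup>2)"
    using N0 by (simp add: field_simps)
  also have "\<dots> = 3 * qs_const ^ 3 * Q" by (simp add: power2_eq_square power3_eq_cube)
  finally have "P \<le> 3 * qs_const ^ 3 * Q / sqrt (real s + 1)"
    by (simp add: pos_le_divide_eq mult.commute)
  then show ?thesis by (simp add: P_def Q_def)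
qed

end

section \<open>An explicit control function for quasisymmetry\<close>

text \<open>At \<open>t = 0\<close> the formula gives \<open>0\<close>, since \<open>1 / 0 = 0\<close>, \<open>ln 1 = 0\<close> and \<open>A / 0 = 0\<close>.\<close>

definition qs_control :: "real \<Rightarrow> real \<Rightarrow> real \<Rightarrow> real" where
  "qs_control A B t = A * (exp (B * t) - 1) + A / sqrt (ln (1 + 1 / t))"

lemma qs_control_0 [simp]: "qs_control A B 0 = 0"
  by (simp add: qs_control_def)

lemma qs_control_strict_mono:
  assumes A: "0 < A" and B: "0 < B"
  shows "strict_mono_on {0..} (qs_control A B)"
proof (rule strict_mono_onI)
  fix t u :: real assume tu: "t \<in> {0..}" "u \<in> {0..}" "t < u"
  have pos: "0 < ln (1 + 1 / s)" if "0 < s" for s :: real using that by (intro ln_gt_zero) simp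
  have e: "A * (exp (B * t) - 1) < A * (exp (B * u) - 1)"
    using A B tu by simp
  have "A / sqrt (ln (1 + 1 / t)) \<le> A / sqrt (ln (1 + 1 / u))"
  proof (cases "t = 0")
    case True
    then show ?thesis using A pos[of u] tu by (simp add: less_imp_le)
  next
    case False
    then have t0: "0 < t" using tu by simp
    have "1 / u \<le> 1 / t" using t0 tu by (simp add: frac_le)
    then have "ln (1 + 1 / u) \<le> ln (1 + 1 / t)"
      using t0 tu by (intro ln_mono) (auto intro: add_pos_pos)
    then show ?thesis using A pos[of u] pos[of t] t0 tu
      by (intro divide_left_mono) (auto intro!: mult_pos_pos)
  qed
  with e show "qs_control A B t < qs_control A B u" by (simp add: qs_control_def)
qed

lemma qs_control_continuous:
  "continuous_on {0..} (qs_control A B)"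
proof -
  have lim: "((\<lambda>t. A / sqrt (ln (1 + 1 / t))) \<longlongrightarrow> 0) (at_right 0)"
  proof (rule real_tendsto_divide_at_top[OF tendsto_const])
    have "filterlim (\<lambda>t::real. 1 + inverse t) at_top (at_right 0)"
      by (rule filterlim_tendsto_add_at_top[OF tendsto_const filterlim_inverse_at_top_right])
    then have "filterlim (\<lambda>t::real. sqrt (ln (1 + inverse t))) at_top (at_right 0)"
      by (rule filterlim_compose[OF sqrt_at_top filterlim_compose[OF ln_at_top]])
    then show "filterlim (\<lambda>t::real. sqrt (ln (1 + 1 / t))) at_top (at_right 0)"
      by (simp add: inverse_eq_divide)
  qed
  have "continuous (at t within {0..}) (\<lambda>t. A / sqrt (ln (1 + 1 / t)))" if "t \<in> {0..}" for t
  proof (cases "t = 0")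
    case True
    have "(at 0 within {0..}) = at_right (0::real)"
      by (rule at_within_nhd[of _ UNIV]) auto
    then show ?thesis using lim by (simp add: continuous_within True)
  next
    case False
    then have "t > 0" using that by simp
    then have "1 + 1 / t > 1" by simp
    then have "ln (1 + 1 / t) > 0" by (rule ln_gt_zero)
    then have "isCont (\<lambda>t. A / sqrt (ln (1 + 1 / t))) t"
      using \<open>t > 0\<close> \<open>1 + 1 / t > 1\<close> \<open>ln (1 + 1 / t) > 0\<close>
      by (intro continuous_intros) (linarith | simp)+
    then show ?thesis by (rule continuous_at_imp_continuous_within)
  qed
  then have c: "continuous_on {0..} (\<lambda>t. A / sqrt (ln (1 + 1 / t)))"
    by (simp add: continuous_on_eq_continuous_within)
  show ?thesis
    unfolding qs_control_def by (rule continuous_on_add[OF _ c]) (intro continuous_intros)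
qed

lemma qs_control_homeomorphism:
  assumes A: "0 < A" and B: "0 < B"
  shows "\<exists>\<theta>. homeomorphism {0..} {0..} (qs_control A B) \<theta>"
proof -
  have mono: "qs_control A B t \<le> qs_control A B u" if "0 \<le> t" "t \<le> u" for t u
    using strict_mono_onD[OF qs_control_strict_mono[OF A B], of t u] that by (cases "t = u") auto
  have "inj_on (qs_control A B) {0..}"
    by (rule strict_mono_on_imp_inj_on[OF qs_control_strict_mono[OF A B]])
  moreover have "path_connected {0::real..}"
    by (intro convex_imp_path_connected) auto
  moreover have "qs_control A B ` {0..} = {0..}"
  proof (intro equalityI subsetI)
    fix y assume "y \<in> qs_control A B ` {0..}"
    then show "y \<in> {0..}" using mono[of 0] by auto
  next
    fix y :: real assume y: "y \<in> {0..}"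
    \<comment> \<open>The exponential term alone reaches \<open>y\<close> here, because
      \<open>exp u - 1 \<ge> u\<close>; the intermediate value theorem then gives
      surjectivity.\<close>
    define T where "T = y / (A * B)"
    have T0: "T \<ge> 0" using y A B by (simp add: T_def)
    have "A * (B * T) \<le> A * (exp (B * T) - 1)"
    proof (rule mult_left_mono)
      show "B * T \<le> exp (B * T) - 1" using exp_ge_add_one_self[of "B * T"] by linarith
    qed (use A in simp)
    moreover have "A * (B * T) = y" using A B by (simp add: T_def)
    moreover have "0 \<le> A / sqrt (ln (1 + 1 / T))"
      using A T0 by (intro divide_nonneg_nonneg real_sqrt_ge_zero ln_ge_zero) auto
    ultimately have "y \<le> qs_control A B T" by (simp add: qs_control_def)
    then have "\<exists>t\<ge>0. t \<le> T \<and> qs_control A B t = y"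
      using y T0 by (intro IVT' continuous_on_subset[OF qs_control_continuous]) auto
    then show "y \<in> qs_control A B ` {0..}" by force
  qed
  ultimately show ?thesis
    using injective_into_1d_eq_homeomorphism[OF qs_control_continuous, of A B] by metis
qed

lemma homeomorphism_imp_embedding_map:
  assumes "homeomorphism UNIV S g h"
  shows "embedding_map euclidean euclidean g"
proof -
  have "range g = S" "continuous_on UNIV g" "continuous_on S h" "\<And>x. h (g x) = x" "\<And>y. y \<in> S \<Longrightarrow> g (h y) = y"
    using assms by (auto simp: homeomorphism_def)
  then have "homeomorphic_maps euclidean (subtopology euclidean (range g)) g h"
    by (auto simp: homeomorphic_maps_def continuous_map_in_subtopology)
  then show ?thesis
    unfolding embedding_map_def homeomorphic_map_maps by auto
qed

context turning_half_plane_map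
begin

text \<open>For \<open>t \<ge> 1\<close> the exponential term of \<open>qs_control\<close> dominates
  \<open>weak_quasisymmetry\<close>. For \<open>t < 1\<close> the other term dominates
  \<open>quasisymmetry_decay\<close> with \<open>s\<close> the integer part of
  \<open>log 2 (1 / t)\<close>; the factor \<open>4 / 3\<close> between
  \<open>sqrt (ln (1 + 1 / t))\<close> and \<open>sqrt (real s + 1)\<close> turns
  \<open>3 * qs_const ^ 3\<close> into \<open>4 * qs_const ^ 3\<close>.\<close>

lemma quasisymmetric:
  assumes hom: "homeomorphism UNIV S bv h"
  shows "quasisymmetric_embedding bv"
proof -
  define A where "A = 4 * qs_const ^ 3"
  define B :: real where "B = 22500000"
  have N3: "qs_const \<le> qs_const ^ 3" using qs_const_ge_1 power_increasing[of 1 3 qs_const] by simp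
  have A0: "A > 0" "qs_const \<le> A" using qs_const_ge_1 N3 by (auto simp: A_def)
  have B0: "B > 0" by (simp add: B_def)
  have bound: "cmod (bv x - bv a) / cmod (bv x - bv b) \<le> qs_control A B t"
    if t: "0 \<le> t" and xab: "distinct [x, a, b]" and r: "\<bar>x - a\<bar> / \<bar>x - b\<bar> \<le> t" for t x a b
  proof -
    have xa0: "0 < \<bar>x - a\<bar>" "0 < \<bar>x - b\<bar>" using xab by auto
    have r': "\<bar>x - a\<bar> \<le> t * \<bar>x - b\<bar>" using r xa0 by (simp add: divide_le_eq)
    have "t \<noteq> 0" using r' xa0 by auto
    then have t0: "t > 0" using t by simp
    have d0: "0 < cmod (bv x - bv b)" using xab E_real_eq_iff by simp
    define lnt where "lnt = ln (1 + 1 / t)"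
    have ln0: "lnt > 0" unfolding lnt_def using t0 by (intro ln_gt_zero) simp
    show ?thesis
    proof (cases "1 \<le> t")
      case True
      have "1 / t \<le> 1" using True by simp
      then have "1 + 1 / t \<le> 2" by simp
      then have "lnt \<le> ln 2" unfolding lnt_def using t0 by (intro ln_mono) (auto intro: add_pos_pos)
      then have "lnt \<le> 1" using ln2_le_25_over_36 by linarith
      then have "sqrt lnt \<le> 1" by simp
      then have "A / 1 \<le> A / sqrt lnt" using A0 ln0 by (intro divide_left_mono) auto
      then have ge: "A * exp (B * t) \<le> qs_control A B t"
        by (simp add: qs_control_def lnt_def algebra_simps)
      have "C\<^sup>2 * exp (22500000 * (t + 1)) = C\<^sup>2 * exp 22500000 * exp (B * t)"
        by (simp add: B_def algebra_simps exp_add)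
      also have "\<dots> \<le> qs_const * exp (B * t)"
        unfolding qs_const_def by (intro mult_right_mono mult_left_mono) auto
      also have "\<dots> \<le> A * exp (B * t)" using A0 by (intro mult_right_mono) auto
      also note ge
      finally have "C\<^sup>2 * exp (22500000 * (t + 1)) \<le> qs_control A B t" .
      moreover have "cmod (bv x - bv a) / cmod (bv x - bv b) \<le> C\<^sup>2 * exp (22500000 * (t + 1))"
        using weak_quasisymmetry[OF xab r'] d0 by (simp add: pos_divide_le_eq)
      ultimately show ?thesis by linarith
    next
      case False
      define s where "s = nat \<lfloor>log 2 (1 / t)\<rfloor>"
      have lg: "log 2 (1 / t) \<ge> 0" using False t0 by simp
      have s1: "real s \<le> log 2 (1 / t)" "log 2 (1 / t) < real s + 1"
        using lg unfolding s_def by linarith+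
      have "2 powr real s \<le> 1 / t" using s1(1) t0 by (simp add: le_log_iff)
      then have p1: "2 ^ s \<le> 1 / t" by (simp add: powr_realpow)
      have "1 / t < 2 powr (real s + 1)" using s1(2) t0 by (simp add: log_less_iff)
      then have p2: "1 / t < 2 ^ (s + 1)" by (simp add: powr_realpow powr_add)
      have "2 ^ s * \<bar>x - a\<bar> \<le> 1 / t * \<bar>x - a\<bar>" using p1 by (intro mult_right_mono) auto
      also have "\<dots> \<le> \<bar>x - b\<bar>" using r' t0 by (simp add: field_simps)
      finally have dec: "cmod (bv x - bv a) \<le> 3 * qs_const ^ 3 / sqrt (real s + 1) * cmod (bv x - bv b)"
        by (rule quasisymmetry_decay[OF xab])
      have "(1::real) \<le> 2 ^ (s + 1)" by (rule one_le_power) simp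
      then have "1 + 1 / t \<le> 2 ^ (s + 2)" using p2 by simp
      then have "lnt \<le> ln (2 ^ (s + 2))" unfolding lnt_def using t0 by (intro ln_mono) (auto intro: add_pos_pos)
      also have "\<dots> = (real s + 2) * ln 2" by (subst ln_realpow) auto
      also have "\<dots> \<le> (real s + 2) * (25 / 36)" using ln2_le_25_over_36 by (intro mult_left_mono) auto
      also have "\<dots> \<le> (4 / 3)\<^sup>2 * (real s + 1)" by (simp add: power2_eq_square)
      finally have "sqrt lnt \<le> sqrt ((4 / 3)\<^sup>2 * (real s + 1))" by (rule real_sqrt_le_mono)
      then have sq: "sqrt lnt \<le> 4 / 3 * sqrt (real s + 1)" by (simp only: real_sqrt_mult) simp
      have "3 * qs_const ^ 3 / sqrt (real s + 1) = A / (4 / 3 * sqrt (real s + 1))" by (simp add: A_def)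
      also have "\<dots> \<le> A / sqrt lnt" using sq ln0 A0 by (intro divide_left_mono) auto
      also have "\<dots> \<le> qs_control A B t" using A0 B0 t0 by (simp add: qs_control_def lnt_def)
      finally show ?thesis using dec d0 by (smt (verit) divide_le_eq)
    qed
  qed
  show ?thesis
    unfolding quasisymmetric_embedding_def
    using homeomorphism_imp_embedding_map[OF hom] qs_control_strict_mono[OF A0(1) B0]
      qs_control_homeomorphism[OF A0(1) B0] bound by blast
qed

end

section \<open>Asymptotic conformality and asymptotic symmetry\<close>

text \<open>The function whose limit at \<open>0\<close> occurs in
  \<open>asymptotically_conformal_quasicircle\<close>.\<close>

definition arc_ratio_sup :: "complex set \<Rightarrow> (complex \<Rightarrow> real) \<Rightarrow> real \<Rightarrow> ereal" where
  "arc_ratio_sup \<Gamma> h = (\<lambda>t. SUP (z1, z2) \<in> {(z1, z2). z1 \<in> \<Gamma> \<and> z2 \<in> \<Gamma> \<and> 0 < \<bar>h z1 - h z2\<bar> \<and> \<bar>h z1 - h z2\<bar> \<le> t}.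
               SUP z\<in>subarc \<Gamma> z1 z2. ereal ((cmod (z1 - z) + cmod (z - z2)) / cmod (z1 - z2)))"

lemma asymptotically_conformalD:
  assumes ac: "asymptotically_conformal_quasicircle \<Gamma> g" and \<epsilon>: "0 < \<epsilon>"
  obtains t0 where "0 < t0"
    "\<And>a b x. a \<noteq> b \<Longrightarrow> \<bar>a - b\<bar> \<le> t0 \<Longrightarrow> x \<in> closed_segment a b \<Longrightarrow>
       cmod (g a - g x) + cmod (g x - g b) \<le> (1 + \<epsilon>) * cmod (g a - g b)"
proof -
  obtain h where hom: "homeomorphism UNIV \<Gamma> g h" and lim: "(arc_ratio_sup \<Gamma> h \<longlongrightarrow> 1) (at_right 0)"
    using ac unfolding asymptotically_conformal_quasicircle_def arc_ratio_sup_def by blast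
  have gh: "h (g s) = s" "g s \<in> \<Gamma>" for s
    using hom by (auto simp: homeomorphism_def)
  have "(1::ereal) < ereal (1 + \<epsilon>)"
    using \<epsilon> by (simp add: one_ereal_def)
  from order_tendstoD(2)[OF lim this] obtain d where d: "d > 0" and dt: "\<And>t. 0 < t \<Longrightarrow> t < d \<Longrightarrow>
     arc_ratio_sup \<Gamma> h t < ereal (1 + \<epsilon>)"
    unfolding eventually_at_right_field by auto
  show thesis
  proof (rule that[of "d / 2"])
    fix a b x :: real assume ab: "a \<noteq> b" "\<bar>a - b\<bar> \<le> d / 2" and x: "x \<in> closed_segment a b"
    have "g x \<in> subarc \<Gamma> (g a) (g b)"
      using x by (simp add: subarc_parametrization[OF hom ab(1)])
    then have "ereal ((cmod (g a - g x) + cmod (g x - g b)) / cmod (g a - g b))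
      \<le> (SUP z\<in>subarc \<Gamma> (g a) (g b). ereal ((cmod (g a - z) + cmod (z - g b)) / cmod (g a - g b)))"
      by (rule SUP_upper)
    also have "\<dots> \<le> arc_ratio_sup \<Gamma> h (d / 2)"
      unfolding arc_ratio_sup_def by (rule SUP_upper2[of "(g a, g b)"]) (use ab gh in auto)
    also have "\<dots> < ereal (1 + \<epsilon>)"
      using dt[of "d / 2"] d by simp
    finally have "(cmod (g a - g x) + cmod (g x - g b)) / cmod (g a - g b) < 1 + \<epsilon>"
      by simp
    moreover have "cmod (g a - g b) > 0"
      using ab(1) gh(1) by (metis right_minus_eq zero_less_norm_iff)
    ultimately show "cmod (g a - g x) + cmod (g x - g b) \<le> (1 + \<epsilon>) * cmod (g a - g b)"
      by (simp add: pos_divide_less_eq less_imp_le)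
  qed (use d in simp)
qed

text \<open>The \<open>\<delta>\<close> of asymptotic symmetry depends on the ratio \<open>t\<close>; ratios below \<open>1\<close> are rounded up to the
  grid \<open>i / n\<close>.\<close>

lemma asymptotically_symmetric_imp_conformal:
  assumes qc: "quasicircle_through_infinity \<Gamma>" and hom: "homeomorphism UNIV \<Gamma> g h"
    and as: "asymptotically_symmetric_embedding g"
  shows "asymptotically_conformal_quasicircle \<Gamma> g"
proof -
  define \<Phi> where "\<Phi> = arc_ratio_sup \<Gamma> h"
  have gh: "h (g s) = s" "g s \<in> \<Gamma>" and hg: "z \<in> \<Gamma> \<Longrightarrow> g (h z) = z" for s z
    using hom by (auto simp: homeomorphism_def)
  have ne: "cmod (g a - g b) > 0" if "a \<noteq> b" for a b
    using that gh(1) by (metis right_minus_eq zero_less_norm_iff)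
  \<comment> \<open>An end point of the arc already contributes the value \<open>1\<close>.\<close>
  have low: "1 \<le> \<Phi> t" if t: "0 < t" for t
  proof -
    have "g 0 \<in> subarc \<Gamma> (g 0) (g t)"
      using t by (simp add: subarc_parametrization[OF hom])
    then have "ereal ((cmod (g 0 - g 0) + cmod (g 0 - g t)) / cmod (g 0 - g t))
      \<le> (SUP z\<in>subarc \<Gamma> (g 0) (g t). ereal ((cmod (g 0 - z) + cmod (z - g t)) / cmod (g 0 - g t)))"
      by (rule SUP_upper)
    also have "\<dots> \<le> \<Phi> t"
      unfolding \<Phi>_def arc_ratio_sup_def by (rule SUP_upper2[of "(g 0, g t)"]) (use t gh in auto)
    finally show ?thesis
      using ne[of 0 t] t by (simp add: one_ereal_def)
  qed
  have up: "\<exists>d>0. \<forall>t. 0 < t \<and> t < d \<longrightarrow> \<Phi> t \<le> ereal (1 + \<epsilon>)" if \<epsilon>: "0 < \<epsilon>" for \<epsilon>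
  proof -
    \<comment> \<open>Rounding up to the grid costs \<open>1 / n\<close> at each of the two end
      points of the arc, hence the term \<open>2 / real n\<close> in \<open>en\<close>.\<close>
    define n where "n = Suc (nat \<lceil>8 / \<epsilon>\<rceil>)"
    have n0: "real n > 0" by (simp add: n_def)
    have "8 / \<epsilon> \<le> real n" unfolding n_def by linarith
    then have n\<epsilon>: "8 / real n \<le> \<epsilon>" using \<epsilon> n0 by (simp add: field_simps)
    define \<epsilon>1 where "\<epsilon>1 = min (\<epsilon> / 4) 1"
    have e1: "0 < \<epsilon>1" "\<epsilon>1 \<le> 1" "\<epsilon>1 \<le> \<epsilon> / 4" using \<epsilon> by (auto simp: \<epsilon>1_def)
    define m where "m = 2 / real n"
    have m: "0 \<le> m" "m \<le> \<epsilon> / 4" using n\<epsilon> by (auto simp: m_def)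
    have "\<epsilon>1 * m \<le> 1 * m" using e1 m by (intro mult_right_mono) auto
    then have "(1 + \<epsilon>1) * (1 + m) \<le> 1 + \<epsilon>"
      using e1 m by (simp add: algebra_simps)
    then have en: "(1 + \<epsilon>1) * (1 + 2 / real n) \<le> 1 + \<epsilon>"
      unfolding m_def .
    have allt: "\<forall>t>0. \<exists>\<delta>>0. \<forall>x a b. distinct [x, a, b] \<longrightarrow>
        (\<exists>c d. d - c < \<delta> \<and> {x, a, b} \<subseteq> {c..d}) \<longrightarrow>
        \<bar>x - a\<bar> / \<bar>x - b\<bar> \<le> t \<longrightarrow>
        cmod (g x - g a) / cmod (g x - g b) \<le> (1 + \<epsilon>1) * t"
      using as e1(1) unfolding asymptotically_symmetric_embedding_def by blast
    have "\<exists>\<delta>>0. i \<in> {1..n} \<longrightarrow> (\<forall>x a b. distinct [x, a, b] \<longrightarrow>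
        (\<exists>c d. d - c < \<delta> \<and> {x, a, b} \<subseteq> {c..d}) \<longrightarrow>
        \<bar>x - a\<bar> / \<bar>x - b\<bar> \<le> i / n \<longrightarrow>
        cmod (g x - g a) / cmod (g x - g b) \<le> (1 + \<epsilon>1) * (i / n))" for i
    proof (cases "i \<in> {1..n}")
      case True
      then have "0 < real i / real n" using n0 by simp
      from allt[rule_format, OF this] show ?thesis by blast
    next
      case False
      then show ?thesis
        by (intro exI[of _ "1::real"] conjI impI) simp_all
    qed
    then obtain \<delta> where \<delta>: "\<And>i. 0 < \<delta> i" "\<And>i x a b. i \<in> {1..n} \<Longrightarrow> distinct [x, a, b] \<Longrightarrow>
        (\<exists>c d. d - c < \<delta> i \<and> {x, a, b} \<subseteq> {c..d}) \<Longrightarrow>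
        \<bar>x - a\<bar> / \<bar>x - b\<bar> \<le> i / n \<Longrightarrow>
        cmod (g x - g a) / cmod (g x - g b) \<le> (1 + \<epsilon>1) * (i / n)"
      by metis
    define d where "d = Min (\<delta> ` {1..n})"
    have ne0: "{1..n} \<noteq> {}" by (simp add: n_def)
    have d0: "d > 0" unfolding d_def using \<delta>(1) ne0 by (subst Min_gr_iff) auto
    have dle: "d \<le> \<delta> i" if "i \<in> {1..n}" for i unfolding d_def using that by (intro Min_le) auto
    have key: "cmod (g p - g x) / cmod (g p - g q) \<le> (1 + \<epsilon>1) * (\<bar>p - x\<bar> / \<bar>p - q\<bar> + 1 / n)"
      if pq: "\<bar>p - q\<bar> < d" "p \<noteq> q" and x: "x \<in> closed_segment p q" "x \<noteq> p" "x \<noteq> q" for p q x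
    proof -
      define s where "s = \<bar>p - x\<bar> / \<bar>p - q\<bar>"
      have s: "0 < s" "s \<le> 1"
        using x pq(2) by (auto simp: s_def closed_segment_eq_real_ivl divide_le_eq split: if_splits)
      define i where "i = nat \<lceil>s * real n\<rceil>"
      have sn: "0 < s * real n" "s * real n \<le> 1 * real n" using s n0 by (auto intro!: mult_right_mono)
      have i: "i \<in> {1..n}" "s * real n \<le> real i" "real i \<le> s * real n + 1"
        using sn unfolding i_def by (auto simp: ceiling_le_iff le_nat_iff)
      have "s \<le> real i / real n" using i(2) n0 by (simp add: field_simps)
      then have "cmod (g p - g x) / cmod (g p - g q) \<le> (1 + \<epsilon>1) * (i / n)"
      proof (intro \<delta>(2)[OF i(1)])
        show "\<exists>c da. da - c < \<delta> i \<and> {p, x, q} \<subseteq> {c..da}"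
          using dle[OF i(1)] pq x(1)
          by (intro exI[of _ "min p q"] exI[of _ "max p q"]) (auto simp: closed_segment_eq_real_ivl split: if_splits)
      qed (use x pq s_def in auto)
      also have "\<dots> \<le> (1 + \<epsilon>1) * (s + 1 / n)"
        using i(3) n0 e1 by (intro mult_left_mono) (auto simp: field_simps)
      finally show ?thesis by (simp add: s_def)
    qed
    have "\<Phi> t \<le> ereal (1 + \<epsilon>)" if t: "0 < t" "t < d" for t
      unfolding \<Phi>_def arc_ratio_sup_def
    proof (intro SUP_least, clarify, intro SUP_least)
      fix z1 z2 z assume z12: "z1 \<in> \<Gamma>" "z2 \<in> \<Gamma>" "0 < \<bar>h z1 - h z2\<bar>" "\<bar>h z1 - h z2\<bar> \<le> t"
        and z: "z \<in> subarc \<Gamma> z1 z2"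
      define p where "p = h z1"
      define q where "q = h z2"
      have pq: "z1 = g p" "z2 = g q" "p \<noteq> q" "\<bar>p - q\<bar> < d"
        using z12 hg t by (auto simp: p_def q_def)
      have "z \<in> g ` closed_segment p q"
        using z unfolding pq(1,2) subarc_parametrization[OF hom pq(3)] .
      then obtain x where x: "x \<in> closed_segment p q" "z = g x" by blast
      have D: "cmod (g p - g q) > 0" using ne pq by blast
      have "(cmod (z1 - z) + cmod (z - z2)) / cmod (z1 - z2) \<le> 1 + \<epsilon>"
      proof (cases "x = p \<or> x = q")
        case True
        then show ?thesis using \<epsilon> D by (auto simp: pq x)
      next
        case False
        have 1: "cmod (g p - g x) / cmod (g p - g q) \<le> (1 + \<epsilon>1) * (\<bar>p - x\<bar> / \<bar>p - q\<bar> + 1 / n)"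
          using key[of p q x] pq x False by simp
        have 2: "cmod (g q - g x) / cmod (g q - g p) \<le> (1 + \<epsilon>1) * (\<bar>q - x\<bar> / \<bar>q - p\<bar> + 1 / n)"
          using key[of q p x] pq x False by (simp add: closed_segment_commute abs_minus_commute)
        \<comment> \<open>Seen from the two end points, the parameter ratios add up to exactly
          \<open>1\<close>, so the chord ratios exceed \<open>1\<close> in total only by the error
          terms.\<close>
        have "\<bar>p - x\<bar> + \<bar>q - x\<bar> = \<bar>p - q\<bar>"
          using x(1) by (auto simp: closed_segment_eq_real_ivl split: if_splits)
        then have sum1: "\<bar>p - x\<bar> / \<bar>p - q\<bar> + \<bar>q - x\<bar> / \<bar>q - p\<bar> = 1"
          using pq(3) by (simp add: abs_minus_commute[of q p] add_divide_distrib[symmetric])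
        have "(cmod (z1 - z) + cmod (z - z2)) / cmod (z1 - z2)
          = cmod (g p - g x) / cmod (g p - g q) + cmod (g q - g x) / cmod (g q - g p)"
          by (simp add: pq x add_divide_distrib norm_minus_commute)
        also have "\<dots> \<le> (1 + \<epsilon>1) * (\<bar>p - x\<bar> / \<bar>p - q\<bar> + 1 / n) + (1 + \<epsilon>1) * (\<bar>q - x\<bar> / \<bar>q - p\<bar> + 1 / n)"
          using 1 2 by (rule add_mono)
        also have "\<dots> = (1 + \<epsilon>1) * ((\<bar>p - x\<bar> / \<bar>p - q\<bar> + \<bar>q - x\<bar> / \<bar>q - p\<bar>) + 2 / n)"
          by (simp add: algebra_simps)
        also have "\<dots> \<le> 1 + \<epsilon>" unfolding sum1 by (rule en)
        finally show ?thesis .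
      qed
      then show "ereal ((cmod (z1 - z) + cmod (z - z2)) / cmod (z1 - z2)) \<le> ereal (1 + \<epsilon>)" by simp
    qed
    then show ?thesis using d0 by blast
  qed
  have "(\<Phi> \<longlongrightarrow> 1) (at_right 0)"
  proof (rule order_tendstoI)
    fix l :: ereal assume "l < 1"
    then show "eventually (\<lambda>t. l < \<Phi> t) (at_right 0)"
      using low unfolding eventually_at_right_field by (intro exI[of _ 1]) (auto intro: less_le_trans)
  next
    fix u :: ereal assume "1 < u"
    then obtain v where v: "1 < ereal v" "ereal v < u"
      using ereal_dense2 by blast
    then have "0 < v - 1" by (simp add: one_ereal_def)
    from up[OF this] obtain d where d: "d > 0" "\<forall>t. 0 < t \<and> t < d \<longrightarrow> \<Phi> t \<le> ereal v" by auto
    then show "eventually (\<lambda>t. \<Phi> t < u) (at_right 0)"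
      using v unfolding eventually_at_right_field by (intro exI[of _ d]) (auto intro: le_less_trans)
  qed
  then show ?thesis
    unfolding asymptotically_conformal_quasicircle_def \<Phi>_def arc_ratio_sup_def using qc hom by blast
qed

section \<open>Boundary values of maps with small logarithmic derivative\<close>

lemma norm_exp_minus_one_le:
  fixes w :: complex
  shows "cmod (exp w - 1) \<le> exp (cmod w) - 1"
proof -
  have "cmod (exp (of_real 1 * w) - exp (of_real 0 * w)) \<le> exp (1 * cmod w) - exp (0 * cmod w)"
  proof (rule differentiable_bound_general[where f = "\<lambda>v. exp (of_real v * w)" and \<phi> = "\<lambda>v. exp (v * cmod w)"
        and f' = "\<lambda>v. w * exp (of_real v * w)" and \<phi>' = "\<lambda>v. cmod w * exp (v * cmod w)"])
    fix v :: real assume v: "0 < v" "v < 1"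
    show "((\<lambda>v. exp (of_real v * w)) has_vector_derivative w * exp (of_real v * w)) (at v)"
      by (rule has_vector_derivative_real_field) (auto intro!: derivative_eq_intros)
    show "((\<lambda>v. exp (v * cmod w)) has_vector_derivative cmod w * exp (v * cmod w)) (at v)"
      unfolding has_real_derivative_iff_has_vector_derivative[symmetric]
      by (auto intro!: derivative_eq_intros)
    have "v * Re w \<le> v * cmod w" using v complex_Re_le_cmod by (intro mult_left_mono) auto
    then show "cmod (w * exp (of_real v * w)) \<le> cmod w * exp (v * cmod w)"
      by (auto simp: norm_mult intro!: mult_left_mono)
  qed (auto intro!: continuous_intros)
  then show ?thesis by simp
qed

text \<open>With the parametrisation \<open>y = exp v\<close> the hypothesis becomes a bound
  \<open>e\<close> on the speed, and the parameter interval has length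
  \<open>ln (\<beta> / \<alpha>)\<close>.\<close>

lemma vertical_log_bound:
  assumes F: "F holomorphic_on {z. 0 < Im z}" and ab: "0 < \<alpha>" "\<alpha> \<le> \<beta>"
    and bd: "\<And>y. \<alpha> \<le> y \<Longrightarrow> y \<le> \<beta> \<Longrightarrow> y * cmod (deriv F (Complex u y)) \<le> e"
  shows "cmod (F (Complex u \<beta>) - F (Complex u \<alpha>)) \<le> e * ln (\<beta> / \<alpha>)"
proof (cases "\<alpha> = \<beta>")
  case True
  then show ?thesis using ab by simp
next
  case False
  define \<gamma> where "\<gamma> v = of_real u + \<i> * exp (of_real v)" for v :: real
  have \<gamma>C: "\<gamma> v = Complex u (exp v)" for v
    by (simp add: \<gamma>_def complex_eq_iff Re_exp Im_exp)
  have \<gamma>d: "(\<gamma> has_vector_derivative \<i> * exp (of_real v)) (at v)" for v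
    unfolding \<gamma>_def by (rule has_vector_derivative_real_field) (auto intro!: derivative_eq_intros)
  have Fd: "((F \<circ> \<gamma>) has_vector_derivative \<i> * exp (of_real v) * deriv F (\<gamma> v)) (at v)" for v
    by (rule field_vector_diff_chain_at[OF \<gamma>d], rule holomorphic_derivI[OF F])
      (auto simp: \<gamma>C open_halfspace_Im_gt)
  have "cmod ((F \<circ> \<gamma>) (ln \<beta>) - (F \<circ> \<gamma>) (ln \<alpha>)) \<le> e * ln \<beta> - e * ln \<alpha>"
  proof (rule differentiable_bound_general[where \<phi>' = "\<lambda>v. e"])
    show "ln \<alpha> < ln \<beta>" using ab False by simp
    show "continuous_on {ln \<alpha>..ln \<beta>} (F \<circ> \<gamma>)"
      by (intro continuous_at_imp_continuous_on ballI has_vector_derivative_continuous[OF Fd])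
    fix v assume v: "ln \<alpha> < v" "v < ln \<beta>"
    show "(F \<circ> \<gamma> has_vector_derivative \<i> * exp (of_real v) * deriv F (\<gamma> v)) (at v)" by (rule Fd)
    show "((\<lambda>v. e * v) has_vector_derivative e) (at v)"
      unfolding has_real_derivative_iff_has_vector_derivative[symmetric]
      by (auto intro!: derivative_eq_intros)
    have "exp (ln \<alpha>) < exp v" "exp v < exp (ln \<beta>)" using v by auto
    then show "cmod (\<i> * exp (of_real v) * deriv F (\<gamma> v)) \<le> e"
      using bd[of "exp v"] ab by (simp add: norm_mult \<gamma>C)
  qed (auto intro!: continuous_intros)
  then show ?thesis using ab by (simp add: \<gamma>C ln_div right_diff_distrib)
qed

lemma segment_bound:
  assumes F: "F holomorphic_on S" and S: "open S" and sub: "closed_segment z w \<subseteq> S"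
    and bd: "\<And>x. x \<in> closed_segment z w \<Longrightarrow> cmod (deriv F x) \<le> B"
  shows "cmod (F w - F z) \<le> B * cmod (w - z)"
proof (rule field_differentiable_bound[where f' = "deriv F"])
  show "convex (closed_segment z w)" by simp
  show "(F has_field_derivative deriv F x) (at x within closed_segment z w)" if "x \<in> closed_segment z w" for x
    using holomorphic_derivI[OF F S] that sub by blast
qed (use bd in auto)

lemma closed_segment_horizontal: "x \<in> closed_segment (Complex a y) (Complex b y) \<Longrightarrow> Im x = y"
  by (auto simp: closed_segment_def left_diff_distrib)

context half_plane_map
begin

lemma deriv_E_nonzero: "0 < Im z \<Longrightarrow> deriv E z \<noteq> 0"
  by (rule holomorphic_injective_imp_regular[OF hol open_halfspace_Im_gt inj_on_subset[OF inj]]) auto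

text \<open>The logarithm of the derivative changes by at most \<open>e * T\<close> along the
  horizontal line at height \<open>h\<close> and by at most \<open>- (e * ln \<tau>)\<close> on the
  way down to height \<open>h * \<tau>\<close>. Relative to its value at \<open>Complex x h\<close>,
  the derivative is thus off by at most \<open>exp (e * T) * \<tau> powr (- e) - 1\<close>, which is
  integrable down to the boundary for \<open>e < 1\<close>. The affine map is the first-order
  expansion at \<open>Complex x h\<close>, from which \<open>x + h * s\<close> is displaced by
  \<open>h * (s - \<i>)\<close>.\<close>

lemma boundary_nearly_affine:
  assumes L: "L holomorphic_on {z. 0 < Im z}" "\<And>z. 0 < Im z \<Longrightarrow> exp (L z) = deriv E z"
    and e: "0 \<le> e" "e < 1"
    and bd: "\<And>z. 0 < Im z \<Longrightarrow> Im z \<le> h \<Longrightarrow> Im z * cmod (deriv L z) \<le> e"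
    and h: "0 < h" and s: "\<bar>s\<bar> \<le> T"
  shows "cmod (bv (x + h * s) - (E (Complex x h) + of_real h * (of_real s - \<i>) * deriv E (Complex x h)))
    \<le> h * cmod (deriv E (Complex x h)) * ((exp (e * T) / (1 - e) - 1) + T * (exp (e * T) - 1))"
proof -
  let ?H = "{z. 0 < Im z}"
  have oH: "open ?H" by (rule open_halfspace_Im_gt)
  define z0 where "z0 = Complex x h"
  define D where "D = deriv E z0"
  have T0: "0 \<le> T" using s by linarith
  have hor: "cmod (L (Complex (x + h * s') h) - L z0) \<le> e * T" if "\<bar>s'\<bar> \<le> T" for s'
  proof -
    have "cmod (L (Complex (x + h * s') h) - L z0) \<le> e / h * cmod (Complex (x + h * s') h - z0)"
      unfolding z0_def
    proof (rule segment_bound[OF L(1) oH])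
      fix y assume "y \<in> closed_segment (Complex x h) (Complex (x + h * s') h)"
      then have "Im y = h" by (rule closed_segment_horizontal)
      then show "cmod (deriv L y) \<le> e / h"
        using bd[of y] h by (simp add: field_simps)
    qed (use h closed_segment_horizontal in fastforce)
    also have "cmod (Complex (x + h * s') h - z0) = h * \<bar>s'\<bar>"
      using h by (simp add: z0_def cmod_def abs_mult)
    also have "e / h * (h * \<bar>s'\<bar>) = e * \<bar>s'\<bar>" using h by simp
    also have "\<dots> \<le> e * T" using that e by (intro mult_left_mono)
    finally show ?thesis .
  qed
  have ver: "cmod (L (Complex (x + h * s) (h * \<tau>)) - L (Complex (x + h * s) h)) \<le> - (e * ln \<tau>)"
    if \<tau>: "0 < \<tau>" "\<tau> \<le> 1" for \<tau>
  proof -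
    have "cmod (L (Complex (x + h * s) h) - L (Complex (x + h * s) (h * \<tau>))) \<le> e * ln (h / (h * \<tau>))"
    proof (rule vertical_log_bound[OF L(1)])
      fix y assume "h * \<tau> \<le> y" "y \<le> h"
      moreover have "0 < h * \<tau>" using h \<tau> by simp
      ultimately show "y * cmod (deriv L (Complex (x + h * s) y)) \<le> e"
        using bd[of "Complex (x + h * s) y"] by simp
    qed (use h \<tau> in auto)
    then show ?thesis using h \<tau> by (simp add: norm_minus_commute ln_div)
  qed
  have dE: "cmod (deriv E z - D) \<le> cmod D * (exp b - 1)"
    if z: "0 < Im z" and b: "cmod (L z - L z0) \<le> b" for z b
  proof -
    have "D = exp (L z0)" "deriv E z = exp (L z)"
      using L(2)[OF z] L(2)[of z0] h by (simp_all add: D_def z0_def)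
    then have "deriv E z = D * exp (L z - L z0)"
      by (simp add: exp_diff)
    then have "deriv E z - D = D * (exp (L z - L z0) - 1)" by (simp add: algebra_simps)
    then have "cmod (deriv E z - D) = cmod D * cmod (exp (L z - L z0) - 1)" by (simp add: norm_mult)
    also have "\<dots> \<le> cmod D * (exp b - 1)"
      using norm_exp_minus_one_le[of "L z - L z0"] b
      by (intro mult_left_mono) (auto intro: order_trans)
    finally show ?thesis .
  qed
  have A: "cmod (E (Complex (x + h * s) h) - (E z0 + of_real (h * s) * D)) \<le> h * cmod D * (T * (exp (e * T) - 1))"
  proof -
    define F where "F z = E z - D * z" for z
    have Fh: "F holomorphic_on ?H" unfolding F_def using hol by (intro holomorphic_intros)
    have Fd: "deriv F z = deriv E z - D" if "0 < Im z" for z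
      unfolding F_def using that
      by (intro DERIV_imp_deriv) (auto intro!: derivative_eq_intros holomorphic_derivI[OF hol oH])
    have "cmod (F (Complex (x + h * s) h) - F z0) \<le> cmod D * (exp (e * T) - 1) * cmod (Complex (x + h * s) h - z0)"
      unfolding z0_def
    proof (rule segment_bound[OF Fh oH])
      fix y assume y: "y \<in> closed_segment (Complex x h) (Complex (x + h * s) h)"
      then have im: "Im y = h" by (rule closed_segment_horizontal)
      define s' where "s' = (Re y - x) / h"
      have yC: "y = Complex (x + h * s') h" using im h by (simp add: s'_def complex_eq_iff)
      have "\<bar>s'\<bar> \<le> \<bar>s\<bar>"
      proof -
        obtain u where u: "0 \<le> u" "u \<le> 1" "y = (1 - u) *\<^sub>R Complex x h + u *\<^sub>R Complex (x + h * s) h"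
          using y by (auto simp: closed_segment_def)
        have "Re y = (1 - u) * x + u * (x + h * s)" using u(3) by simp
        then have "Re y = x + u * h * s" by (simp add: algebra_simps)
        then have "s' = u * s" using h by (simp add: s'_def)
        then show ?thesis using u by (simp add: abs_mult mult_left_le_one_le)
      qed
      then have "cmod (L y - L z0) \<le> e * T" using hor[of s'] s yC by simp
      then show "cmod (deriv F y) \<le> cmod D * (exp (e * T) - 1)"
        using dE[of y] Fd[of y] im h by simp
    qed (use h closed_segment_horizontal in fastforce)
    also have "cmod (Complex (x + h * s) h - z0) = h * \<bar>s\<bar>"
      using h by (simp add: z0_def cmod_def abs_mult)
    also have "cmod D * (exp (e * T) - 1) * (h * \<bar>s\<bar>) \<le> cmod D * (exp (e * T) - 1) * (h * T)"
      using s h e T0 by (intro mult_left_mono) auto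
    finally have "cmod (F (Complex (x + h * s) h) - F z0) \<le> h * cmod D * (T * (exp (e * T) - 1))"
      by (simp add: mult_ac)
    moreover have "F (Complex (x + h * s) h) - F z0 = E (Complex (x + h * s) h) - (E z0 + of_real (h * s) * D)"
    proof -
      have "Complex (x + h * s) h = z0 + of_real (h * s)" by (simp add: z0_def complex_eq_iff)
      then show ?thesis by (simp add: F_def algebra_simps)
    qed
    ultimately show ?thesis by simp
  qed
  have B: "cmod (E (Complex (x + h * s) h) - \<i> * of_real h * D - bv (x + h * s)) \<le> h * cmod D * (exp (e * T) / (1 - e) - 1)"
  proof -
    define \<gamma> where "\<gamma> \<tau> = of_real (x + h * s) + \<i> * of_real h * of_real \<tau>" for \<tau> :: real
    have \<gamma>C: "\<gamma> \<tau> = Complex (x + h * s) (h * \<tau>)" for \<tau> by (simp add: \<gamma>_def complex_eq_iff)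
    have \<gamma>d: "(\<gamma> has_vector_derivative \<i> * of_real h) (at \<tau>)" for \<tau>
      unfolding \<gamma>_def by (rule has_vector_derivative_real_field[where f = "\<lambda>z. of_real (x + h * s) + \<i> * of_real h * z"])
        (auto intro!: derivative_eq_intros)
    define \<psi> where "\<psi> \<tau> = (E \<circ> \<gamma>) \<tau> - \<i> * of_real h * D * of_real \<tau>" for \<tau>
    \<comment> \<open>An antiderivative of the majorant. Since \<open>1 - e > 0\<close>, it is
      continuous at \<open>\<tau> = 0\<close>, where the majorant itself may blow up.\<close>
    define \<phi> where "\<phi> \<tau> = h * cmod D * (exp (e * T) * (\<tau> powr (1 - e) / (1 - e)) - \<tau>)" for \<tau>
    have "cmod (\<psi> 1 - \<psi> 0) \<le> \<phi> 1 - \<phi> 0"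
    proof (rule differentiable_bound_general[where f' = "\<lambda>\<tau>. \<i> * of_real h * deriv E (\<gamma> \<tau>) - \<i> * of_real h * D"
          and \<phi>' = "\<lambda>\<tau>. h * cmod D * (exp (e * T) * \<tau> powr (- e) - 1)"])
      have c: "continuous_on {0..1} (E \<circ> \<gamma>)"
      proof (rule continuous_on_compose)
        show "continuous_on {0..1} \<gamma>" unfolding \<gamma>_def by (intro continuous_intros)
        show "continuous_on (\<gamma> ` {0..1}) E"
          by (rule continuous_on_subset[OF cont]) (use h in \<open>auto simp: \<gamma>C\<close>)
      qed
      show "continuous_on {0..1} \<psi>" unfolding \<psi>_def by (rule continuous_on_diff[OF c]) (intro continuous_intros)
      have p: "continuous_on {0..1} (\<lambda>\<tau>::real. \<tau> powr (1 - e))"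
        using e by (intro continuous_on_powr') (auto intro!: continuous_intros)
      show "continuous_on {0..1} \<phi>" unfolding \<phi>_def
        by (intro continuous_on_mult continuous_on_diff continuous_on_divide continuous_on_const continuous_on_id p)
          (use e in auto)
    next
      fix \<tau> :: real assume \<tau>: "0 < \<tau>" "\<tau> < 1"
      have pos: "0 < Im (\<gamma> \<tau>)" using \<tau> h by (simp add: \<gamma>C)
      have "(E has_field_derivative deriv E (\<gamma> \<tau>)) (at (\<gamma> \<tau>))"
        using holomorphic_derivI[OF hol oH] pos by simp
      from field_vector_diff_chain_at[OF \<gamma>d this]
      have 1: "((E \<circ> \<gamma>) has_vector_derivative \<i> * of_real h * deriv E (\<gamma> \<tau>)) (at \<tau>)" .
      have 2: "((\<lambda>\<tau>. \<i> * of_real h * D * of_real \<tau>) has_vector_derivative \<i> * of_real h * D) (at \<tau>)"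
        by (rule has_vector_derivative_real_field[where f = "\<lambda>z. \<i> * of_real h * D * z"]) (auto intro!: derivative_eq_intros)
      show "(\<psi> has_vector_derivative \<i> * of_real h * deriv E (\<gamma> \<tau>) - \<i> * of_real h * D) (at \<tau>)"
        unfolding \<psi>_def by (rule has_vector_derivative_diff[OF 1 2])
      have "((\<lambda>\<tau>. \<tau> powr (1 - e)) has_real_derivative (1 - e) * \<tau> powr (1 - e - 1)) (at \<tau>)"
        using \<tau> by (intro has_real_derivative_powr)
      from DERIV_cdivide[OF this, of "1 - e"]
      have "((\<lambda>\<tau>. \<tau> powr (1 - e) / (1 - e)) has_real_derivative \<tau> powr (- e)) (at \<tau>)"
        using e by simp
      from DERIV_cmult[OF DERIV_diff[OF DERIV_cmult[OF this] DERIV_ident]]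
      show "(\<phi> has_vector_derivative h * cmod D * (exp (e * T) * \<tau> powr (- e) - 1)) (at \<tau>)"
        unfolding \<phi>_def has_real_derivative_iff_has_vector_derivative[symmetric] .
      have "cmod (L (\<gamma> \<tau>) - L z0) \<le> e * T + - (e * ln \<tau>)"
        unfolding \<gamma>C using norm_triangle_le[OF add_mono[OF ver[of \<tau>] hor[OF s]]] \<tau> by (simp add: algebra_simps)
      from dE[OF pos this]
      have "cmod (deriv E (\<gamma> \<tau>) - D) \<le> cmod D * (exp (e * T + - (e * ln \<tau>)) - 1)" .
      moreover have "exp (e * T + - (e * ln \<tau>)) = exp (e * T) * \<tau> powr (- e)"
        using \<tau> by (simp only: exp_add powr_def) simp
      ultimately have "cmod (deriv E (\<gamma> \<tau>) - D) \<le> cmod D * (exp (e * T) * \<tau> powr (- e) - 1)" by simp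
      then have "h * cmod (deriv E (\<gamma> \<tau>) - D) \<le> h * (cmod D * (exp (e * T) * \<tau> powr (- e) - 1))"
        using h by (intro mult_left_mono) auto
      moreover have "cmod (\<i> * of_real h * deriv E (\<gamma> \<tau>) - \<i> * of_real h * D) = h * cmod (deriv E (\<gamma> \<tau>) - D)"
        using h by (simp only: right_diff_distrib[symmetric] norm_mult) simp
      ultimately show "cmod (\<i> * of_real h * deriv E (\<gamma> \<tau>) - \<i> * of_real h * D) \<le> h * cmod D * (exp (e * T) * \<tau> powr (- e) - 1)"
        by (simp add: mult.assoc)
    qed simp
    moreover have "\<psi> 1 = E (Complex (x + h * s) h) - \<i> * of_real h * D" "\<psi> 0 = bv (x + h * s)"
      by (simp add: \<psi>_def \<gamma>C, simp add: \<psi>_def \<gamma>_def)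
    moreover have "\<phi> 1 - \<phi> 0 = h * cmod D * (exp (e * T) / (1 - e) - 1)"
      by (simp add: \<phi>_def)
    ultimately show ?thesis by simp
  qed
  define X where "X = E (Complex (x + h * s) h) - (E z0 + of_real (h * s) * D)"
  define Y where "Y = E (Complex (x + h * s) h) - \<i> * of_real h * D - bv (x + h * s)"
  have "bv (x + h * s) - (E z0 + of_real h * (of_real s - \<i>) * D) = X - Y"
    by (simp add: X_def Y_def algebra_simps)
  moreover have "cmod (X - Y) \<le> cmod X + cmod Y"
    by (rule norm_triangle_ineq4)
  ultimately have "cmod (bv (x + h * s) - (E z0 + of_real h * (of_real s - \<i>) * D))
    \<le> h * cmod D * (T * (exp (e * T) - 1)) + h * cmod D * (exp (e * T) / (1 - e) - 1)"
    using A B unfolding X_def[symmetric] Y_def[symmetric] by simp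
  then show ?thesis by (simp add: z0_def D_def algebra_simps)
qed

text \<open>Affine maps preserve ratios exactly. With \<open>h = \<bar>x - b\<bar>\<close> the
  points become \<open>x + h * sa\<close> and \<open>x + h * sb\<close> with
  \<open>\<bar>sa\<bar> \<le> t\<close> and \<open>\<bar>sb\<bar> = 1\<close>, and the deviation
  from the affine map is a small fraction of the image scale \<open>h * cmod D\<close>.\<close>

lemma log_deriv_vanishing_imp_asymptotically_symmetric:
  assumes L: "L holomorphic_on {z. 0 < Im z}" "\<And>z. 0 < Im z \<Longrightarrow> exp (L z) = deriv E z"
    and lim: "\<And>e. 0 < e \<Longrightarrow> \<exists>y0>0. \<forall>z. 0 < Im z \<and> Im z \<le> y0 \<longrightarrow> Im z * cmod (deriv L z) \<le> e"
    and \<epsilon>: "0 < \<epsilon>" and t: "0 < t"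
  obtains \<delta> where "0 < \<delta>" "\<And>x a b. x \<noteq> b \<Longrightarrow> \<bar>x - b\<bar> \<le> \<delta> \<Longrightarrow> \<bar>x - a\<bar> \<le> t * \<bar>x - b\<bar> \<Longrightarrow>
     cmod (bv x - bv a) \<le> (1 + \<epsilon>) * t * cmod (bv x - bv b)"
proof -
  define T where "T = max t 1"
  define \<kappa> where "\<kappa> e = (exp (e * T) / (1 - e) - 1) + T * (exp (e * T) - 1)" for e
  \<comment> \<open>The solution of \<open>t + 2 * \<kappa>0 = (1 + \<epsilon>) * t * (1 - 2 *
    \<kappa>0)\<close>; a distance carries the errors of both its end points, hence
    \<open>2 * \<kappa>0\<close>.\<close>
  define \<kappa>0 where "\<kappa>0 = \<epsilon> * t / (2 * (1 + (1 + \<epsilon>) * t))"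
  have p1: "0 < 1 + (1 + \<epsilon>) * t" using \<epsilon> t by (simp add: add_pos_pos)
  have k0: "\<kappa>0 > 0" unfolding \<kappa>0_def using \<epsilon> t p1 by simp
  have k1: "2 * \<kappa>0 * (1 + (1 + \<epsilon>) * t) = \<epsilon> * t"
  proof -
    have "2 * (u / (2 * p)) * p = u" if "0 < p" for u p :: real using that by simp
    from this[OF p1] show ?thesis unfolding \<kappa>0_def .
  qed
  have "isCont \<kappa> 0" unfolding \<kappa>_def by (intro continuous_intros) auto
  moreover have "\<kappa> 0 = 0" by (simp add: \<kappa>_def)
  ultimately have "(\<kappa> \<longlongrightarrow> 0) (at 0)" by (simp add: isCont_def)
  from order_tendstoD(2)[OF this k0] obtain d where d: "d > 0" "\<And>e. e \<noteq> 0 \<Longrightarrow> dist e 0 < d \<Longrightarrow> \<kappa> e < \<kappa>0"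
    unfolding eventually_at by auto
  define e where "e = min (d / 2) (1 / 2)"
  have e: "0 < e" "e < 1" "e < d" using d(1) by (auto simp: e_def)
  have e\<kappa>: "\<kappa> e \<le> \<kappa>0" using d(2)[of e] e by simp
  obtain y0 where y0: "y0 > 0" "\<And>z. 0 < Im z \<Longrightarrow> Im z \<le> y0 \<Longrightarrow> Im z * cmod (deriv L z) \<le> e"
    using lim[OF e(1)] by blast
  show thesis
  proof (rule that[OF y0(1)])
    fix x a b :: real assume xb: "x \<noteq> b" "\<bar>x - b\<bar> \<le> y0" and xa: "\<bar>x - a\<bar> \<le> t * \<bar>x - b\<bar>"
    define h where "h = \<bar>x - b\<bar>"
    have h: "0 < h" "h \<le> y0" using xb by (auto simp: h_def)
    define D where "D = deriv E (Complex x h)"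
    define Af where "Af s = E (Complex x h) + of_real h * (of_real s - \<i>) * D" for s :: real
    have near: "cmod (bv (x + h * s) - Af s) \<le> h * cmod D * \<kappa>0" if "\<bar>s\<bar> \<le> T" for s
    proof -
      have "cmod (bv (x + h * s) - Af s) \<le> h * cmod D * \<kappa> e"
        unfolding Af_def D_def \<kappa>_def
        by (rule boundary_nearly_affine[OF L _ e(2) _ h(1) that]) (use e y0 h in auto)
      also have "\<dots> \<le> h * cmod D * \<kappa>0" using e\<kappa> h by (intro mult_left_mono) auto
      finally show ?thesis .
    qed
    have dif: "\<bar>cmod (bv x - bv (x + h * s)) - h * cmod D * \<bar>s\<bar>\<bar> \<le> h * cmod D * (2 * \<kappa>0)"
      if "\<bar>s\<bar> \<le> T" for s
    proof -
      have "Af 0 - Af s = - (of_real h * of_real s * D)" by (simp add: Af_def algebra_simps)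
      then have "cmod (Af 0 - Af s) = h * cmod D * \<bar>s\<bar>" using h by (simp add: norm_mult)
      moreover have "cmod ((bv x - bv (x + h * s)) - (Af 0 - Af s))
         \<le> cmod (bv (x + h * 0) - Af 0) + cmod (bv (x + h * s) - Af s)"
        using norm_triangle_ineq4[of "bv (x + h * 0) - Af 0" "bv (x + h * s) - Af s"]
        by (simp add: algebra_simps)
      moreover have "0 \<le> T" by (simp add: T_def)
      ultimately show ?thesis
        using near[of 0] near[OF that]
          norm_triangle_ineq3[of "bv x - bv (x + h * s)" "Af 0 - Af s"]
        by (simp add: algebra_simps)
    qed
    define sa where "sa = (a - x) / h"
    define sb where "sb = (b - x) / h"
    have sa: "a = x + h * sa" "\<bar>sa\<bar> \<le> t"
      using h xa by (auto simp: sa_def abs_divide pos_divide_le_eq h_def abs_minus_commute)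
    have sb: "b = x + h * sb" "\<bar>sb\<bar> = 1"
      using h by (auto simp: sb_def abs_divide h_def abs_minus_commute)
    have saT: "\<bar>sa\<bar> \<le> T" and sbT: "\<bar>sb\<bar> \<le> T" using sa(2) sb(2) by (auto simp: T_def)
    have 1: "cmod (bv x - bv a) \<le> h * cmod D * (t + 2 * \<kappa>0)"
    proof -
      have "cmod (bv x - bv a) \<le> h * cmod D * (\<bar>sa\<bar> + 2 * \<kappa>0)"
        unfolding distrib_left using dif[OF saT, folded sa(1)] by linarith
      also have "\<dots> \<le> h * cmod D * (t + 2 * \<kappa>0)" using sa h by (intro mult_left_mono) auto
      finally show ?thesis .
    qed
    have 2: "h * cmod D * (1 - 2 * \<kappa>0) \<le> cmod (bv x - bv b)"
      unfolding right_diff_distrib using dif[OF sbT, folded sb(1)] sb(2) by simp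
    have "t + 2 * \<kappa>0 = (1 + \<epsilon>) * t * (1 - 2 * \<kappa>0)" using k1 by (simp add: algebra_simps)
    then have "h * cmod D * (t + 2 * \<kappa>0) = (1 + \<epsilon>) * t * (h * cmod D * (1 - 2 * \<kappa>0))" by simp
    also have "\<dots> \<le> (1 + \<epsilon>) * t * cmod (bv x - bv b)"
      using 2 \<epsilon> t by (intro mult_left_mono) auto
    finally show "cmod (bv x - bv a) \<le> (1 + \<epsilon>) * t * cmod (bv x - bv b)"
      using 1 by simp
  qed
qed

end

section \<open>Distortion of univalent functions on the half-plane\<close>

lemma deriv_bound_cball:
  assumes F: "F holomorphic_on S" and S: "open S" and sub: "cball z r \<subseteq> S" and r: "0 < r"
    and bd: "\<And>x. x \<in> cball z r \<Longrightarrow> cmod (F x) \<le> B"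
  shows "cmod (deriv F z) \<le> B / r"
proof -
  have "cmod ((deriv ^^ 1) F z) \<le> fact 1 * B / r ^ 1"
  proof (rule Cauchy_inequality)
    show "F holomorphic_on ball z r" using F sub ball_subset_cball by (meson holomorphic_on_subset order_trans)
    show "continuous_on (cball z r) F" using F sub by (meson holomorphic_on_subset holomorphic_on_imp_continuous_on)
    show "cmod (F x) \<le> B" if "cmod (z - x) = r" for x using bd[of x] that by (simp add: dist_norm)
  qed (rule r)
  then show ?thesis by simp
qed

text \<open>The exponential is the bound in Schottky's theorem for radius \<open>1/2\<close>.\<close>

definition koebe_const :: real where
  "koebe_const = 256 * exp (pi * exp (pi * 16))"

lemma koebe_const_ge_1: "1 \<le> koebe_const"
proof -
  have "(1::real) \<le> exp (pi * exp (pi * 16))" by simp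
  then show ?thesis unfolding koebe_const_def by linarith
qed

locale unbounded_half_plane_map = half_plane_map +
  assumes frontier_image: "frontier (E ` {z. 0 < Im z}) = E ` \<real>"
    and unbounded_image: "\<not> bounded (E ` \<real>)"
begin

lemma open_upper: "open {z. 0 < Im z}"
  by (rule open_halfspace_Im_gt)

lemma inj_upper: "inj_on E {z. 0 < Im z}"
  by (rule inj_on_subset[OF inj]) auto

lemma open_image_upper: "open (E ` {z. 0 < Im z})"
  using invariance_of_domain[OF holomorphic_on_imp_continuous_on[OF hol] open_upper inj_upper] .

lemma cball_subset_upper: "r < Im z \<Longrightarrow> cball z r \<subseteq> {z. 0 < Im z}"
proof
  fix w assume r: "r < Im z" and w: "w \<in> cball z r"
  have "\<bar>Im z - Im w\<bar> \<le> r" using abs_Im_le_cmod[of "z - w"] w by (simp add: dist_norm)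
  then show "w \<in> {z. 0 < Im z}" using r by simp
qed

text \<open>A weak form of Koebe's distortion theorem: with \<open>w0\<close> a point of the boundary closest to \<open>E z\<close> and \<open>w1\<close>
  a boundary point at the same distance from \<open>w0\<close>, Schottky's theorem applies to
  \<open>(E - w0) / (w1 - w0)\<close>, which omits \<open>0\<close> and \<open>1\<close>.\<close>

lemma koebe_deriv2:
  assumes z: "0 < Im z"
  shows "cmod (deriv (deriv E) z) \<le> koebe_const * cmod (deriv E z) / Im z"
proof -
  let ?H = "{z. 0 < Im z}"
  define S where "S = exp (pi * exp (pi * 16))"
  define y where "y = Im z"
  define w where "w = E z"
  have y0: "y > 0" using z by (simp add: y_def)
  have disj: "E ` ?H \<inter> E ` \<real> = {}"
    using open_image_upper unfolding frontier_image[symmetric] by (simp add: frontier_def interior_open Diff_triv)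
  have clo: "closed (E ` \<real>)" unfolding frontier_image[symmetric] by (rule frontier_closed)
  have ne: "E ` \<real> \<noteq> {}" using Reals_0 by blast
  obtain w0 where w0: "w0 \<in> E ` \<real>" "\<And>v. v \<in> E ` \<real> \<Longrightarrow> dist w w0 \<le> dist w v"
    using distance_attains_inf[OF clo ne] by blast
  define d where "d = dist w w0"
  have wH: "w \<in> E ` ?H" using z by (simp add: w_def)
  have d0: "d > 0" using disj wH w0(1) by (auto simp: d_def)
  have ball_sub: "ball w d \<subseteq> E ` ?H"
  proof (rule ccontr)
    assume n: "\<not> ball w d \<subseteq> E ` ?H"
    have "ball w d \<inter> frontier (E ` ?H) \<noteq> {}"
    proof (rule connected_Int_frontier)
      show "ball w d \<inter> E ` ?H \<noteq> {}" using wH centre_in_ball[of w d] d0 by blast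
    qed (use n in auto)
    then obtain v where "v \<in> ball w d" "v \<in> E ` \<real>" unfolding frontier_image by blast
    then show False using w0(2)[of v] by (simp add: d_def)
  qed
  have connR: "connected (E ` \<real>)"
  proof (rule connected_continuous_image)
    show "continuous_on \<real> E" by (rule continuous_on_subset[OF cont]) (auto simp: complex_is_Real_iff)
    have "(\<real> :: complex set) = range of_real" by (simp add: Reals_def)
    moreover have "connected (range (of_real :: real \<Rightarrow> complex))"
      by (intro connected_continuous_image continuous_intros) simp
    ultimately show "connected (\<real> :: complex set)" by simp
  qed
  \<comment> \<open>The boundary is connected and unbounded, so it meets the circle of radius
    \<open>d\<close> about \<open>w0\<close>.\<close>
  have "\<exists>v\<in>E ` \<real>. d \<le> dist w0 v"
  proof (rule ccontr)
    assume "\<not> (\<exists>v\<in>E ` \<real>. d \<le> dist w0 v)"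
    then have "E ` \<real> \<subseteq> ball w0 d" by (auto simp: not_le)
    then show False using unbounded_image bounded_ball bounded_subset by blast
  qed
  then obtain v where v: "v \<in> E ` \<real>" "d \<le> dist w0 v" by blast
  have "\<exists>x\<in>E ` \<real>. dist w0 x = d"
    by (rule connected_attains[OF connR _ w0(1) v(1)]) (use d0 v in \<open>auto intro!: continuous_intros\<close>)
  then obtain w1 where w1: "w1 \<in> E ` \<real>" "dist w0 w1 = d" by blast
  have w10: "w1 - w0 \<noteq> 0" "cmod (w1 - w0) = d" using w1 d0 by (auto simp: dist_norm norm_minus_commute)
  have omit: "E v \<noteq> w0" "E v \<noteq> w1" if "v \<in> ?H" for v
    using disj w0(1) w1(1) that by blast+
  \<comment> \<open>Here \<open>cmod (\<phi> 0) = 1\<close>. Radius \<open>1 / 2\<close> in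
    Schottky's theorem corresponds to \<open>cball z (y / 4)\<close>, which leaves room for Cauchy's
    inequality twice with radius \<open>y / 8\<close>.\<close>
  define \<phi> where "\<phi> \<zeta> = (E (z + of_real (y / 2) * \<zeta>) - w0) / (w1 - w0)" for \<zeta>
  have inH: "z + of_real (y / 2) * \<zeta> \<in> ?H" if "cmod \<zeta> \<le> 1" for \<zeta>
  proof -
    have "dist z (z + of_real (y / 2) * \<zeta>) \<le> y / 2"
      using that y0 by (simp add: dist_norm norm_mult mult_left_le)
    then show ?thesis using cball_subset_upper[of "y / 2" z] y0 by (auto simp: y_def)
  qed
  have \<phi>hol: "\<phi> holomorphic_on cball 0 1"
  proof -
    have "(E \<circ> (\<lambda>\<zeta>. z + of_real (y / 2) * \<zeta>)) holomorphic_on cball 0 1"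
      by (rule holomorphic_on_compose_gen[OF _ hol]) (use inH in \<open>auto intro!: holomorphic_intros\<close>)
    then show ?thesis unfolding \<phi>_def using w10 by (intro holomorphic_intros) (auto simp: o_def)
  qed
  have bound: "cmod (E v - w0) \<le> S * d" if v: "v \<in> cball z (y / 4)" for v
  proof -
    define \<zeta> where "\<zeta> = (v - z) / of_real (y / 2)"
    have "cmod \<zeta> = cmod (v - z) / (y / 2)"
      unfolding \<zeta>_def norm_divide norm_of_real using y0 by (simp only: abs_of_pos half_gt_zero)
    moreover have "cmod (v - z) \<le> y / 4" using v by (simp add: dist_norm norm_minus_commute)
    ultimately have \<zeta>: "cmod \<zeta> \<le> 1 / 2" using y0 by (simp add: pos_divide_le_eq)
    have "cmod (\<phi> \<zeta>) \<le> exp (pi * exp (pi * (2 + 2 * 1 + 12 * (1/2) / (1 - 1/2))))"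
    proof (rule Schottky[OF \<phi>hol _ _ _ _ \<zeta>])
      show "cmod (\<phi> 0) \<le> 1" using d0 w10(2) by (simp add: \<phi>_def norm_divide d_def w_def dist_norm)
      show "\<not> (\<phi> x = 0 \<or> \<phi> x = 1)" if "x \<in> cball 0 1" for x
        using omit[OF inH[of x]] that w10 by (auto simp: \<phi>_def)
    qed auto
    then have "cmod (\<phi> \<zeta>) \<le> S" by (simp add: S_def)
    moreover have gen: "z + k * ((v - z) / k) = v" if "k \<noteq> 0" for k
      using that by simp
    have "z + of_real (y / 2) * \<zeta> = v"
      unfolding \<zeta>_def by (rule gen) (use y0 in simp)
    then have "\<phi> \<zeta> = (E v - w0) / (w1 - w0)" by (simp only: \<phi>_def)
    ultimately show ?thesis using d0 w10 by (simp add: norm_divide pos_divide_le_eq)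
  qed
  have dd: "deriv (\<lambda>v. E v - w0) v = deriv E v" if "v \<in> ?H" for v
    using that by (intro DERIV_imp_deriv) (auto intro!: derivative_eq_intros holomorphic_derivI[OF hol open_upper])
  have bound': "cmod (deriv E v) \<le> S * d / (y / 8)" if v: "v \<in> cball z (y / 8)" for v
  proof -
    have vH: "v \<in> ?H" using cball_subset_upper[of "y / 8" z] v y0 by (auto simp: y_def)
    have "cmod (deriv (\<lambda>v. E v - w0) v) \<le> S * d / (y / 8)"
    proof (rule deriv_bound_cball[OF _ open_upper])
      show "(\<lambda>v. E v - w0) holomorphic_on ?H" by (intro holomorphic_intros hol)
      have sub: "cball v (y / 8) \<subseteq> cball z (y / 4)"
      proof
        fix x assume "x \<in> cball v (y / 8)"
        then show "x \<in> cball z (y / 4)" using v dist_triangle[of z x v] by simp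
      qed
      then show "cball v (y / 8) \<subseteq> ?H" using cball_subset_upper[of "y / 4" z] y0 by (auto simp: y_def)
      show "cmod (E x - w0) \<le> S * d" if "x \<in> cball v (y / 8)" for x using bound sub that by blast
    qed (use y0 in auto)
    then show ?thesis using dd[OF vH] by simp
  qed
  have E2: "cmod (deriv (deriv E) z) \<le> S * d / (y / 8) / (y / 8)"
  proof (rule deriv_bound_cball[OF holomorphic_deriv[OF hol open_upper] open_upper _ _ bound'])
    show "cball z (y / 8) \<subseteq> ?H" using cball_subset_upper[of "y / 8" z] y0 by (auto simp: y_def)
  qed (use y0 in auto)
  \<comment> \<open>The inverse map is defined on the disc of radius \<open>d\<close> about
    \<open>w\<close>. Followed by the Cayley transform that sends \<open>z\<close> to
    \<open>0\<close> it is bounded by \<open>1\<close>, and its derivative at \<open>w\<close> has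
    modulus \<open>1 / (2 * y * cmod (deriv E z))\<close>, which Cauchy's inequality bounds by
    \<open>2 / d\<close>.\<close>
  have E1: "d \<le> 4 * y * cmod (deriv E z)"
  proof -
    obtain \<psi> where \<psi>: "\<psi> holomorphic_on (E ` ?H)" "\<And>v. v \<in> ?H \<Longrightarrow> deriv E v * deriv \<psi> (E v) = 1"
        "\<And>v. v \<in> ?H \<Longrightarrow> \<psi> (E v) = v"
      using holomorphic_has_inverse[OF hol open_upper inj_upper] by metis
    have \<psi>H: "\<psi> v \<in> ?H" if "v \<in> E ` ?H" for v using that \<psi>(3) by auto
    define cay where "cay v = (\<psi> v - z) / (\<psi> v - cnj z)" for v
    have den: "\<psi> v - cnj z \<noteq> 0" if "v \<in> E ` ?H" for v
    proof
      assume "\<psi> v - cnj z = 0"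
      then have "Im (\<psi> v) = - Im z" by simp
      then show False using \<psi>H[OF that] z by simp
    qed
    have cayhol: "cay holomorphic_on (E ` ?H)"
      unfolding cay_def by (intro holomorphic_intros \<psi>(1)) (use den in auto)
    have cay1: "cmod (cay v) \<le> 1" if v: "v \<in> E ` ?H" for v
    proof -
      have "0 < Im (\<psi> v)" using \<psi>H[OF v] by simp
      then have "(Im (\<psi> v) - Im z)\<^sup>2 \<le> (Im (\<psi> v) + Im z)\<^sup>2"
        using z by (intro power2_le_iff_abs_le[THEN iffD2]) auto
      then have "cmod (\<psi> v - z) \<le> cmod (\<psi> v - cnj z)"
        unfolding cmod_def by (intro real_sqrt_le_mono) simp
      then show ?thesis using den[OF v] by (simp add: cay_def norm_divide divide_le_eq)
    qed
    have "cmod (deriv cay w) \<le> 1 / (d / 2)"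
    proof (rule deriv_bound_cball[OF cayhol open_image_upper])
      have s: "cball w (d / 2) \<subseteq> ball w d" using d0 by auto
      then show "cball w (d / 2) \<subseteq> E ` ?H" using ball_sub by blast
      show "cmod (cay x) \<le> 1" if "x \<in> cball w (d / 2)" for x using cay1 s that ball_sub by blast
    qed (use d0 in simp)
    moreover have "deriv cay w = deriv \<psi> w / (z - cnj z)"
    proof (rule DERIV_imp_deriv)
      have "(\<psi> has_field_derivative deriv \<psi> w) (at w)" using holomorphic_derivI[OF \<psi>(1) open_image_upper wH] .
      moreover have "\<psi> w = z" using \<psi>(3)[of z] z by (simp add: w_def)
      moreover have "z - cnj z \<noteq> 0" using den[OF wH] \<open>\<psi> w = z\<close> by simp
      ultimately show "(cay has_field_derivative deriv \<psi> w / (z - cnj z)) (at w)"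
        unfolding cay_def by (auto intro!: derivative_eq_intros simp: divide_simps)
    qed
    moreover have "deriv \<psi> w = 1 / deriv E z"
      using \<psi>(2)[of z] z deriv_E_nonzero[OF z] by (simp add: w_def field_simps)
    moreover have "cmod (z - cnj z) = 2 * y"
      using y0 by (simp add: complex_diff_cnj norm_mult y_def)
    ultimately have le: "1 / cmod (deriv E z) / (2 * y) \<le> 1 / (d / 2)"
      by (simp only: norm_divide norm_one)
    have m0: "cmod (deriv E z) > 0" using deriv_E_nonzero[OF z] by simp
    show ?thesis using le d0 y0 m0 by (simp add: divide_simps mult_ac split: if_splits)
  qed
  \<comment> \<open>The factor \<open>64 = 8 * 8\<close> from the two Cauchy estimates and the
    factor \<open>4\<close> of \<open>E1\<close> make up the \<open>256\<close> in
    \<open>koebe_const\<close>.\<close>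
  have "cmod (deriv (deriv E) z) \<le> 64 * S * d / y\<^sup>2" using E2 by (simp add: power2_eq_square)
  also have "\<dots> \<le> 64 * S * (4 * y * cmod (deriv E z)) / y\<^sup>2"
    using E1 by (intro divide_right_mono mult_left_mono) (auto simp: S_def)
  also have "\<dots> = koebe_const * cmod (deriv E z) / Im z"
    using y0 by (simp add: power2_eq_square koebe_const_def S_def y_def)
  finally show ?thesis .
qed

lemma log_deriv_bounds:
  assumes W: "W holomorphic_on {z. 0 < Im z}" "\<And>z. 0 < Im z \<Longrightarrow> exp (W z) = deriv E z" and z: "0 < Im z"
  shows "cmod (deriv W z) \<le> koebe_const / Im z"
    and "deriv W z * deriv E z = deriv (deriv E) z"
proof -
  have 1: "((\<lambda>v. exp (W v)) has_field_derivative exp (W z) * deriv W z) (at z)"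
    using holomorphic_derivI[OF W(1) open_upper, of z UNIV] z by (intro DERIV_fun_exp) simp
  have "((deriv E) has_field_derivative exp (W z) * deriv W z) (at z)"
    by (rule has_field_derivative_transform_within_open[OF 1 open_upper]) (use W(2) z in auto)
  then show eq: "deriv W z * deriv E z = deriv (deriv E) z"
    using DERIV_imp_deriv W(2)[OF z] by (metis mult.commute)
  have "cmod (deriv W z) * cmod (deriv E z) \<le> koebe_const / Im z * cmod (deriv E z)"
    using koebe_deriv2[OF z] by (simp flip: eq add: norm_mult)
  then show "cmod (deriv W z) \<le> koebe_const / Im z"
    by (rule mult_right_le_imp_le) (use deriv_E_nonzero[OF z] in simp)
qed

lemma log_deriv_exists:
  obtains W where "W holomorphic_on {z. 0 < Im z}" "\<And>z. 0 < Im z \<Longrightarrow> exp (W z) = deriv E z"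
proof -
  obtain W where "W holomorphic_on {z. 0 < Im z}" "\<And>z. z \<in> {z. 0 < Im z} \<Longrightarrow> exp (W z) = deriv E z"
    using holomorphic_logarithm_exists[OF convex_halfspace_Im_gt open_upper holomorphic_deriv[OF hol open_upper], of \<i>]
      deriv_E_nonzero by auto
  then show thesis using that by simp
qed

section \<open>Lower bounds and difference quotients of univalent functions\<close>

definition distortion_radius :: real where
  "distortion_radius = 1 / (4 * koebe_const)"

lemma distortion_radius_pos: "0 < distortion_radius" "distortion_radius \<le> 1 / 4"
  using koebe_const_ge_1 by (auto simp: distortion_radius_def divide_simps)

text \<open>Integration of \<open>log_deriv_bounds\<close> along the segment from \<open>z\<close>
  to \<open>v\<close>, on which the height stays above \<open>Im z / 2\<close>.\<close>

lemma deriv_distortion: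
  assumes z: "0 < Im z" and v: "cmod (v - z) \<le> distortion_radius * Im z"
  shows "cmod (deriv E v) \<le> 2 * cmod (deriv E z)"
proof -
  obtain W where W: "W holomorphic_on {z. 0 < Im z}" "\<And>z. 0 < Im z \<Longrightarrow> exp (W z) = deriv E z"
    using log_deriv_exists by blast
  have rad: "distortion_radius * Im z \<le> Im z / 4" using distortion_radius_pos z by simp
  have seg: "x \<in> closed_segment z v \<Longrightarrow> cmod (x - z) \<le> Im z / 4" for x
    using segment_bound1[of x z v] v rad by linarith
  have im: "3 / 4 * Im z \<le> Im x" if "x \<in> closed_segment z v" for x
    using seg[OF that] abs_Im_le_cmod[of "x - z"] by simp
  have "cmod (W v - W z) \<le> koebe_const / (Im z / 2) * cmod (v - z)"
  proof (rule segment_bound[OF W(1) open_upper])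
    show "closed_segment z v \<subseteq> {z. 0 < Im z}" using im z by fastforce
    fix x assume x: "x \<in> closed_segment z v"
    have "0 < Im x" "Im z / 2 \<le> Im x" using im[OF x] z by linarith+
    then have "koebe_const / Im x \<le> koebe_const / (Im z / 2)"
      using koebe_const_ge_1 z by (intro divide_left_mono) auto
    then show "cmod (deriv W x) \<le> koebe_const / (Im z / 2)"
      using log_deriv_bounds(1)[OF W \<open>0 < Im x\<close>] by linarith
  qed
  also have "\<dots> \<le> koebe_const / (Im z / 2) * (distortion_radius * Im z)"
    using v koebe_const_ge_1 z by (intro mult_left_mono) auto
  \<comment> \<open>This equation dictates the value of \<open>distortion_radius\<close>: the
    logarithm of the derivative changes by at most \<open>1 / 2\<close>, which is below
    \<open>ln 2\<close>.\<close>
  also have "\<dots> = 1 / 2" using z koebe_const_ge_1 by (simp add: distortion_radius_def)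
  finally have dW: "cmod (W v - W z) \<le> 1 / 2" .
  have vim: "0 < Im v" using im[of v] z by simp
  have "deriv E v = deriv E z * exp (W v - W z)"
    by (simp add: exp_diff W(2)[OF z, symmetric] W(2)[OF vim, symmetric])
  then have "cmod (deriv E v) = cmod (deriv E z) * exp (Re (W v - W z))"
    by (simp add: norm_mult)
  also have "\<dots> \<le> cmod (deriv E z) * exp (ln 2)"
  proof (intro mult_left_mono)
    show "exp (Re (W v - W z)) \<le> exp (ln 2 :: real)"
      using dW complex_Re_le_cmod[of "W v - W z"] ln2_ge_two_thirds unfolding exp_le_cancel_iff by linarith
  qed simp
  finally show ?thesis by simp
qed

text \<open>By \<open>Bloch_lemma\<close> the image of \<open>ball z r\<close> contains a disc about
  \<open>E z\<close> of radius at least \<open>r * cmod (deriv E z) / 8\<close>, and by injectivity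
  \<open>E v\<close> is not in this image. The \<open>1 / 8\<close> is a convenient lower bound for
  \<open>3 - 2 * sqrt 2\<close>.\<close>

lemma univalent_lower_bound:
  assumes z: "0 < Im z" and v: "0 < Im v"
  shows "min (distortion_radius * Im z) (cmod (v - z)) * cmod (deriv E z) / 8 \<le> cmod (E v - E z)"
proof (cases "v = z")
  case True
  then show ?thesis using distortion_radius_pos z by simp
next
  case False
  define r where "r = min (distortion_radius * Im z) (cmod (v - z))"
  have r0: "0 < r" using False distortion_radius_pos z by (simp add: r_def)
  have "distortion_radius * Im z \<le> Im z / 4" using distortion_radius_pos z by simp
  moreover have "r \<le> distortion_radius * Im z" by (simp add: r_def)
  ultimately have "r < Im z" using z by linarith
  then have sub: "cball z r \<subseteq> {z. 0 < Im z}" by (rule cball_subset_upper)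
  have "ball (E z) ((3 - 2 * sqrt 2) * r * cmod (deriv E z)) \<subseteq> E ` ball z r"
  proof (rule Bloch_lemma[OF holomorphic_on_subset[OF hol sub] r0])
    fix x assume "x \<in> ball z r"
    then show "cmod (deriv E x) \<le> 2 * cmod (deriv E z)"
      by (intro deriv_distortion[OF z]) (simp add: dist_norm r_def norm_minus_commute)
  qed
  moreover have "E v \<notin> E ` ball z r"
  proof
    assume "E v \<in> E ` ball z r"
    then obtain x where x: "x \<in> ball z r" "E v = E x" by blast
    then have "v = x" using inj_onD[OF inj_upper x(2)] v sub ball_subset_cball by blast
    then show False using x(1) by (simp add: r_def dist_norm norm_minus_commute)
  qed
  ultimately have "(3 - 2 * sqrt 2) * r * cmod (deriv E z) \<le> cmod (E v - E z)"
    by (auto simp: dist_norm norm_minus_commute not_less subset_iff)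
  moreover have "1 / 8 \<le> 3 - 2 * sqrt 2"
  proof -
    have "sqrt 2 \<le> sqrt ((23 / 16)\<^sup>2)" by (rule real_sqrt_le_mono) (simp add: power2_eq_square)
    then show ?thesis by simp
  qed
  then have "1 / 8 * (r * cmod (deriv E z)) \<le> (3 - 2 * sqrt 2) * (r * cmod (deriv E z))"
    using r0 by (intro mult_right_mono) auto
  ultimately show ?thesis by (simp add: r_def mult.assoc)
qed

text \<open>The bound must be uniform in \<open>a\<close>. For large \<open>a\<close> the two
  derivatives are bounded separately by \<open>univalent_lower_bound\<close>; for small
  \<open>a\<close> their difference is controlled by the second derivative on a segment of length
  \<open>a\<close>, and this \<open>a\<close> cancels against the lower bound for the
  denominator.\<close>

lemma difference_log_deriv_bound:
  assumes z: "0 < Im z" and a: "0 < a"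
  shows "cmod ((deriv E (z + of_real a) - deriv E z) / (E (z + of_real a) - E z)) \<le> 64 * koebe_const / Im z"
proof -
  let ?v = "z + of_real a"
  define y where "y = Im z"
  define c where "c = distortion_radius"
  have y0: "y > 0" using z by (simp add: y_def)
  have c0: "c > 0" by (simp add: c_def distortion_radius_pos)
  have v: "0 < Im ?v" using z by simp
  have D: "cmod (E ?v - E z) > 0" using inj_onD[OF inj_upper, of ?v z] z a by auto
  have lb: "min (c * y) a * cmod (deriv E z) / 8 \<le> cmod (E ?v - E z)"
    using univalent_lower_bound[OF z v] a by (simp add: c_def y_def)
  have lb': "min (c * y) a * cmod (deriv E ?v) / 8 \<le> cmod (E ?v - E z)"
    using univalent_lower_bound[OF v z] a by (simp add: c_def y_def norm_minus_commute)
  have "cmod (deriv E ?v - deriv E z) \<le> 64 * koebe_const / y * cmod (E ?v - E z)"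
  proof (cases "c * y \<le> a")
    case True
    have "cmod (deriv E z) \<le> 8 / (c * y) * cmod (E ?v - E z)" "cmod (deriv E ?v) \<le> 8 / (c * y) * cmod (E ?v - E z)"
      using lb lb' True c0 y0 by (simp_all add: field_simps)
    then have "cmod (deriv E ?v - deriv E z) \<le> 16 / (c * y) * cmod (E ?v - E z)"
      using norm_triangle_ineq4[of "deriv E ?v" "deriv E z"] by simp
    also have "16 / (c * y) = 64 * koebe_const / y"
      using koebe_const_ge_1 y0 by (simp add: c_def distortion_radius_def)
    finally show ?thesis .
  next
    case False
    have "z = Complex (Re z) y" "?v = Complex (Re z + a) y" by (simp_all add: complex_eq_iff y_def)
    note zv = this
    have imx: "Im x = y" if "x \<in> closed_segment z ?v" for x
      using that zv closed_segment_horizontal by metis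
    have "cmod (deriv E ?v - deriv E z) \<le> koebe_const * (2 * cmod (deriv E z)) / y * cmod (?v - z)"
    proof (rule segment_bound[OF holomorphic_deriv[OF hol open_upper] open_upper])
      show "closed_segment z ?v \<subseteq> {z. 0 < Im z}" using imx y0 by auto
      fix x assume x: "x \<in> closed_segment z ?v"
      have "cmod (x - z) \<le> a" using segment_bound1[OF x] a by simp
      then have "cmod (deriv E x) \<le> 2 * cmod (deriv E z)"
        using False by (intro deriv_distortion[OF z]) (simp add: c_def y_def)
      then have "koebe_const * cmod (deriv E x) / y \<le> koebe_const * (2 * cmod (deriv E z)) / y"
        using koebe_const_ge_1 y0 by (intro divide_right_mono mult_left_mono) auto
      then show "cmod (deriv (deriv E) x) \<le> koebe_const * (2 * cmod (deriv E z)) / y"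
        using koebe_deriv2[of x] imx[OF x] y0 by simp
    qed
    also have "\<dots> = 16 * koebe_const / y * (a * cmod (deriv E z) / 8)" using a by simp
    also have "\<dots> \<le> 16 * koebe_const / y * cmod (E ?v - E z)"
      using lb False koebe_const_ge_1 y0 by (intro mult_left_mono) auto
    also have "\<dots> \<le> 64 * koebe_const / y * cmod (E ?v - E z)"
      using koebe_const_ge_1 y0 by (intro mult_right_mono divide_right_mono) auto
    finally show ?thesis .
  qed
  then show ?thesis using D by (simp add: norm_divide pos_divide_le_eq y_def)
qed

text \<open>If \<open>deriv W\<close> were constant, the function \<open>\<Psi>\<close> would be
  constant and the quotient would equal \<open>deriv W z\<close>. In general the derivative of
  \<open>\<Psi>\<close> at \<open>x\<close> is \<open>(deriv W x - deriv W z) * deriv E x\<close>,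
  whose first factor is of order \<open>a / y\<^sup>2\<close> by Cauchy's inequality for
  \<open>deriv W\<close>.\<close>

lemma difference_log_deriv_approx:
  assumes W: "W holomorphic_on {z. 0 < Im z}" "\<And>z. 0 < Im z \<Longrightarrow> exp (W z) = deriv E z"
    and z: "0 < Im z" and a: "0 < a" "a \<le> distortion_radius * Im z"
  shows "cmod ((deriv E (z + of_real a) - deriv E z) / (E (z + of_real a) - E z) - deriv W z)
    \<le> 64 * koebe_const * a / (Im z)\<^sup>2"
proof -
  let ?v = "z + of_real a"
  define y where "y = Im z"
  have y0: "y > 0" using z by (simp add: y_def)
  have v: "0 < Im ?v" using z by simp
  have D: "cmod (E ?v - E z) > 0" using inj_onD[OF inj_upper, of ?v z] z a by auto
  have lb: "a * cmod (deriv E z) / 8 \<le> cmod (E ?v - E z)"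
    using univalent_lower_bound[OF z v] a by (simp add: min_def split: if_splits)
  have zv: "z = Complex (Re z) y" "?v = Complex (Re z + a) y" by (simp_all add: complex_eq_iff y_def)
  have imx: "Im x = y" if "x \<in> closed_segment z ?v" for x
    using that zv closed_segment_horizontal by metis
  have segH: "closed_segment z ?v \<subseteq> {z. 0 < Im z}" using imx y0 by auto
  have W2: "cmod (deriv (deriv W) x) \<le> 4 * koebe_const / y\<^sup>2" if x: "x \<in> closed_segment z ?v" for x
  proof -
    have "cmod (deriv (deriv W) x) \<le> koebe_const / (y / 2) / (y / 2)"
    proof (rule deriv_bound_cball[OF holomorphic_deriv[OF W(1) open_upper] open_upper])
      show "cball x (y / 2) \<subseteq> {z. 0 < Im z}" using cball_subset_upper[of "y / 2" x] imx[OF x] y0 by simp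
      fix u assume u: "u \<in> cball x (y / 2)"
      have "\<bar>Im x - Im u\<bar> \<le> y / 2" using abs_Im_le_cmod[of "x - u"] u by (simp add: dist_norm)
      then have iu: "y / 2 \<le> Im u" using imx[OF x] by linarith
      then have "koebe_const / Im u \<le> koebe_const / (y / 2)"
        using koebe_const_ge_1 y0 by (intro divide_left_mono) auto
      then show "cmod (deriv W u) \<le> koebe_const / (y / 2)"
        using log_deriv_bounds(1)[OF W, of u] iu y0 by linarith
    qed (use y0 in simp)
    then show ?thesis by (simp add: power2_eq_square)
  qed
  have dW: "cmod (deriv W x - deriv W z) \<le> 4 * koebe_const / y\<^sup>2 * a" if x: "x \<in> closed_segment z ?v" for x
  proof -
    have sub: "closed_segment z x \<subseteq> closed_segment z ?v" using x by (simp add: subset_closed_segment)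
    have "cmod (deriv W x - deriv W z) \<le> 4 * koebe_const / y\<^sup>2 * cmod (x - z)"
      by (rule segment_bound[OF holomorphic_deriv[OF W(1) open_upper] open_upper]) (use sub segH W2 in auto)
    also have "\<dots> \<le> 4 * koebe_const / y\<^sup>2 * a"
      using segment_bound1[OF x] a koebe_const_ge_1 by (intro mult_left_mono) auto
    finally show ?thesis .
  qed
  define \<Psi> where "\<Psi> x = deriv E x - deriv W z * E x" for x
  have \<Psi>h: "\<Psi> holomorphic_on {z. 0 < Im z}"
    unfolding \<Psi>_def by (intro holomorphic_intros hol holomorphic_deriv open_upper)
  have \<Psi>d: "deriv \<Psi> x = (deriv W x - deriv W z) * deriv E x" if "0 < Im x" for x
  proof -
    have "(E has_field_derivative deriv E x) (at x)" "(deriv E has_field_derivative deriv (deriv E) x) (at x)"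
      using that holomorphic_derivI[OF hol open_upper, of x] holomorphic_derivI[OF holomorphic_deriv[OF hol open_upper] open_upper, of x] by auto
    then have "(\<Psi> has_field_derivative (deriv (deriv E) x - deriv W z * deriv E x)) (at x)"
      unfolding \<Psi>_def by (intro DERIV_diff DERIV_cmult)
    then show ?thesis using log_deriv_bounds(2)[OF W that] by (simp add: DERIV_imp_deriv left_diff_distrib)
  qed
  have "cmod (\<Psi> ?v - \<Psi> z) \<le> (4 * koebe_const / y\<^sup>2 * a) * (2 * cmod (deriv E z)) * cmod (?v - z)"
  proof (rule segment_bound[OF \<Psi>h open_upper segH])
    fix x assume x: "x \<in> closed_segment z ?v"
    have "cmod (x - z) \<le> a" using segment_bound1[OF x] a by simp
    then have "cmod (deriv E x) \<le> 2 * cmod (deriv E z)"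
      using a by (intro deriv_distortion[OF z]) simp
    then have "cmod (deriv W x - deriv W z) * cmod (deriv E x) \<le> (4 * koebe_const / y\<^sup>2 * a) * (2 * cmod (deriv E z))"
      using dW[OF x] koebe_const_ge_1 a by (intro mult_mono) auto
    then show "cmod (deriv \<Psi> x) \<le> (4 * koebe_const / y\<^sup>2 * a) * (2 * cmod (deriv E z))"
      using \<Psi>d[of x] imx[OF x] y0 by (simp add: norm_mult)
  qed
  also have "\<dots> = 64 * koebe_const * a / y\<^sup>2 * (a * cmod (deriv E z) / 8)" using a by simp
  also have "\<dots> \<le> 64 * koebe_const * a / y\<^sup>2 * cmod (E ?v - E z)"
    using lb koebe_const_ge_1 a by (intro mult_left_mono) auto
  finally have main: "cmod (\<Psi> ?v - \<Psi> z) \<le> 64 * koebe_const * a / y\<^sup>2 * cmod (E ?v - E z)" .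
  have "(deriv E ?v - deriv E z) / (E ?v - E z) - deriv W z = (\<Psi> ?v - \<Psi> z) / (E ?v - E z)"
    using D by (simp add: \<Psi>_def field_simps)
  then show ?thesis using main D by (simp only: norm_divide pos_divide_le_eq y_def)
qed

end

section \<open>A derivative estimate from boundary imaginary parts\<close>

text \<open>Because \<open>f w = 0\<close>, the integrand is the difference quotient of
  \<open>f\<close> divided by \<open>z - w\<close>, and Cauchy's formula returns the value
  \<open>deriv f w\<close> of that quotient at \<open>w\<close>. On the boundary \<open>f\<close> is
  only continuous, which calls for the weak form of the formula.\<close>

lemma rectpath_double_pole:
  assumes cont: "continuous_on (cbox a b) f" and hol: "f holomorphic_on box a b"
    and w: "w \<in> box a b" and fw: "f w = 0"
  shows "((\<lambda>z. f z / (z - w)\<^sup>2) has_contour_integral 2 * of_real pi * \<i> * deriv f w) (rectpath a b)"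
proof -
  have ab: "Re a \<le> Re b" "Im a \<le> Im b" using w by (auto simp: in_box_complex_iff)
  define g where "g z = (if z = w then deriv f w else (f z - f w) / (z - w))" for z
  have ghol: "g holomorphic_on box a b"
    unfolding g_def by (rule pole_lemma_open[OF hol open_box])
  have gcont: "continuous_on (cbox a b) g"
    unfolding continuous_on_eq_continuous_within
  proof
    fix z assume z: "z \<in> cbox a b"
    show "continuous (at z within cbox a b) g"
    proof (cases "z = w")
      case True
      have "isCont g w"
        using holomorphic_on_imp_continuous_on[OF ghol] w by (simp add: continuous_on_eq_continuous_at[OF open_box])
      then show ?thesis unfolding True by (rule continuous_at_imp_continuous_within)
    next
      case False
      have "continuous (at z within cbox a b) f"
        using cont z by (simp add: continuous_on_eq_continuous_within)
      then have "continuous (at z within cbox a b) (\<lambda>z. (f z - f w) / (z - w))"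
        using False by (intro continuous_intros) auto
      then show ?thesis
        by (rule continuous_transform_within[where \<delta> = "dist z w"])
          (use z False in \<open>auto simp: g_def dist_commute\<close>)
    qed
  qed
  have pim: "path_image (rectpath a b) = cbox a b - box a b"
    by (rule path_image_rectpath_cbox_minus_box[OF ab])
  have "((\<lambda>z. g z / (z - w)) has_contour_integral
      complex_of_real (2 * pi) * \<i> * winding_number (rectpath a b) w * g w) (rectpath a b)"
  proof (rule Cauchy_integral_formula_weak[OF convex_box(1) finite.emptyI gcont])
    show "g field_differentiable at x" if "x \<in> interior (cbox a b) - {}" for x
      using that ghol holomorphic_on_open[OF open_box, of g a b] by (auto simp: interior_cbox field_differentiable_def)
  qed (use w pim in \<open>auto simp: interior_cbox\<close>)
  then have "((\<lambda>z. g z / (z - w)) has_contour_integral 2 * of_real pi * \<i> * deriv f w) (rectpath a b)"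
    using winding_number_rectpath[OF w] by (simp add: g_def)
  then show ?thesis
    by (rule has_contour_integral_eq) (use pim w fw in \<open>auto simp: g_def power2_eq_square\<close>)
qed

lemma contour_integral_rectpath_split:
  assumes "Re a \<le> Re b" "Im a \<le> Im b" and cont: "continuous_on (cbox a b - box a b) f"
  shows "contour_integral (rectpath a b) f =
    contour_integral (linepath a (Complex (Re b) (Im a))) f + contour_integral (linepath (Complex (Re b) (Im a)) b) f
    + contour_integral (linepath b (Complex (Re a) (Im b))) f + contour_integral (linepath (Complex (Re a) (Im b)) a) f"
proof -
  have pim: "path_image (rectpath a b) = cbox a b - box a b"
    using assms by (intro path_image_rectpath_cbox_minus_box)
  have sub: "closed_segment a (Complex (Re b) (Im a)) \<subseteq> cbox a b - box a b"
    "closed_segment (Complex (Re b) (Im a)) b \<subseteq> cbox a b - box a b"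
    "closed_segment b (Complex (Re a) (Im b)) \<subseteq> cbox a b - box a b"
    "closed_segment (Complex (Re a) (Im b)) a \<subseteq> cbox a b - box a b"
    unfolding pim[symmetric] by (auto simp: rectpath_def Let_def path_image_join)
  have "f contour_integrable_on linepath a (Complex (Re b) (Im a))"
    "f contour_integrable_on linepath (Complex (Re b) (Im a)) b"
    "f contour_integrable_on linepath b (Complex (Re a) (Im b))"
    "f contour_integrable_on linepath (Complex (Re a) (Im b)) a"
    using sub by (auto intro!: contour_integrable_continuous_linepath intro: continuous_on_subset[OF cont])
  then show ?thesis
    by (simp add: rectpath_def Let_def)
qed

section \<open>A Cauchy kernel with zeros at the lower corners of a rectangle\<close>

text \<open>The kernel is the derivative of \<open>- (z\<^sup>2 - R\<^sup>2)\<^sup>2 / ((R\<^sup>2 + 1)\<^sup>2 (z - \<sigma>))\<close>. Hence it vanishes at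
  the corners \<open>\<plusminus> R\<close>, its integral over \<open>[-R, R]\<close> is zero, and for \<open>\<sigma> = \<i>\<close> it has a double pole
  without residue.\<close>

definition corner_kernel :: "real \<Rightarrow> complex \<Rightarrow> complex \<Rightarrow> complex" where
  "corner_kernel R \<sigma> z = (z\<^sup>2 - of_real (R\<^sup>2)) / of_real ((R\<^sup>2 + 1)\<^sup>2) *
     ((z\<^sup>2 - of_real (R\<^sup>2)) / (z - \<sigma>)\<^sup>2 - 4 * z / (z - \<sigma>))"

lemma of_real_square_plus_one_nonzero: "complex_of_real ((R\<^sup>2 + 1)\<^sup>2) \<noteq> 0"
  by (metis of_real_eq_0_iff power_eq_0_iff add_nonneg_eq_0_iff zero_le_power2 zero_le_one zero_neq_one)

lemma corner_kernel_bound: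
  assumes R: "0 < R" and A: "cmod (z\<^sup>2 - of_real (R\<^sup>2)) \<le> A" and D: "0 < D" "D \<le> cmod (z - \<sigma>)" and M: "cmod z \<le> M"
  shows "cmod (corner_kernel R \<sigma> z) \<le> A / R ^ 4 * (A / D\<^sup>2 + 4 * M / D)"
proof -
  have A0: "0 \<le> A" using A norm_ge_zero order_trans by blast
  have M0: "0 \<le> M" using M norm_ge_zero order_trans by blast
  have "R ^ 4 \<le> (R\<^sup>2 + 1)\<^sup>2"
  proof -
    have "(R\<^sup>2)\<^sup>2 \<le> (R\<^sup>2 + 1)\<^sup>2" by (rule power_mono) auto
    then show ?thesis by (simp flip: power_mult)
  qed
  then have 1: "cmod ((z\<^sup>2 - of_real (R\<^sup>2)) / of_real ((R\<^sup>2 + 1)\<^sup>2)) \<le> A / R ^ 4"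
    unfolding norm_divide norm_of_real using A A0 R by (intro frac_le) auto
  have h1: "cmod ((z\<^sup>2 - of_real (R\<^sup>2)) / (z - \<sigma>)\<^sup>2) \<le> A / D\<^sup>2"
    unfolding norm_divide norm_power using A A0 D by (intro frac_le power_mono) auto
  have h2: "cmod (4 * z / (z - \<sigma>)) \<le> 4 * M / D"
    unfolding norm_divide norm_mult using M M0 D by (intro frac_le mult_mono) auto
  have 2: "cmod ((z\<^sup>2 - of_real (R\<^sup>2)) / (z - \<sigma>)\<^sup>2 - 4 * z / (z - \<sigma>)) \<le> A / D\<^sup>2 + 4 * M / D"
    by (rule order_trans[OF norm_triangle_ineq4 add_mono[OF h1 h2]])
  show ?thesis
    unfolding corner_kernel_def norm_mult
    using 1 2 A0 R by (intro mult_mono) auto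
qed

text \<open>On a vertical side \<open>z\<^sup>2 - R\<^sup>2\<close> has the factor \<open>y\<close>.
  This linear zero at the corner later pays for the singularity of
  \<open>ln (R / y)\<close>.\<close>

lemma corner_kernel_side:
  assumes R: "2 \<le> R" and \<sigma>: "Re \<sigma> = 0" and x: "\<bar>x\<bar> = R" and y: "0 \<le> y" "y \<le> R"
  shows "cmod (corner_kernel R \<sigma> (Complex x y)) \<le> 33 * y / R ^ 3"
proof -
  let ?z = "Complex x y"
  have x2: "x\<^sup>2 = R\<^sup>2" using x by (metis power2_abs)
  have "?z\<^sup>2 - of_real (R\<^sup>2) = of_real y * Complex (- y) (2 * x)"
    using x2 by (simp add: complex_eq_iff power2_eq_square)
  then have "cmod (?z\<^sup>2 - of_real (R\<^sup>2)) = y * cmod (Complex (- y) (2 * x))"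
    using y by (simp add: norm_mult)
  also have "\<dots> \<le> y * (3 * R)"
    using y x cmod_le[of "Complex (- y) (2 * x)"] by (intro mult_left_mono) (auto simp: abs_mult)
  finally have A: "cmod (?z\<^sup>2 - of_real (R\<^sup>2)) \<le> 3 * R * y" by (simp add: mult_ac)
  have D: "R \<le> cmod (?z - \<sigma>)" using abs_Re_le_cmod[of "?z - \<sigma>"] \<sigma> x by simp
  have M: "cmod ?z \<le> 2 * R" using cmod_le[of ?z] x y by simp
  have "cmod (corner_kernel R \<sigma> ?z) \<le> 3 * R * y / R ^ 4 * (3 * R * y / R\<^sup>2 + 4 * (2 * R) / R)"
    using R by (intro corner_kernel_bound A D M) auto
  also have "\<dots> \<le> 3 * R * y / R ^ 4 * 11"
  proof (rule mult_left_mono)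
    have "3 * R * y / R\<^sup>2 \<le> 3 * R * R / R\<^sup>2" using R y by (intro divide_right_mono mult_left_mono) auto
    also have "\<dots> = 3" using R by (simp add: power2_eq_square)
    finally show "3 * R * y / R\<^sup>2 + 4 * (2 * R) / R \<le> 11" using R by simp
  qed (use R y in auto)
  also have "\<dots> = 33 * y / R ^ 3" using R by (simp add: power_eq_if)
  finally show ?thesis .
qed

lemma corner_kernel_top:
  assumes R: "2 \<le> R" and \<sigma>: "\<bar>Im \<sigma>\<bar> = 1" and x: "\<bar>x\<bar> \<le> R"
  shows "cmod (corner_kernel R \<sigma> (Complex x R)) \<le> 84 / R\<^sup>2"
proof -
  let ?z = "Complex x R"
  have M: "cmod ?z \<le> 2 * R" using cmod_le[of ?z] x R by simp
  have "?z\<^sup>2 - of_real (R\<^sup>2) = Complex (x\<^sup>2 - 2 * R\<^sup>2) (2 * x * R)"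
    by (simp add: complex_eq_iff power2_eq_square)
  then have "(cmod (?z\<^sup>2 - of_real (R\<^sup>2)))\<^sup>2 = (x\<^sup>2 - 2 * R\<^sup>2)\<^sup>2 + (2 * x * R)\<^sup>2"
    by (simp add: cmod_power2)
  also have "\<dots> = x ^ 4 + 4 * R ^ 4" by (simp add: power2_eq_square power_eq_if algebra_simps)
  also have "\<dots> \<le> R ^ 4 + 4 * R ^ 4"
  proof -
    have "\<bar>x\<bar> ^ 4 \<le> R ^ 4" using x by (intro power_mono) auto
    then show ?thesis by (simp add: power_even_abs)
  qed
  also have "\<dots> \<le> (3 * R\<^sup>2)\<^sup>2" using R by (simp add: power_mult_distrib flip: power_mult)
  finally have A: "cmod (?z\<^sup>2 - of_real (R\<^sup>2)) \<le> 3 * R\<^sup>2"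
    by (rule power2_le_imp_le) simp
  have D: "R / 2 \<le> cmod (?z - \<sigma>)" using abs_Im_le_cmod[of "?z - \<sigma>"] \<sigma> R by simp
  have "cmod (corner_kernel R \<sigma> ?z) \<le> 3 * R\<^sup>2 / R ^ 4 * (3 * R\<^sup>2 / (R / 2)\<^sup>2 + 4 * (2 * R) / (R / 2))"
    using R by (intro corner_kernel_bound A D M) auto
  also have "\<dots> = 84 / R\<^sup>2" using R by (simp add: power2_eq_square power_eq_if)
  finally show ?thesis .
qed

lemma corner_kernel_bottom:
  assumes R: "2 \<le> R" and \<sigma>: "\<bar>Im \<sigma>\<bar> = 1" and x: "\<bar>x\<bar> \<le> R"
  shows "cmod (corner_kernel R \<sigma> (of_real x)) \<le> 3"
proof -
  have x2: "x\<^sup>2 \<le> R\<^sup>2" using x R by (intro power2_le_iff_abs_le[THEN iffD2]) auto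
  have "cmod ((of_real x)\<^sup>2 - of_real (R\<^sup>2)) = \<bar>x\<^sup>2 - R\<^sup>2\<bar>"
    by (metis norm_of_real of_real_diff of_real_power)
  also have "\<dots> \<le> R\<^sup>2" using x2 by (simp add: abs_if)
  finally have A: "cmod ((of_real x)\<^sup>2 - of_real (R\<^sup>2)) \<le> R\<^sup>2" .
  have D: "1 \<le> cmod (of_real x - \<sigma>)" using abs_Im_le_cmod[of "of_real x - \<sigma>"] \<sigma> by simp
  have M: "cmod (of_real x) \<le> R" using x by simp
  have "cmod (corner_kernel R \<sigma> (of_real x)) \<le> R\<^sup>2 / R ^ 4 * (R\<^sup>2 / 1\<^sup>2 + 4 * R / 1)"
    using R by (intro corner_kernel_bound A D M) auto
  also have "\<dots> = 1 + 4 / R" using R by (simp add: power2_eq_square power_eq_if field_simps)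
  also have "\<dots> \<le> 3" using R by (simp add: pos_divide_le_eq)
  finally show ?thesis .
qed

lemma corner_kernel_integral_0:
  assumes R: "0 < R" and \<sigma>: "Im \<sigma> \<noteq> 0"
  shows "((\<lambda>x. corner_kernel R \<sigma> (of_real x)) has_integral 0) {- R..R}"
proof -
  define K where "K z = - ((z\<^sup>2 - of_real (R\<^sup>2))\<^sup>2 / (of_real ((R\<^sup>2 + 1)\<^sup>2) * (z - \<sigma>)))" for z
  note c0 = of_real_square_plus_one_nonzero[of R]
  have ne: "of_real x - \<sigma> \<noteq> 0" for x using \<sigma> by (auto simp: complex_eq_iff)
  have "((\<lambda>x. corner_kernel R \<sigma> (of_real x)) has_integral K (of_real R) - K (of_real (- R))) {- R..R}"
  proof (rule fundamental_theorem_of_calculus)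
    fix x assume "x \<in> {- R..R}"
    define c where "c = complex_of_real ((R\<^sup>2 + 1)\<^sup>2)"
    define q where "q = complex_of_real (R\<^sup>2)"
    define z where "z = complex_of_real x"
    have zs: "z - \<sigma> \<noteq> 0" "c \<noteq> 0" using ne c0 by (auto simp: z_def c_def)
    have "((\<lambda>z. - ((z\<^sup>2 - q)\<^sup>2 / (c * (z - \<sigma>)))) has_field_derivative
       - ((2 * (z\<^sup>2 - q) * (2 * z) * (c * (z - \<sigma>)) - (z\<^sup>2 - q)\<^sup>2 * c) / (c * (z - \<sigma>))\<^sup>2)) (at z)"
      using zs by (auto intro!: derivative_eq_intros simp: power2_eq_square)
    also have "- ((2 * (z\<^sup>2 - q) * (2 * z) * (c * (z - \<sigma>)) - (z\<^sup>2 - q)\<^sup>2 * c) / (c * (z - \<sigma>))\<^sup>2)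
       = (z\<^sup>2 - q) / c * ((z\<^sup>2 - q) / (z - \<sigma>)\<^sup>2 - 4 * z / (z - \<sigma>))"
      using zs by (simp add: divide_simps) (simp add: algebra_simps power2_eq_square)
    finally have "(K has_field_derivative corner_kernel R \<sigma> z) (at z)"
      unfolding K_def corner_kernel_def q_def c_def .
    then show "((\<lambda>x. K (of_real x)) has_vector_derivative corner_kernel R \<sigma> (of_real x)) (at x within {- R..R})"
      unfolding z_def by (rule has_vector_derivative_real_field)
  qed (use R in simp)
  moreover have "K (of_real R) = 0" "K (of_real (- R)) = 0" by (simp_all add: K_def)
  ultimately show ?thesis by simp
qed

lemma corner_kernel_cnj: "corner_kernel R (cnj \<sigma>) (of_real x) = cnj (corner_kernel R \<sigma> (of_real x))"
  by (simp add: corner_kernel_def)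

lemma continuous_on_corner_kernel:
  assumes "\<sigma> \<notin> S"
  shows "continuous_on S (corner_kernel R \<sigma>)"
proof -
  have "z - \<sigma> \<noteq> 0" if "z \<in> S" for z using assms that by auto
  moreover note of_real_square_plus_one_nonzero[of R]
  ultimately show ?thesis
    unfolding corner_kernel_def by (intro continuous_intros) auto
qed

text \<open>On the vertical sides \<open>y * ln (R / y) \<le> R\<close> removes the singularity of
  the bound at the corner. The integrand is then of order \<open>C * (2 + ln R) / R\<^sup>2\<close>
  on three sides of total length \<open>4 * R\<close>.\<close>

lemma corner_kernel_sides_integral:
  assumes R: "2 \<le> R" and C: "0 \<le> C" and \<sigma>: "Re \<sigma> = 0" "\<bar>Im \<sigma>\<bar> = 1"
    and cont: "continuous_on (cbox (Complex (- R) 0) (Complex R R)) P"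
    and bd: "\<And>s y. \<bar>s\<bar> \<le> R \<Longrightarrow> 0 < y \<Longrightarrow> y \<le> R \<Longrightarrow> cmod (P (Complex s y)) \<le> C * (1 + ln R + ln (R / y))"
  shows "cmod (contour_integral (rectpath (Complex (- R) 0) (Complex R R)) (\<lambda>z. P z * corner_kernel R \<sigma> z)
     - integral {- R..R} (\<lambda>x. P (of_real x) * corner_kernel R \<sigma> (of_real x))) \<le> 234 * C * (2 + ln R) / R"
proof -
  let ?a = "Complex (- R) 0" and ?b = "Complex R R"
  let ?f = "\<lambda>z. P z * corner_kernel R \<sigma> z"
  have lnR: "0 \<le> ln R" using R by simp
  have \<sigma>n: "\<sigma> \<notin> cbox ?a ?b - box ?a ?b"
    using \<sigma> R by (auto simp: in_cbox_complex_iff in_box_complex_iff)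
  have cf: "continuous_on (cbox ?a ?b - box ?a ?b) ?f"
    by (intro continuous_on_mult continuous_on_subset[OF cont] continuous_on_corner_kernel \<sigma>n) auto
  have side: "cmod (?f (Complex x y)) \<le> 33 * C * (2 + ln R) / R\<^sup>2" if x: "\<bar>x\<bar> = R" and y: "0 \<le> y" "y \<le> R" for x y
  proof (cases "y = 0")
    case True
    then have "corner_kernel R \<sigma> (Complex x y) = 0"
      using corner_kernel_side[OF R \<sigma>(1) x, of 0] R by simp
    then show ?thesis using C R lnR by simp
  next
    case False
    then have y0: "0 < y" using y by simp
    have "cmod (?f (Complex x y)) \<le> C * (1 + ln R + ln (R / y)) * (33 * y / R ^ 3)"
      unfolding norm_mult using bd[of x y] corner_kernel_side[OF R \<sigma>(1) x y] x y y0
      by (intro mult_mono) (auto intro: order_trans[OF norm_ge_zero])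
    also have "\<dots> = 33 * C / R ^ 3 * (y * (1 + ln R) + y * ln (R / y))" by (simp add: algebra_simps)
    also have "\<dots> \<le> 33 * C / R ^ 3 * (R * (1 + ln R) + R)"
    proof (intro mult_left_mono add_mono)
      show "y * (1 + ln R) \<le> R * (1 + ln R)" using y lnR by (intro mult_right_mono) auto
      have "ln (R / y) \<le> R / y"
        using ln_le_minus_one[of "R / y"] y0 R by simp
      then have "y * ln (R / y) \<le> y * (R / y)" using y0 by (intro mult_left_mono) auto
      then show "y * ln (R / y) \<le> R" using y0 by simp
    qed (use C R in auto)
    also have "\<dots> = 33 * C * (2 + ln R) / R\<^sup>2"
      using R by (simp add: power_eq_if field_simps)
    finally show ?thesis .
  qed
  have top: "cmod (?f (Complex x R)) \<le> 84 * C * (2 + ln R) / R\<^sup>2" if x: "\<bar>x\<bar> \<le> R" for x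
  proof -
    have "cmod (?f (Complex x R)) \<le> C * (1 + ln R + ln (R / R)) * (84 / R\<^sup>2)"
      unfolding norm_mult using bd[of x R] corner_kernel_top[OF R \<sigma>(2) x] x R
      by (intro mult_mono) (auto intro: order_trans[OF norm_ge_zero])
    also have "\<dots> \<le> C * (2 + ln R) * (84 / R\<^sup>2)"
      using R C lnR by (intro mult_right_mono mult_left_mono) auto
    finally show ?thesis by (simp add: mult_ac)
  qed
  have nn: "0 \<le> C * (2 + ln R)" using C lnR by simp
  have I: "?f contour_integrable_on linepath u v" if "closed_segment u v \<subseteq> cbox ?a ?b - box ?a ?b" for u v
    by (rule contour_integrable_continuous_linepath[OF continuous_on_subset[OF cf that]])
  have s1: "closed_segment (Complex R 0) ?b = {z. Re z = R \<and> Im z \<in> {0..R}}"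
    using R by (auto simp: closed_segment_same_Re closed_segment_eq_real_ivl)
  have s2: "closed_segment ?b (Complex (- R) R) = {z. Im z = R \<and> Re z \<in> {- R..R}}"
    using R by (auto simp: closed_segment_same_Im closed_segment_eq_real_ivl)
  have s3: "closed_segment (Complex (- R) R) ?a = {z. Re z = - R \<and> Im z \<in> {0..R}}"
    using R by (auto simp: closed_segment_same_Re closed_segment_eq_real_ivl)
  have 1: "cmod (contour_integral (linepath (Complex R 0) ?b) ?f) \<le> 33 * C * (2 + ln R) / R\<^sup>2 * cmod (?b - Complex R 0)"
  proof (rule contour_integral_bound_linepath[OF I])
    show "closed_segment (Complex R 0) ?b \<subseteq> cbox ?a ?b - box ?a ?b"
      unfolding s1 using R by (auto simp: in_cbox_complex_iff in_box_complex_iff)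
    fix z assume "z \<in> closed_segment (Complex R 0) ?b"
    then have "z = Complex R (Im z)" "0 \<le> Im z" "Im z \<le> R" unfolding s1 by (auto simp: complex_eq_iff)
    then show "cmod (?f z) \<le> 33 * C * (2 + ln R) / R\<^sup>2" using side[of R "Im z"] R by simp
  qed (use nn in \<open>simp add: mult.assoc\<close>)
  have 2: "cmod (contour_integral (linepath ?b (Complex (- R) R)) ?f) \<le> 84 * C * (2 + ln R) / R\<^sup>2 * cmod (Complex (- R) R - ?b)"
  proof (rule contour_integral_bound_linepath[OF I])
    show "closed_segment ?b (Complex (- R) R) \<subseteq> cbox ?a ?b - box ?a ?b"
      unfolding s2 using R by (auto simp: in_cbox_complex_iff in_box_complex_iff)
    fix z assume "z \<in> closed_segment ?b (Complex (- R) R)"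
    then have "z = Complex (Re z) R" "\<bar>Re z\<bar> \<le> R" unfolding s2 by (auto simp: complex_eq_iff)
    then show "cmod (?f z) \<le> 84 * C * (2 + ln R) / R\<^sup>2" using top[of "Re z"] by simp
  qed (use nn in \<open>simp add: mult.assoc\<close>)
  have 3: "cmod (contour_integral (linepath (Complex (- R) R) ?a) ?f) \<le> 33 * C * (2 + ln R) / R\<^sup>2 * cmod (?a - Complex (- R) R)"
  proof (rule contour_integral_bound_linepath[OF I])
    show "closed_segment (Complex (- R) R) ?a \<subseteq> cbox ?a ?b - box ?a ?b"
      unfolding s3 using R by (auto simp: in_cbox_complex_iff in_box_complex_iff)
    fix z assume "z \<in> closed_segment (Complex (- R) R) ?a"
    then have "z = Complex (- R) (Im z)" "0 \<le> Im z" "Im z \<le> R" unfolding s3 by (auto simp: complex_eq_iff)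
    then show "cmod (?f z) \<le> 33 * C * (2 + ln R) / R\<^sup>2" using side[of "- R" "Im z"] R by simp
  qed (use nn in \<open>simp add: mult.assoc\<close>)
  have len: "cmod (?b - Complex R 0) = R" "cmod (Complex (- R) R - ?b) = 2 * R" "cmod (?a - Complex (- R) R) = R"
    using R by (simp_all add: cmod_def real_sqrt_mult)
  have bot: "contour_integral (linepath ?a (Complex R 0)) ?f = integral {- R..R} (\<lambda>x. ?f (of_real x))"
    using R by (subst contour_integral_linepath_Reals_eq) (auto simp: complex_is_Real_iff)
  have split: "contour_integral (rectpath ?a ?b) ?f = contour_integral (linepath ?a (Complex R 0)) ?f
     + contour_integral (linepath (Complex R 0) ?b) ?f + contour_integral (linepath ?b (Complex (- R) R)) ?f
     + contour_integral (linepath (Complex (- R) R) ?a) ?f"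
    using contour_integral_rectpath_split[of ?a ?b ?f] cf R by simp
  define T where "T = C * (2 + ln R) / R"
  define I1 where "I1 = contour_integral (linepath (Complex R 0) ?b) ?f"
  define I2 where "I2 = contour_integral (linepath ?b (Complex (- R) R)) ?f"
  define I3 where "I3 = contour_integral (linepath (Complex (- R) R) ?a) ?f"
  have "cmod I1 \<le> 33 * T" using 1 R unfolding I1_def len T_def by (simp add: power2_eq_square mult_ac)
  moreover have "cmod I2 \<le> 168 * T" using 2 R unfolding I2_def len T_def by (simp add: power2_eq_square mult_ac)
  moreover have "cmod I3 \<le> 33 * T" using 3 R unfolding I3_def len T_def by (simp add: power2_eq_square mult_ac)
  moreover have "cmod (I1 + I2 + I3) \<le> cmod I1 + cmod I2 + cmod I3"
    using norm_triangle_ineq[of "I1 + I2" I3] norm_triangle_ineq[of I1 I2] by linarith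
  \<comment> \<open>\<open>234 = 33 + 2 * 84 + 33\<close>, where the top side has length
    \<open>2 * R\<close>.\<close>
  ultimately have "cmod (I1 + I2 + I3) \<le> 234 * T" by linarith
  moreover have "contour_integral (rectpath ?a ?b) ?f - integral {- R..R} (\<lambda>x. ?f (of_real x)) = I1 + I2 + I3"
    unfolding split bot I1_def I2_def I3_def by simp
  ultimately show ?thesis by (simp add: T_def mult.assoc)
qed

text \<open>Subtracting the conjugate of Cauchy's theorem for the kernel with pole at \<open>- \<i>\<close> from Cauchy's formula
  for the kernel with pole at \<open>\<i>\<close> leaves only the imaginary part of \<open>P\<close> on the real axis. The
  logarithmic growth allowed near the corners is absorbed by the zeros of the kernel there.\<close>

lemma deriv_bound_from_boundary_imaginary_part:
  assumes R: "2 \<le> R" and C: "0 \<le> C" and \<kappa>: "0 \<le> \<kappa>"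
    and cont: "continuous_on (cbox (Complex (- R) 0) (Complex R R)) P"
    and hol: "P holomorphic_on box (Complex (- R) 0) (Complex R R)" and Pi: "P \<i> = 0"
    and bd: "\<And>s y. \<bar>s\<bar> \<le> R \<Longrightarrow> 0 < y \<Longrightarrow> y \<le> R \<Longrightarrow> cmod (P (Complex s y)) \<le> C * (1 + ln R + ln (R / y))"
    and near: "\<And>s. \<bar>s\<bar> \<le> R \<Longrightarrow> \<bar>Im (P (of_real s)) - A\<bar> \<le> \<kappa>"
  shows "cmod (deriv P \<i>) \<le> 2 * R * \<kappa> + 78 * C * (2 + ln R) / R"
proof -
  let ?a = "Complex (- R) 0" and ?b = "Complex R R"
  let ?k = "\<lambda>\<sigma> z. corner_kernel R \<sigma> z"
  define S where "S = 234 * C * (2 + ln R) / R"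
  have ibox: "\<i> \<in> box ?a ?b" using R by (simp add: in_box_complex_iff)
  note c0 = of_real_square_plus_one_nonzero[of R]
  \<comment> \<open>The numerator of the kernel over the double pole. The denominator
    \<open>(R\<^sup>2 + 1)\<^sup>2\<close> normalises \<open>N \<i> = 1\<close>, and together with
    \<open>P \<i> = 0\<close> this makes the derivative of \<open>P * N\<close> at
    \<open>\<i>\<close> that of \<open>P\<close>.\<close>
  define N where "N z = ((z\<^sup>2 - of_real (R\<^sup>2))\<^sup>2 - 4 * z * (z\<^sup>2 - of_real (R\<^sup>2)) * (z - \<i>)) / of_real ((R\<^sup>2 + 1)\<^sup>2)" for z
  have Nk: "?k \<i> z = N z / (z - \<i>)\<^sup>2" if "z \<noteq> \<i>" for z
  proof -
    have "z - \<i> \<noteq> 0" using that by simp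
    then show ?thesis unfolding corner_kernel_def N_def
      using c0 by (simp add: divide_simps del: of_real_power of_real_add) (simp add: algebra_simps power2_eq_square)
  qed
  have Ni: "N \<i> = 1"
  proof -
    have "(\<i>\<^sup>2 - complex_of_real (R\<^sup>2))\<^sup>2 = complex_of_real ((R\<^sup>2 + 1)\<^sup>2)"
      by (simp add: power2_eq_square algebra_simps)
    then show ?thesis using c0 by (simp add: N_def)
  qed
  have Nh: "N holomorphic_on UNIV" unfolding N_def by (intro holomorphic_intros) (use c0 in simp)
  have pim: "path_image (rectpath ?a ?b) = cbox ?a ?b - box ?a ?b"
    using R by (intro path_image_rectpath_cbox_minus_box) auto
  have dPN: "deriv (\<lambda>z. P z * N z) \<i> = deriv P \<i>"
  proof (rule DERIV_imp_deriv)
    have "(P has_field_derivative deriv P \<i>) (at \<i>)" using holomorphic_derivI[OF hol open_box ibox] .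
    moreover have "(N has_field_derivative deriv N \<i>) (at \<i>)" using holomorphic_derivI[OF Nh] by simp
    ultimately have "((\<lambda>z. P z * N z) has_field_derivative (deriv P \<i> * N \<i> + deriv N \<i> * P \<i>)) (at \<i>)"
      by (rule DERIV_mult)
    then show "((\<lambda>z. P z * N z) has_field_derivative deriv P \<i>) (at \<i>)" by (simp add: Ni Pi)
  qed
  have "((\<lambda>z. P z * N z / (z - \<i>)\<^sup>2) has_contour_integral 2 * of_real pi * \<i> * deriv (\<lambda>z. P z * N z) \<i>) (rectpath ?a ?b)"
  proof (rule rectpath_double_pole[OF _ _ ibox])
    show "continuous_on (cbox ?a ?b) (\<lambda>z. P z * N z)"
      by (intro continuous_on_mult cont continuous_on_subset[OF holomorphic_on_imp_continuous_on[OF Nh]]) simp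
    show "(\<lambda>z. P z * N z) holomorphic_on box ?a ?b"
      by (intro holomorphic_on_mult hol holomorphic_on_subset[OF Nh]) simp
  qed (simp add: Pi)
  then have "((\<lambda>z. P z * ?k \<i> z) has_contour_integral 2 * of_real pi * \<i> * deriv P \<i>) (rectpath ?a ?b)"
    unfolding dPN
  proof (rule has_contour_integral_eq)
    fix z assume "z \<in> path_image (rectpath ?a ?b)"
    then have "z \<noteq> \<i>" using ibox by (auto simp only: pim)
    then show "P z * N z / (z - \<i>)\<^sup>2 = P z * ?k \<i> z" by (simp add: Nk)
  qed
  then have I1: "contour_integral (rectpath ?a ?b) (\<lambda>z. P z * ?k \<i> z) = 2 * of_real pi * \<i> * deriv P \<i>"
    by (rule contour_integral_unique)
  have mi: "- \<i> \<notin> cbox ?a ?b" by (simp add: in_cbox_complex_iff)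
  have kh: "?k (- \<i>) holomorphic_on - {- \<i>}"
    unfolding corner_kernel_def by (intro holomorphic_intros) (use c0 in \<open>auto simp: eq_neg_iff_add_eq_0\<close>)
  have "((\<lambda>z. P z * ?k (- \<i>) z) has_contour_integral 0) (rectpath ?a ?b)"
  proof (rule Cauchy_theorem_convex[OF _ convex_box(1) finite.emptyI])
    show "continuous_on (cbox ?a ?b) (\<lambda>z. P z * ?k (- \<i>) z)"
      by (intro continuous_on_mult cont continuous_on_corner_kernel mi)
    have "(\<lambda>z. P z * ?k (- \<i>) z) holomorphic_on box ?a ?b"
      by (intro holomorphic_on_mult hol holomorphic_on_subset[OF kh]) (use mi box_subset_cbox in blast)
    then show "(\<lambda>z. P z * ?k (- \<i>) z) field_differentiable at x" if "x \<in> interior (cbox ?a ?b) - {}" for x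
      using that holomorphic_on_open[OF open_box] by (auto simp: interior_cbox field_differentiable_def)
  qed (auto simp: pim)
  then have I2: "contour_integral (rectpath ?a ?b) (\<lambda>z. P z * ?k (- \<i>) z) = 0"
    by (rule contour_integral_unique)
  define X where "X = integral {- R..R} (\<lambda>x. P (of_real x) * ?k \<i> (of_real x))"
  define Y where "Y = integral {- R..R} (\<lambda>x. P (of_real x) * ?k (- \<i>) (of_real x))"
  have XS: "cmod (2 * of_real pi * \<i> * deriv P \<i> - X) \<le> S"
    using corner_kernel_sides_integral[OF R C _ _ cont bd, of \<i>] unfolding I1 X_def S_def by simp
  have YS: "cmod Y \<le> S"
    using corner_kernel_sides_integral[OF R C _ _ cont bd, of "- \<i>"] unfolding I2 Y_def S_def by simp
  have cP: "continuous_on {- R..R} (\<lambda>x. P (of_real x))"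
    by (rule continuous_on_compose2[OF cont]) (use R in \<open>auto intro!: continuous_intros simp: in_cbox_complex_iff\<close>)
  have ck: "continuous_on {- R..R} (\<lambda>x. ?k \<sigma> (of_real x))" if "Im \<sigma> \<noteq> 0" for \<sigma>
    by (rule continuous_on_compose2[OF continuous_on_corner_kernel[of \<sigma> "\<real>"]])
      (use that in \<open>auto intro!: continuous_intros simp: complex_is_Real_iff\<close>)
  \<comment> \<open>On the real line the kernels with poles \<open>\<i>\<close> and
    \<open>- \<i>\<close> are conjugate, so the difference involves \<open>P\<close> minus its
    conjugate. The constant \<open>A\<close> may be subtracted because the kernel has integral
    \<open>0\<close>.\<close>
  define h where "h x = P (of_real x) * ?k \<i> (of_real x) - cnj (P (of_real x)) * ?k \<i> (of_real x) - 2 * \<i> * of_real A * ?k \<i> (of_real x)" for x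
  have hX: "((\<lambda>x. P (of_real x) * ?k \<i> (of_real x)) has_integral X) {- R..R}"
    unfolding X_def by (intro integrable_integral integrable_continuous_interval continuous_on_mult cP ck) simp
  have hY: "((\<lambda>x. P (of_real x) * ?k (- \<i>) (of_real x)) has_integral Y) {- R..R}"
    unfolding Y_def by (intro integrable_integral integrable_continuous_interval continuous_on_mult cP ck) simp
  have "((cnj \<circ> (\<lambda>x. P (of_real x) * ?k (- \<i>) (of_real x))) has_integral cnj Y) {- R..R}"
    using hY by (simp only: has_integral_cnj)
  moreover have "cnj \<circ> (\<lambda>x. P (of_real x) * ?k (- \<i>) (of_real x)) = (\<lambda>x. cnj (P (of_real x)) * ?k \<i> (of_real x))"
    using corner_kernel_cnj[of R "- \<i>"] by (auto simp: o_def)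
  ultimately have hY': "((\<lambda>x. cnj (P (of_real x)) * ?k \<i> (of_real x)) has_integral cnj Y) {- R..R}" by simp
  have hK: "((\<lambda>x. 2 * \<i> * of_real A * ?k \<i> (of_real x)) has_integral 2 * \<i> * of_real A * 0) {- R..R}"
    by (intro has_integral_mult_right corner_kernel_integral_0) (use R in auto)
  have hh: "(h has_integral X - cnj Y - 2 * \<i> * of_real A * 0) {- R..R}"
    unfolding h_def by (intro has_integral_diff hX hY' hK)
  have hb: "cmod (h x) \<le> 6 * \<kappa>" if x: "x \<in> {- R..R}" for x
  proof -
    have "h x = 2 * \<i> * of_real (Im (P (of_real x)) - A) * ?k \<i> (of_real x)"
      unfolding h_def by (simp add: complex_eq_iff algebra_simps)
    then have "cmod (h x) = 2 * \<bar>Im (P (of_real x)) - A\<bar> * cmod (?k \<i> (of_real x))"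
      by (simp add: norm_mult del: of_real_diff)
    also have "\<dots> \<le> 2 * \<kappa> * 3"
      using near[of x] x \<kappa> corner_kernel_bottom[OF R, of \<i> x] by (intro mult_mono) auto
    finally show ?thesis by simp
  qed
  have "cmod (X - cnj Y) \<le> 6 * \<kappa> * (R - (- R))"
  proof -
    have "cmod (X - cnj Y - 2 * \<i> * of_real A * 0) \<le> 6 * \<kappa> * measure lborel (cbox (- R) R)"
      by (rule has_integral_bound[OF _ _ hb]) (use hh \<kappa> in \<open>auto simp: cbox_interval\<close>)
    then show ?thesis using R by simp
  qed
  then have "cmod (X - cnj Y) \<le> 12 * R * \<kappa>" by (simp add: algebra_simps)
  moreover have "cmod X \<le> cmod (X - cnj Y) + cmod Y"
    using norm_triangle_ineq[of "X - cnj Y" "cnj Y"] by simp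
  moreover have "cmod (2 * of_real pi * \<i> * deriv P \<i>) \<le> cmod X + S"
    using XS norm_triangle_sub[of "2 * of_real pi * \<i> * deriv P \<i>" X] by linarith
  ultimately have "2 * pi * cmod (deriv P \<i>) \<le> 12 * R * \<kappa> + 2 * S"
    using YS by (simp add: norm_mult)
  moreover have "2 * 3 * cmod (deriv P \<i>) \<le> 2 * pi * cmod (deriv P \<i>)"
    using pi_gt3 by (intro mult_right_mono) auto
  ultimately have "6 * cmod (deriv P \<i>) \<le> 12 * R * \<kappa> + 2 * S" by simp
  then show ?thesis by (simp add: S_def)
qed

section \<open>Nearly constant chord directions\<close>

text \<open>Near \<open>z\<close> the function \<open>q\<close> agrees with
  \<open>q z + Ln (D w / D z)\<close>: by continuity its imaginary part moves by less than
  \<open>1\<close>, hence by less than \<open>pi\<close>, which excludes every other branch.\<close>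

lemma holomorphic_continuous_log:
  assumes S: "open S" and q: "continuous_on S q" and D: "D holomorphic_on S" and e: "\<And>z. z \<in> S \<Longrightarrow> exp (q z) = D z"
  shows "q holomorphic_on S" and "\<And>z. z \<in> S \<Longrightarrow> deriv q z = deriv D z / D z"
proof -
  have d: "(q has_field_derivative deriv D z / D z) (at z)" if z: "z \<in> S" for z
  proof -
    have "isCont q z" using q S z by (simp add: continuous_on_eq_continuous_at)
    then obtain r where r: "r > 0" "\<And>w. dist w z < r \<Longrightarrow> dist (q w) (q z) < 1"
      unfolding continuous_at_eps_delta by (metis zero_less_one)
    obtain r' where r': "r' > 0" "ball z r' \<subseteq> S" using S z open_contains_ball by blast
    have D0: "D z \<noteq> 0" using e[OF z] by (metis exp_not_eq_zero)
    have dD: "(D has_field_derivative deriv D z) (at z)" using holomorphic_derivI[OF D S z] .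
    have "((\<lambda>w. q z + Ln (D w / D z)) has_field_derivative deriv D z / D z) (at z)"
      using D0 by (auto intro!: derivative_eq_intros dD)
    moreover have "q z + Ln (D w / D z) = q w" if w: "w \<in> ball z (min r r')" for w
    proof -
      have "w \<in> S" using w r' by auto
      then have "D w / D z = exp (q w - q z)" using e z by (simp add: exp_diff)
      moreover have "\<bar>Im (q w - q z)\<bar> < 1"
        using r(2)[of w] w abs_Im_le_cmod[of "q w - q z"] by (simp add: dist_norm norm_minus_commute)
      then have "Ln (exp (q w - q z)) = q w - q z"
        using pi_gt3 by (intro Ln_exp) linarith+
      ultimately show ?thesis by simp
    qed
    ultimately show ?thesis
      using r r' by (elim has_field_derivative_transform_within_open[of _ _ _ "ball z (min r r')"]) auto
  qed
  show "q holomorphic_on S" using d S by (auto simp: holomorphic_on_open)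
  show "\<And>z. z \<in> S \<Longrightarrow> deriv q z = deriv D z / D z" using d by (simp add: DERIV_imp_deriv)
qed

text \<open>The law of cosines gives \<open>p * q * (cmod (sgn u - sgn v))\<^sup>2 = (p + q)\<^sup>2
  - c\<^sup>2\<close>, so the angle is controlled by the defect in the triangle inequality. The
  constant \<open>B\<close> enters when \<open>p\<^sup>2 + q\<^sup>2\<close> is compared with
  \<open>p * q\<close>.\<close>

lemma sgn_diff_bound:
  fixes u v :: complex
  assumes uv: "u \<noteq> 0" "v \<noteq> 0" and \<epsilon>: "0 \<le> \<epsilon>" and sum: "cmod u + cmod v \<le> (1 + \<epsilon>) * cmod (u + v)"
    and B: "cmod u \<le> B * cmod v" "cmod v \<le> B * cmod u"
  shows "cmod (sgn u - sgn v) \<le> sqrt (2 * \<epsilon> * (2 * B + 2))"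
proof -
  define p where "p = cmod u"
  define q where "q = cmod v"
  define c where "c = cmod (u + v)"
  have p0: "p > 0" and q0: "q > 0" using uv by (auto simp: p_def q_def)
  have "c \<le> p + q" unfolding c_def p_def q_def by (rule norm_triangle_ineq)
  have id: "p * q * (cmod (sgn u - sgn v))\<^sup>2 = (p + q)\<^sup>2 - c\<^sup>2"
  proof -
    have "(cmod (sgn u - sgn v))\<^sup>2 = 2 - 2 * ((u / p) \<bullet> (v / q))"
    proof -
      have "sgn u = u / p" "sgn v = v / q" by (simp_all add: sgn_eq p_def q_def)
      moreover have "cmod (u / p) = 1" "cmod (v / q) = 1" using uv by (simp_all add: norm_divide p_def q_def)
      ultimately show ?thesis
        using dot_norm_neg[of "u / p" "v / q"] by simp
    qed
    moreover have "(u / p) \<bullet> (v / q) = (u \<bullet> v) / (p * q)"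
      by (simp add: inner_complex_def add_divide_distrib)
    moreover have "c\<^sup>2 = p\<^sup>2 + q\<^sup>2 + 2 * (u \<bullet> v)"
      using dot_norm[of u v] by (simp add: c_def p_def q_def)
    ultimately show ?thesis using p0 q0 by (simp add: power2_eq_square field_simps)
  qed
  have "(p + q)\<^sup>2 - c\<^sup>2 = (p + q - c) * (p + q + c)" by (simp add: power2_eq_square algebra_simps)
  also have "\<dots> \<le> (\<epsilon> * c) * (2 * (p + q))"
    using sum \<open>c \<le> p + q\<close> \<epsilon> p0 q0 by (intro mult_mono) (auto simp: p_def q_def c_def algebra_simps)
  also have "\<dots> \<le> (\<epsilon> * (p + q)) * (2 * (p + q))"
    using \<open>c \<le> p + q\<close> \<epsilon> p0 q0 by (intro mult_right_mono mult_left_mono) auto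
  also have "\<dots> = 2 * \<epsilon> * (p * p + 2 * (p * q) + q * q)" by (simp add: algebra_simps)
  also have "\<dots> \<le> 2 * \<epsilon> * (B * (p * q) + 2 * (p * q) + B * (p * q))"
  proof -
    have "p * p \<le> B * q * p" "q * q \<le> B * p * q"
      using B p0 q0 by (auto simp: p_def q_def intro!: mult_right_mono)
    then show ?thesis using \<epsilon> by (intro mult_left_mono) (auto simp: mult_ac)
  qed
  also have "\<dots> = p * q * (2 * \<epsilon> * (2 * B + 2))" by (simp add: algebra_simps)
  finally have "p * q * (cmod (sgn u - sgn v))\<^sup>2 \<le> p * q * (2 * \<epsilon> * (2 * B + 2))" using id by simp
  then have "(cmod (sgn u - sgn v))\<^sup>2 \<le> 2 * \<epsilon> * (2 * B + 2)" using p0 q0 by simp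
  then show ?thesis by (rule real_le_rsqrt)
qed

text \<open>Subtracting from \<open>Im (q s)\<close> the principal argument of \<open>m s\<close>
  leaves a continuous function whose values differ by multiples of \<open>2 * pi\<close>. It is
  therefore constant, and the constant serves as \<open>A\<close>.\<close>

lemma continuous_arg_nearly_constant:
  fixes q u :: "real \<Rightarrow> complex"
  assumes q: "continuous_on {- R..R} q" and e: "\<And>s. \<bar>s\<bar> \<le> R \<Longrightarrow> exp (q s) = u s"
    and v: "cmod v = 1" and near: "\<And>s. \<bar>s\<bar> \<le> R \<Longrightarrow> cmod (sgn (u s) - v) \<le> \<kappa>" and \<kappa>: "\<kappa> < 1 / 2"
  obtains A where "\<And>s. \<bar>s\<bar> \<le> R \<Longrightarrow> \<bar>Im (q s) - A\<bar> \<le> 2 * \<kappa>"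
proof -
  define m where "m s = exp (\<i> * of_real (Im (q s))) / v" for s
  have v0: "v \<noteq> 0" using v by auto
  have sg: "sgn (u s) = exp (\<i> * of_real (Im (q s)))" if "\<bar>s\<bar> \<le> R" for s
  proof -
    have "u s = of_real (exp (Re (q s))) * exp (\<i> * of_real (Im (q s)))"
      using e[OF that] by (metis exp_eq_polar cis_conv_exp of_real_exp)
    then show ?thesis by (simp add: sgn_mult sgn_of_real sgn_eq[of "exp (\<i> * of_real (Im (q s)))"])
  qed
  have m1: "cmod (m s - 1) \<le> \<kappa>" if "\<bar>s\<bar> \<le> R" for s
  proof -
    have "m s - 1 = (sgn (u s) - v) / v" using v0 by (simp add: m_def sg[OF that] diff_divide_distrib)
    then show ?thesis using near[OF that] v by (simp add: norm_divide)
  qed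
  have mn: "m s \<notin> \<real>\<^sub>\<le>\<^sub>0" if "\<bar>s\<bar> \<le> R" for s
  proof
    assume "m s \<in> \<real>\<^sub>\<le>\<^sub>0"
    then have "Re (m s) \<le> 0" by (simp add: complex_nonpos_Reals_iff)
    then show False using m1[OF that] abs_Re_le_cmod[of "m s - 1"] \<kappa> by simp
  qed
  define f where "f s = Im (q s) - Im (Ln (m s))" for s
  have mc: "continuous_on {- R..R} m" unfolding m_def by (intro continuous_intros q) (use v0 in auto)
  have fc: "continuous_on {- R..R} f" unfolding f_def
    by (intro continuous_intros q mc) (use mn in auto)
  have ef: "exp (\<i> * of_real (f s)) = v" if "\<bar>s\<bar> \<le> R" for s
  proof -
    have m0: "m s \<noteq> 0" using v0 by (simp add: m_def)
    have "cmod (m s) = 1" using v by (simp add: m_def norm_divide)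
    then have "Re (Ln (m s)) = 0" using m0 by (simp add: Re_Ln)
    then have "Ln (m s) = \<i> * of_real (Im (Ln (m s)))" by (simp add: complex_eq_iff)
    then have "exp (\<i> * of_real (Im (Ln (m s)))) = m s" using m0 by (metis exp_Ln)
    then have "exp (\<i> * of_real (f s)) = exp (\<i> * of_real (Im (q s))) / m s"
      by (simp add: f_def right_diff_distrib exp_diff)
    then show ?thesis using v0 by (simp add: m_def)
  qed
  have "f constant_on {- R..R}"
  proof (rule continuous_discrete_range_constant[OF _ fc])
    fix s assume s: "s \<in> {- R..R}"
    show "\<exists>e>0. \<forall>y. y \<in> {- R..R} \<and> f y \<noteq> f s \<longrightarrow> e \<le> norm (f y - f s)"
    proof (intro exI[of _ "2 * pi"] conjI allI impI)
      fix y assume y: "y \<in> {- R..R} \<and> f y \<noteq> f s"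
      have "exp (\<i> * of_real (f y)) = exp (\<i> * of_real (f s))" using ef[of y] ef[of s] y s by auto
      then obtain n :: int where n: "\<i> * of_real (f y) = \<i> * of_real (f s) + of_real (real_of_int (2 * n) * pi) * \<i>"
        unfolding exp_eq by blast
      then have "f y = f s + 2 * of_int n * pi"
        by (simp add: complex_eq_iff)
      moreover from this y have "n \<noteq> 0" by auto
      then have "1 \<le> \<bar>real_of_int n\<bar>" by linarith
      ultimately show "2 * pi \<le> norm (f y - f s)" by (simp add: abs_mult)
    qed simp
  qed simp
  then obtain c where c: "\<And>s. s \<in> {- R..R} \<Longrightarrow> f s = c" by (auto simp: constant_on_def)
  show thesis
  proof (rule that[of c])
    fix s assume s: "\<bar>s\<bar> \<le> R"
    have "s \<in> {- R..R}" using s by auto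
    then have "Im (q s) - c = Im (Ln (m s))" using c[of s] by (simp add: f_def)
    then have "\<bar>Im (q s) - c\<bar> \<le> cmod (Ln (1 + (m s - 1)))" using abs_Im_le_cmod by simp
    also have "\<dots> \<le> 2 * cmod (m s - 1)" using m1[OF s] \<kappa> by (intro norm_Ln_le) simp
    finally show "\<bar>Im (q s) - c\<bar> \<le> 2 * \<kappa>" using m1[OF s] by simp
  qed
qed

context unbounded_half_plane_map
begin

text \<open>The previous estimate is applied to a logarithm of \<open>E (z + a) - E z\<close>; for small \<open>a\<close> its derivative
  is close to the derivative of \<open>W\<close>.\<close>

lemma log_deriv_bound_at_ii:
  assumes R: "2 \<le> R" and a: "0 < a" "a \<le> distortion_radius" and v: "cmod v = 1" and \<kappa>: "0 \<le> \<kappa>" "\<kappa> < 1 / 2"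
    and near: "\<And>s. \<bar>s\<bar> \<le> R \<Longrightarrow> cmod (sgn (bv (s + a) - bv s) - v) \<le> \<kappa>"
    and W: "W holomorphic_on {z. 0 < Im z}" "\<And>z. 0 < Im z \<Longrightarrow> exp (W z) = deriv E z"
  shows "cmod (deriv W \<i>) \<le> 4 * R * \<kappa> + 4992 * koebe_const * (2 + ln R) / R + 64 * koebe_const * a"
proof -
  let ?H = "{z. 0 < Im z}" and ?H' = "{z. 0 \<le> Im z}"
  define D where "D z = E (z + of_real a) - E z" for z
  have Dc: "continuous_on ?H' D"
    unfolding D_def by (intro continuous_on_diff cont continuous_on_compose2[OF cont]) (auto intro!: continuous_intros)
  have D0: "D z \<noteq> 0" if "z \<in> ?H'" for z
    using inj_onD[OF inj, of "z + of_real a" z] that a by (auto simp: D_def)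
  \<comment> \<open>Injectivity of \<open>E\<close> on the closed half-plane makes \<open>D\<close>
    free of zeros up to the real line, so its logarithm is continuous there as well, with the
    argument of a chord as imaginary part.\<close>
  obtain Q where Q: "continuous_on ?H' Q" "\<And>z. z \<in> ?H' \<Longrightarrow> D z = exp (Q z)"
    using continuous_logarithm_on_contractible[OF Dc convex_imp_contractible[OF convex_halfspace_Im_ge] D0] by blast
  have Eshift: "(\<lambda>z. E (z + of_real a)) holomorphic_on ?H"
    by (rule holomorphic_on_compose_gen[unfolded o_def, OF _ hol]) (auto intro!: holomorphic_intros)
  have Dh: "D holomorphic_on ?H"
    unfolding D_def by (intro holomorphic_on_diff Eshift hol)
  have Dd: "deriv D z = deriv E (z + of_real a) - deriv E z" if "0 < Im z" for z
  proof (rule DERIV_imp_deriv)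
    have "(E has_field_derivative deriv E (z + of_real a)) (at (z + of_real a))" "(E has_field_derivative deriv E z) (at z)"
      using that by (auto intro!: holomorphic_derivI[OF hol open_upper])
    then show "(D has_field_derivative deriv E (z + of_real a) - deriv E z) (at z)"
      unfolding D_def by (intro DERIV_diff) (simp_all add: DERIV_shift)
  qed
  have QcH: "continuous_on ?H Q" by (rule continuous_on_subset[OF Q(1)]) auto
  have eQ: "exp (Q z) = D z" if "z \<in> ?H" for z using Q(2)[of z] that by auto
  have Qh: "Q holomorphic_on ?H" and Qd: "\<And>z. z \<in> ?H \<Longrightarrow> deriv Q z = deriv D z / D z"
    using holomorphic_continuous_log[OF open_upper QcH Dh eQ] by blast+
  define CQ where "CQ = 64 * koebe_const"
  have CQ0: "0 \<le> CQ" using koebe_const_ge_1 by (simp add: CQ_def)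
  have Qb: "cmod (deriv Q z) \<le> CQ / Im z" if "0 < Im z" for z
    using difference_log_deriv_bound[OF that a(1)] that by (simp add: Qd Dd D_def CQ_def)
  have Qb': "y * cmod (deriv Q (Complex s y)) \<le> CQ" if "0 < y" for s y
    using Qb[of "Complex s y"] that by (simp add: field_simps)
  define P where "P z = Q z - Q \<i>" for z
  have "continuous_on {- R..R} (\<lambda>s. Q (of_real s))"
    by (rule continuous_on_compose2[OF Q(1)]) (auto intro!: continuous_intros)
  moreover have "exp (Q (of_real s)) = bv (s + a) - bv s" for s
    using Q(2)[of "of_real s"] by (simp add: D_def)
  ultimately obtain A where A: "\<And>s. \<bar>s\<bar> \<le> R \<Longrightarrow> \<bar>Im (Q (of_real s)) - A\<bar> \<le> 2 * \<kappa>"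
    using continuous_arg_nearly_constant[of R "\<lambda>s. Q (of_real s)" "\<lambda>s. bv (s + a) - bv s" v \<kappa>] v near \<kappa>(2) by metis
  \<comment> \<open>With \<open>CQ = 64 * koebe_const\<close> the factor \<open>78\<close> becomes
    \<open>4992\<close>; the bound \<open>2 * \<kappa>\<close> for the argument is the source of
    \<open>4 * R * \<kappa>\<close>.\<close>
  have "cmod (deriv P \<i>) \<le> 2 * R * (2 * \<kappa>) + 78 * CQ * (2 + ln R) / R"
  proof (rule deriv_bound_from_boundary_imaginary_part[OF R CQ0])
    have "cbox (Complex (- R) 0) (Complex R R) \<subseteq> ?H'" "box (Complex (- R) 0) (Complex R R) \<subseteq> ?H"
      by (auto simp: in_cbox_complex_iff in_box_complex_iff)
    then show "continuous_on (cbox (Complex (- R) 0) (Complex R R)) P" "P holomorphic_on box (Complex (- R) 0) (Complex R R)"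
      unfolding P_def by (auto intro!: continuous_intros holomorphic_intros intro: continuous_on_subset[OF Q(1)] holomorphic_on_subset[OF Qh])
    show "P \<i> = 0" by (simp add: P_def)
    show "\<bar>Im (P (of_real s)) - (A - Im (Q \<i>))\<bar> \<le> 2 * \<kappa>" if "\<bar>s\<bar> \<le> R" for s
      using A[OF that] by (simp add: P_def algebra_simps)
    fix s y assume s: "\<bar>s\<bar> \<le> R" and y: "0 < y" "y \<le> R"
    \<comment> \<open>The route leads from \<open>Complex s y\<close> up to height \<open>R\<close>,
      across to the imaginary axis and down to \<open>\<i>\<close>; its pieces account for the terms
      \<open>ln (R / y)\<close>, \<open>1\<close> and \<open>ln R\<close>.\<close>
    have 1: "cmod (Q (Complex s R) - Q (Complex s y)) \<le> CQ * ln (R / y)"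
      by (rule vertical_log_bound[OF Qh y]) (use Qb' y in auto)
    have 2: "cmod (Q (Complex s R) - Q (Complex 0 R)) \<le> CQ / R * cmod (Complex s R - Complex 0 R)"
    proof (rule segment_bound[OF Qh open_upper])
      show "closed_segment (Complex 0 R) (Complex s R) \<subseteq> ?H" using closed_segment_horizontal R by fastforce
      fix x assume "x \<in> closed_segment (Complex 0 R) (Complex s R)"
      then have "Im x = R" by (rule closed_segment_horizontal)
      then show "cmod (deriv Q x) \<le> CQ / R" using Qb[of x] R by simp
    qed
    have "cmod (Complex s R - Complex 0 R) = \<bar>s\<bar>" by (simp add: cmod_def)
    then have "CQ / R * cmod (Complex s R - Complex 0 R) \<le> CQ / R * R"
      using s CQ0 R by (intro mult_left_mono) auto
    then have 2: "cmod (Q (Complex s R) - Q (Complex 0 R)) \<le> CQ" using 2 R by simp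
    have 3: "cmod (Q (Complex 0 R) - Q (Complex 0 1)) \<le> CQ * ln (R / 1)"
      by (rule vertical_log_bound[OF Qh]) (use Qb' R in auto)
    have i: "Complex 0 1 = \<i>" by (simp add: complex_eq_iff)
    have "P (Complex s y) = (Q (Complex s R) - Q (Complex 0 R)) + (Q (Complex 0 R) - Q \<i>) - (Q (Complex s R) - Q (Complex s y))"
      by (simp add: P_def)
    then have "cmod (P (Complex s y)) \<le> cmod (Q (Complex s R) - Q (Complex 0 R)) + cmod (Q (Complex 0 R) - Q \<i>) + cmod (Q (Complex s R) - Q (Complex s y))"
      by (metis norm_triangle_ineq4 norm_triangle_ineq order_trans add_right_mono)
    also have "\<dots> \<le> CQ + CQ * ln R + CQ * ln (R / y)" using 1 2 3 i by simp
    finally show "cmod (P (Complex s y)) \<le> CQ * (1 + ln R + ln (R / y))" by (simp add: algebra_simps)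
  qed (use \<kappa> in simp)
  moreover have "deriv P \<i> = deriv Q \<i>"
  proof (rule DERIV_imp_deriv)
    have "(Q has_field_derivative deriv Q \<i>) (at \<i>)" using holomorphic_derivI[OF Qh open_upper] by simp
    from DERIV_diff[OF this DERIV_const] show "(P has_field_derivative deriv Q \<i>) (at \<i>)"
      unfolding P_def by simp
  qed
  moreover have "cmod (deriv Q \<i> - deriv W \<i>) \<le> 64 * koebe_const * a"
    using difference_log_deriv_approx[OF W, of \<i> a] a by (simp add: Qd Dd D_def)
  moreover have "cmod (deriv W \<i>) \<le> cmod (deriv Q \<i>) + cmod (deriv Q \<i> - deriv W \<i>)"
    using norm_triangle_ineq4[of "deriv Q \<i>" "deriv Q \<i> - deriv W \<i>"] by simp
  ultimately show ?thesis by (simp add: CQ_def)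
qed

text \<open>Real translations and dilations move every point of the half-plane to
  \<open>\<i>\<close>, and the constants in the estimates of this locale are absolute, so the bound
  at \<open>\<i>\<close> holds at every scale.\<close>

lemma rescale:
  assumes y: "0 < y"
  shows "unbounded_half_plane_map (\<lambda>z. E (of_real x + of_real y * z))"
proof unfold_locales
  let ?A = "\<lambda>z::complex. of_real x + of_real y * z"
  show "continuous_on {z. 0 \<le> Im z} (\<lambda>z. E (?A z))"
    by (rule continuous_on_compose2[OF cont]) (use y in \<open>auto intro!: continuous_intros\<close>)
  show "inj_on (\<lambda>z. E (?A z)) {z. 0 \<le> Im z}"
  proof (rule inj_onI)
    fix z w assume zw: "z \<in> {z. 0 \<le> Im z}" "w \<in> {z. 0 \<le> Im z}" "E (?A z) = E (?A w)"
    have "?A z = ?A w" by (rule inj_onD[OF inj zw(3)]) (use zw y in auto)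
    then show "z = w" using y by simp
  qed
  show "(\<lambda>z. E (?A z)) holomorphic_on {z. 0 < Im z}"
    by (rule holomorphic_on_compose_gen[unfolded o_def, OF _ hol]) (use y in \<open>auto intro!: holomorphic_intros\<close>)
  have inv: "?A ((z - of_real x) / of_real y) = z" for z :: complex using y by simp
  have 1: "?A ` {z. 0 < Im z} = {z. 0 < Im z}"
  proof (intro equalityI subsetI)
    fix z assume "z \<in> {z. 0 < Im z}"
    then have "(z - of_real x) / of_real y \<in> {z. 0 < Im z}" using y by (simp add: Im_divide_of_real)
    then show "z \<in> ?A ` {z. 0 < Im z}" using inv by (metis image_eqI)
  qed (use y in auto)
  have 2: "?A ` \<real> = \<real>"
  proof (intro equalityI subsetI)
    fix z :: complex assume "z \<in> \<real>"
    then have "(z - of_real x) / of_real y \<in> \<real>" by (intro Reals_divide Reals_diff) auto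
    then show "z \<in> ?A ` \<real>" using inv by (metis image_eqI)
  qed auto
  have "(\<lambda>z. E (?A z)) ` S = E ` ?A ` S" for S by (simp add: image_image)
  then show "frontier ((\<lambda>z. E (?A z)) ` {z. 0 < Im z}) = (\<lambda>z. E (?A z)) ` \<real>" "\<not> bounded ((\<lambda>z. E (?A z)) ` \<real>)"
    using 1 2 frontier_image unbounded_image by simp_all
qed

end

locale quasidisk_map = turning_half_plane_map + unbounded_half_plane_map
begin

text \<open>The parameters depend on each other in a fixed order: \<open>a\<close> for the error of
  the difference quotient, \<open>R\<close> for the far sides of the rectangle,
  \<open>\<kappa>\<close> against the factor \<open>R\<close>, then \<open>\<epsilon>\<close>
  against the quasisymmetry bound \<open>B\<close>, and finally the scale \<open>y0\<close>. Each of
  the three error terms receives \<open>e / 4\<close>.\<close>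

lemma asymptotically_conformal_imp_log_deriv_vanishing:
  assumes ac: "\<And>\<epsilon>. 0 < \<epsilon> \<Longrightarrow> \<exists>t0>0. \<forall>a b x. a \<noteq> b \<longrightarrow> \<bar>a - b\<bar> \<le> t0 \<longrightarrow> x \<in> closed_segment a b \<longrightarrow>
      cmod (bv a - bv x) + cmod (bv x - bv b) \<le> (1 + \<epsilon>) * cmod (bv a - bv b)"
    and W: "W holomorphic_on {z. 0 < Im z}" "\<And>z. 0 < Im z \<Longrightarrow> exp (W z) = deriv E z"
    and e: "0 < e"
  shows "\<exists>y0>0. \<forall>z. 0 < Im z \<and> Im z \<le> y0 \<longrightarrow> Im z * cmod (deriv W z) \<le> e"
proof -
  define K where "K = koebe_const"
  have K1: "K \<ge> 1" using koebe_const_ge_1 by (simp add: K_def)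
  define a where "a = min distortion_radius (e / (256 * K))"
  have a: "0 < a" "a \<le> distortion_radius" "64 * K * a \<le> e / 4" "a \<le> 1"
  proof -
    show "0 < a" using distortion_radius_pos e K1 by (simp add: a_def)
    have "64 * K * a \<le> 64 * K * (e / (256 * K))" using K1 by (intro mult_left_mono) (auto simp: a_def)
    then show "64 * K * a \<le> e / 4" using K1 by simp
    show "a \<le> distortion_radius" by (simp add: a_def)
    then show "a \<le> 1" using distortion_radius_pos(2) by linarith
  qed
  have "((\<lambda>R. 4992 * K * (2 * inverse R + ln R / R)) \<longlongrightarrow> 4992 * K * (2 * 0 + 0)) at_top"
    by (intro tendsto_mult tendsto_add tendsto_const tendsto_inverse_0_at_top filterlim_ident ln_x_over_x_tendsto_0)
  then have "eventually (\<lambda>R. 4992 * K * (2 * inverse R + ln R / R) < e / 4) at_top"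
    using e by (intro order_tendstoD(2)) auto
  then have "eventually (\<lambda>R. 2 \<le> R \<and> 4992 * K * (2 * inverse R + ln R / R) < e / 4) at_top"
    using eventually_ge_at_top[of "2 :: real"] by eventually_elim simp
  then obtain R where R: "2 \<le> R" "4992 * K * (2 * inverse R + ln R / R) < e / 4"
    using eventually_happens'[OF trivial_limit_at_top_linorder] by blast
  have R': "4992 * K * (2 + ln R) / R \<le> e / 4"
  proof -
    have "4992 * K * (2 + ln R) / R = 4992 * K * (2 * inverse R + ln R / R)"
      using R(1) by (simp add: field_simps)
    then show ?thesis using R(2) by linarith
  qed
  define \<kappa> where "\<kappa> = min (1 / 4) (e / (16 * R))"
  have \<kappa>: "0 < \<kappa>" "\<kappa> < 1 / 2" "4 * R * \<kappa> \<le> e / 4"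
  proof -
    show "0 < \<kappa>" "\<kappa> < 1 / 2" using e R by (auto simp: \<kappa>_def)
    have "4 * R * \<kappa> \<le> 4 * R * (e / (16 * R))" using R by (intro mult_left_mono) (auto simp: \<kappa>_def)
    then show "4 * R * \<kappa> \<le> e / 4" using R by simp
  qed
  \<comment> \<open>The adjacent parameter intervals compared below have lengths of ratio at most
    \<open>t\<close>; \<open>B\<close> then bounds the ratio of their chords by
    \<open>weak_quasisymmetry\<close>, and \<open>\<epsilon>\<close> is tuned so that
    \<open>sgn_diff_bound\<close> yields \<open>\<kappa> / 2\<close>.\<close>
  define t where "t = (2 * R + 1) / a"
  have t1: "2 * R + 1 \<le> t" "2 * R + 1 = t * a" using a R by (auto simp: t_def le_divide_eq mult_left_le)
  define B where "B = C\<^sup>2 * exp (22500000 * (t + 1))"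
  have B0: "0 \<le> B" by (simp add: B_def)
  define \<epsilon> where "\<epsilon> = \<kappa>\<^sup>2 / (8 * (2 * B + 2))"
  have \<epsilon>0: "0 < \<epsilon>" using \<kappa> B0 by (simp add: \<epsilon>_def)
  have sq: "sqrt (2 * \<epsilon> * (2 * B + 2)) = \<kappa> / 2"
  proof -
    have gen: "2 * (k / (8 * b)) * b = k / 4" if "0 < b" for k b :: real using that by simp
    have "2 * \<epsilon> * (2 * B + 2) = (\<kappa> / 2)\<^sup>2"
      unfolding \<epsilon>_def using gen[of "2 * B + 2" "\<kappa>\<^sup>2"] B0 by (simp add: power_divide)
    then show ?thesis using \<kappa> by simp
  qed
  obtain t0 where t0: "t0 > 0" "\<And>a b x. a \<noteq> b \<Longrightarrow> \<bar>a - b\<bar> \<le> t0 \<Longrightarrow> x \<in> closed_segment a b \<Longrightarrow>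
      cmod (bv a - bv x) + cmod (bv x - bv b) \<le> (1 + \<epsilon>) * cmod (bv a - bv b)"
    using ac[OF \<epsilon>0] by blast
  \<comment> \<open>After rescaling all parameters lie between \<open>- R\<close> and
    \<open>R + 3\<close>, so the arcs in question have parameter length below
    \<open>y * (2 * R + 4)\<close>.\<close>
  define y0 where "y0 = t0 / (2 * R + 4)"
  have y00: "y0 > 0" using t0(1) R by (simp add: y0_def)
  have "Im z * cmod (deriv W z) \<le> e" if z: "0 < Im z" "Im z \<le> y0" for z
  proof -
    define x where "x = Re z"
    define y where "y = Im z"
    have y: "0 < y" "y * (2 * R + 4) \<le> t0" using z R by (auto simp: y_def y0_def le_divide_eq)
    define F where "F \<zeta> = E (of_real x + of_real y * \<zeta>)" for \<zeta>
    interpret F: unbounded_half_plane_map F unfolding F_def by (rule rescale[OF y(1)])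
    have Fr: "F (of_real s) = bv (x + y * s)" for s by (simp add: F_def)
    have sgn_close: "cmod (sgn (F (of_real q) - F (of_real p)) - sgn (F (of_real r) - F (of_real q))) \<le> \<kappa> / 2"
      if pqr: "- R \<le> p" "p < q" "q < r" "r \<le> R + 3" "q - p \<le> t * (r - q)" "r - q \<le> t * (q - p)" for p q r
    proof -
      define p' where "p' = x + y * p"
      define q' where "q' = x + y * q"
      define r' where "r' = x + y * r"
      have d: "q' - p' = y * (q - p)" "r' - q' = y * (r - q)" "r' - p' = y * (r - p)"
        by (simp_all add: p'_def q'_def r'_def algebra_simps)
      have o: "p' < q'" "q' < r'" using pqr y by (simp_all add: p'_def q'_def r'_def)
      have "r' - p' \<le> y * (2 * R + 4)" unfolding d using pqr y by (intro mult_left_mono) auto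
      then have len: "\<bar>p' - r'\<bar> \<le> t0" using y o by linarith
      have u0: "bv q' - bv p' \<noteq> 0" "bv r' - bv q' \<noteq> 0"
        using o by (auto simp: E_real_eq_iff)
      have "cmod (sgn (bv q' - bv p') - sgn (bv r' - bv q')) \<le> sqrt (2 * \<epsilon> * (2 * B + 2))"
      proof (rule sgn_diff_bound[OF u0])
        show "cmod (bv q' - bv p') + cmod (bv r' - bv q')
          \<le> (1 + \<epsilon>) * cmod (bv q' - bv p' + (bv r' - bv q'))"
          using t0(2)[of p' r' q'] o len by (simp add: closed_segment_eq_real_ivl norm_minus_commute)
        have "y * (q - p) \<le> t * (y * (r - q))" "y * (r - q) \<le> t * (y * (q - p))"
          using mult_left_mono[OF pqr(5), of y] mult_left_mono[OF pqr(6), of y] y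
          by (simp_all add: mult.left_commute)
        moreover have "\<bar>q' - p'\<bar> = y * (q - p)" "\<bar>q' - r'\<bar> = y * (r - q)"
          using o d by linarith+
        ultimately have m: "\<bar>q' - p'\<bar> \<le> t * \<bar>q' - r'\<bar>" "\<bar>q' - r'\<bar> \<le> t * \<bar>q' - p'\<bar>"
          by (simp_all only:)
        show "cmod (bv q' - bv p') \<le> B * cmod (bv r' - bv q')"
          using weak_quasisymmetry[of q' p' r' t] o m by (simp add: B_def norm_minus_commute)
        show "cmod (bv r' - bv q') \<le> B * cmod (bv q' - bv p')"
          using weak_quasisymmetry[of q' r' p' t] o m by (simp add: B_def norm_minus_commute)
      qed (use \<epsilon>0 in simp)
      then show ?thesis unfolding Fr p'_def q'_def r'_def sq .
    qed
    \<comment> \<open>The chord over \<open>[s, s + a]\<close> is compared with the fixed one over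
      \<open>[T, T + 1]\<close> through the chord over \<open>[s + a, T]\<close>, at a cost of
      \<open>\<kappa> / 2\<close> each time. The choice of \<open>T\<close> keeps the middle
      interval at length at least \<open>1\<close> for all \<open>s\<close>.\<close>
    define T where "T = R + a + 1"
    define v where "v = sgn (F (of_real (T + 1)) - F (of_real T))"
    have v1: "cmod v = 1"
    proof -
      have "F (of_real (T + 1)) \<noteq> F (of_real T)"
        unfolding Fr E_real_eq_iff using y by simp
      then show ?thesis by (simp add: v_def norm_sgn)
    qed
    have near: "cmod (sgn (F (of_real (s + a)) - F (of_real s)) - v) \<le> \<kappa>" if s: "\<bar>s\<bar> \<le> R" for s
    proof -
      have sR: "- R \<le> s" "s \<le> R" using s by auto
      define w where "w = sgn (F (of_real T) - F (of_real (s + a)))"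
      have t0': "1 \<le> t" using t1 R by linarith
      have i1: "1 \<le> T - (s + a)" "T - (s + a) \<le> 2 * R + 1" using sR by (auto simp: T_def)
      have "1 * 1 \<le> t * (T - (s + a))" using t0' i1 by (intro mult_mono) auto
      then have "cmod (sgn (F (of_real (s + a)) - F (of_real s)) - w) \<le> \<kappa> / 2"
        unfolding w_def using sR a i1 t1 by (intro sgn_close) (auto simp: T_def)
      moreover have "cmod (w - v) \<le> \<kappa> / 2"
        unfolding w_def v_def
        using sR a i1 t1 \<open>1 * 1 \<le> t * (T - (s + a))\<close> by (intro sgn_close) (auto simp: T_def)
      ultimately show ?thesis
        using norm_triangle_ineq[of "sgn (F (of_real (s + a)) - F (of_real s)) - w" "w - v"] by simp
    qed
    \<comment> \<open>The chain rule multiplies the derivative of \<open>E\<close> by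
      \<open>y\<close>; the constant \<open>ln y\<close> accounts for this factor and disappears on
      differentiation.\<close>
    define WF where "WF \<zeta> = W (of_real x + of_real y * \<zeta>) + of_real (ln y)" for \<zeta>
    have imA: "0 < Im (of_real x + of_real y * \<zeta>)" if "0 < Im \<zeta>" for \<zeta> using that y by simp
    have WFd: "(WF has_field_derivative of_real y * deriv W (of_real x + of_real y * \<zeta>)) (at \<zeta>)" if "0 < Im \<zeta>" for \<zeta>
    proof -
      have "(W has_field_derivative deriv W (of_real x + of_real y * \<zeta>)) (at (of_real x + of_real y * \<zeta>))"
        using holomorphic_derivI[OF W(1) open_upper] imA[OF that] by simp
      moreover have "((\<lambda>\<zeta>. of_real x + of_real y * \<zeta>) has_field_derivative of_real y) (at \<zeta>)"
        by (auto intro!: derivative_eq_intros)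
      ultimately have "((\<lambda>\<zeta>. W (of_real x + of_real y * \<zeta>)) has_field_derivative deriv W (of_real x + of_real y * \<zeta>) * of_real y) (at \<zeta>)"
        by (rule DERIV_chain2)
      from DERIV_add[OF this DERIV_const, of "of_real (ln y)"]
      show ?thesis unfolding WF_def by (simp add: mult.commute)
    qed
    have WF1: "WF holomorphic_on {z. 0 < Im z}"
      using WFd open_upper by (auto simp: holomorphic_on_open)
    have WF2: "exp (WF \<zeta>) = deriv F \<zeta>" if "0 < Im \<zeta>" for \<zeta>
    proof -
      have "(E has_field_derivative deriv E (of_real x + of_real y * \<zeta>)) (at (of_real x + of_real y * \<zeta>))"
        using holomorphic_derivI[OF hol open_upper] imA[OF that] by simp
      moreover have "((\<lambda>\<zeta>. of_real x + of_real y * \<zeta>) has_field_derivative of_real y) (at \<zeta>)"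
        by (auto intro!: derivative_eq_intros)
      ultimately have "(F has_field_derivative deriv E (of_real x + of_real y * \<zeta>) * of_real y) (at \<zeta>)"
        unfolding F_def by (rule DERIV_chain2)
      then have "deriv F \<zeta> = deriv E (of_real x + of_real y * \<zeta>) * of_real y" by (rule DERIV_imp_deriv)
      moreover have "exp (of_real (ln y)) = complex_of_real y" using y by (metis exp_ln exp_of_real)
      ultimately show ?thesis using W(2)[OF imA[OF that]] by (simp add: WF_def exp_add)
    qed
    have "cmod (deriv WF \<i>) \<le> 4 * R * \<kappa> + 4992 * koebe_const * (2 + ln R) / R + 64 * koebe_const * a"
      by (rule F.log_deriv_bound_at_ii[OF R(1) a(1,2) v1 _ \<kappa>(2) near WF1 WF2]) (use \<kappa> in auto)
    also have "\<dots> \<le> e" using \<kappa>(3) R' a(3) e unfolding K_def by linarith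
    finally have "cmod (deriv WF \<i>) \<le> e" .
    moreover have "deriv WF \<i> = of_real y * deriv W z"
    proof -
      have "of_real x + of_real y * \<i> = z" by (simp add: complex_eq_iff x_def y_def)
      then show ?thesis using DERIV_imp_deriv[OF WFd[of \<i>]] by simp
    qed
    ultimately show ?thesis using y by (simp add: norm_mult y_def)
  qed
  then show ?thesis using y00 by blast
qed

end

section \<open>The equivalence\<close>

lemma closure_upper_half_plane: "closure upper_half_plane = {z. 0 \<le> Im z}"
proof -
  have "upper_half_plane = {z. inner \<i> z > 0}" "{z. 0 \<le> Im z} = {z. inner \<i> z \<ge> 0}"
    by (auto simp: upper_half_plane_def inner_complex_def)
  then show ?thesis
    using closure_halfspace_gt[of "\<i>" 0] by (simp only: complex_i_not_zero not_False_eq_True simp_thms)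
qed

text \<open>Otherwise the inverse homeomorphism would map a compact set onto a set containing the
  real line.\<close>

lemma quasicircle_unbounded:
  assumes "quasiconformal_plane f"
  shows "\<not> bounded (f ` \<real>)"
proof
  assume b: "bounded (f ` \<real>)"
  obtain h where h: "homeomorphism UNIV UNIV f h"
    using assms unfolding quasiconformal_plane_def by blast
  have "continuous_on A h" for A
    using h by (auto simp: homeomorphism_def intro: continuous_on_subset)
  then have "bounded (h ` closure (f ` \<real>))"
    using b by (intro compact_imp_bounded compact_continuous_image) (simp_all add: compact_closure)
  moreover have "h ` f ` \<real> \<subseteq> h ` closure (f ` \<real>)"
    by (intro image_mono closure_subset)
  moreover have "h ` f ` \<real> = \<real>"
    using h by (force simp: homeomorphism_def image_iff)
  ultimately have "bounded (\<real> :: complex set)"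
    using bounded_subset by metis
  then obtain B where B: "\<And>z :: complex. z \<in> \<real> \<Longrightarrow> cmod z \<le> B"
    by (auto simp: bounded_iff)
  show False
    using B[of "of_real (\<bar>B\<bar> + 1)"] by simp
qed

text \<open>Bounded turning is transported from the parametrisation \<open>f\<close> of the curve to
  \<open>E\<close>. The change of parameter \<open>\<sigma>\<close> is continuous and injective on
  the real line, hence maps segments onto segments, and bounded turning refers to the parameter
  through segments only.\<close>

lemma quasidisk_map_intro:
  assumes qd: "unbounded_quasidisk \<Omega>" and G: "conformal_onto G upper_half_plane \<Omega>"
    and E: "homeomorphism (closure upper_half_plane) (closure \<Omega>) E h" "\<And>z. z \<in> upper_half_plane \<Longrightarrow> E z = G z"
  obtains C k where "quasidisk_map E C" "homeomorphism UNIV (frontier \<Omega>) (\<lambda>s. E (of_real s)) k"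
proof -
  have opn: "open \<Omega>" using qd by (simp add: unbounded_quasidisk_def)
  obtain f where f: "quasiconformal_plane f" "frontier \<Omega> = f ` \<real>"
    using qd unfolding unbounded_quasidisk_def quasicircle_through_infinity_def by blast
  obtain f' where f': "homeomorphism UNIV UNIV f f'"
    using f(1) unfolding quasiconformal_plane_def by blast
  have contE: "continuous_on {z. 0 \<le> Im z} E" and imE: "E ` {z. 0 \<le> Im z} = closure \<Omega>"
    and conth: "continuous_on (closure \<Omega>) h" and hE: "\<And>z. 0 \<le> Im z \<Longrightarrow> h (E z) = z"
    using E(1) unfolding closure_upper_half_plane by (auto simp: homeomorphism_def)
  have injE: "inj_on E {z. 0 \<le> Im z}"
    using hE by (metis inj_onI mem_Collect_eq)
  have holE: "E holomorphic_on {z. 0 < Im z}"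
  proof (rule holomorphic_transform)
    show "G holomorphic_on {z. 0 < Im z}"
      using G unfolding conformal_onto_def upper_half_plane_def by blast
  qed (simp add: E(2) upper_half_plane_def)
  have "E ` {z. 0 < Im z} = G ` {z. 0 < Im z}"
    by (rule image_cong) (simp_all add: E(2) upper_half_plane_def)
  then have imH: "E ` {z. 0 < Im z} = \<Omega>"
    using G unfolding conformal_onto_def upper_half_plane_def by simp
  have Rs: "\<real> = {z. 0 \<le> Im z} - {z. 0 < Im z}"
    by (auto simp: complex_is_Real_iff)
  have "E ` \<real> = closure \<Omega> - \<Omega>"
    unfolding Rs by (subst inj_on_image_set_diff[OF injE]) (auto simp: imE imH)
  then have fr: "frontier \<Omega> = E ` \<real>"
    using opn by (simp add: frontier_def interior_open)
  obtain C where C: "1 \<le> C" "\<And>x b w :: real. w \<in> closed_segment x b \<Longrightarrow>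
     cmod (f (of_real w) - f (of_real x)) \<le> C * cmod (f (of_real b) - f (of_real x))"
    using quasiconformal_bounded_turning[OF f(1)] by blast
  define \<sigma> where "\<sigma> s = Re (f' (E (of_real s)))" for s
  have f\<sigma>: "f (of_real (\<sigma> s)) = E (of_real s)" for s
  proof -
    have "E (of_real s) \<in> E ` \<real>" by (rule imageI) simp
    then have "E (of_real s) \<in> f ` \<real>" by (simp only: fr[symmetric] f(2))
    then obtain x where "x \<in> \<real>" "E (of_real s) = f x" by blast
    moreover then have "f' (E (of_real s)) = x" using f' by (simp add: homeomorphism_def)
    ultimately show ?thesis by (simp add: \<sigma>_def)
  qed
  have contEr: "continuous_on UNIV (\<lambda>s. E (of_real s))"
    by (rule continuous_on_compose2[OF contE]) (auto intro!: continuous_intros)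
  have "continuous_on UNIV f'" using f' by (simp add: homeomorphism_def)
  then have cont\<sigma>: "continuous_on UNIV \<sigma>"
    unfolding \<sigma>_def by (intro continuous_on_Re continuous_on_compose2[OF _ contEr]) auto
  have inj\<sigma>: "inj \<sigma>"
  proof (rule injI)
    fix s t assume "\<sigma> s = \<sigma> t"
    then have "E (of_real s) = E (of_real t)" using f\<sigma> by metis
    then show "s = t" using inj_onD[OF injE, of "of_real s" "of_real t"] by simp
  qed
  have turning: "cmod (E (of_real w) - E (of_real x)) \<le> C * cmod (E (of_real b) - E (of_real x))"
    if w: "w \<in> closed_segment x b" for x b w :: real
  proof -
    have "\<sigma> ` closed_segment x b = closed_segment (\<sigma> x) (\<sigma> b)"
      by (rule continuous_injective_image_segment_1[OF continuous_on_subset[OF cont\<sigma>] inj_on_subset[OF inj\<sigma>]]) auto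
    then have "\<sigma> w \<in> closed_segment (\<sigma> x) (\<sigma> b)" using w by blast
    from C(2)[OF this] show ?thesis by (simp only: f\<sigma>)
  qed
  have "quasidisk_map E C"
    by unfold_locales (use contE injE holE C(1) turning fr imH quasicircle_unbounded[OF f(1)] f(2) in auto)
  moreover have "homeomorphism UNIV (frontier \<Omega>) (\<lambda>s. E (of_real s)) (\<lambda>z. Re (h z))"
  proof (rule homeomorphismI)
    show "continuous_on UNIV (\<lambda>s. E (of_real s))" by (rule contEr)
    show "continuous_on (frontier \<Omega>) (\<lambda>z. Re (h z))"
      by (intro continuous_on_Re continuous_on_subset[OF conth]) (auto simp: frontier_def)
    show "(\<lambda>s. E (of_real s)) ` UNIV \<subseteq> frontier \<Omega>" unfolding fr by auto
    show "Re (h (E (of_real s))) = s" for s using hE[of "of_real s"] by simp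
    show "E (of_real (Re (h z))) = z" if "z \<in> frontier \<Omega>" for z
    proof -
      have "z \<in> E ` \<real>" using that by (simp only: fr)
      then obtain x where x: "z = E x" "x \<in> \<real>" by (rule imageE)
      have "Im x = 0" using x(2) by (simp add: complex_is_Real_iff)
      then have "h z = x"
        unfolding x(1) by (simp add: hE)
      moreover have "of_real (Re x) = x" using \<open>Im x = 0\<close> by (simp add: complex_eq_iff)
      ultimately have "h z = x" "of_real (Re x) = x" by auto
      then show ?thesis using x(1) by simp
    qed
  qed simp
  ultimately show thesis by (rule that)
qed

lemma little_bloch_vanishing:
  assumes "L \<in> little_bloch" and e: "0 < e"
  shows "\<exists>y0>0. \<forall>z. 0 < Im z \<and> Im z \<le> y0 \<longrightarrow> Im z * cmod (deriv L z) \<le> e"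
proof -
  have "uniform_limit UNIV (\<lambda>y x. y * cmod (deriv L (Complex x y))) (\<lambda>x. 0) (at_right 0)"
    using assms(1) by (simp add: little_bloch_def)
  then have "eventually (\<lambda>y. \<forall>x\<in>UNIV. dist (y * cmod (deriv L (Complex x y))) 0 < e) (at_right 0)"
    using e by (rule uniform_limitD)
  then obtain b where b: "b > 0" "\<And>y x. 0 < y \<Longrightarrow> y < b \<Longrightarrow> y * cmod (deriv L (Complex x y)) < e"
    unfolding eventually_at_right_field by (auto simp: dist_norm norm_mult abs_mult)
  show ?thesis
  proof (intro exI[of _ "b / 2"] conjI allI impI)
    fix z assume "0 < Im z \<and> Im z \<le> b / 2"
    then show "Im z * cmod (deriv L z) \<le> e" using b(2)[of "Im z" "Re z"] b(1) by simp
  qed (use b in simp)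
qed

lemma little_blochI:
  assumes hol: "L holomorphic_on {z. 0 < Im z}"
    and bd: "\<And>z. 0 < Im z \<Longrightarrow> cmod (deriv L z) \<le> B / Im z"
    and lim: "\<And>e. 0 < e \<Longrightarrow> \<exists>y0>0. \<forall>z. 0 < Im z \<and> Im z \<le> y0 \<longrightarrow> Im z * cmod (deriv L z) \<le> e"
  shows "L \<in> little_bloch"
  unfolding little_bloch_def upper_half_plane_def
proof (intro CollectI conjI hol)
  show "bdd_above ((\<lambda>z. Im z * cmod (deriv L z)) ` {z. 0 < Im z})"
  proof (rule bdd_aboveI2)
    fix z :: complex assume "z \<in> {z. 0 < Im z}"
    then show "Im z * cmod (deriv L z) \<le> B" using bd[of z] by (simp add: field_simps)
  qed
  show "uniform_limit UNIV (\<lambda>y x. y * cmod (deriv L (Complex x y))) (\<lambda>x. 0) (at_right 0)"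
  proof (rule uniform_limitI)
    fix e :: real assume e: "0 < e"
    obtain y0 where y0: "y0 > 0" "\<And>z. 0 < Im z \<Longrightarrow> Im z \<le> y0 \<Longrightarrow> Im z * cmod (deriv L z) \<le> e / 2"
      using lim[of "e / 2"] e by auto
    have "dist (y * cmod (deriv L (Complex x y))) 0 < e" if "0 < y" "y < y0" for x y
      using y0(2)[of "Complex x y"] that e by simp
    then show "\<forall>\<^sub>F y in at_right 0. \<forall>x\<in>UNIV. dist (y * cmod (deriv L (Complex x y))) 0 < e"
      unfolding eventually_at_right_field using y0(1) by blast
  qed
qed

theorem theorem1p1:
  fixes \<Omega> \<Gamma> :: "complex set" and G :: "complex \<Rightarrow> complex" and g :: "real \<Rightarrow> complex"
  assumes "unbounded_quasidisk \<Omega>"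
    and "\<Gamma> = frontier \<Omega>"
    and "conformal_onto G upper_half_plane \<Omega>"
    and "filterlim G at_infinity (inf at_infinity (principal upper_half_plane))"
    and "homeomorphic_boundary_extension G \<Omega> g"
  shows "((\<exists>L. log_branch L (deriv G) \<and> L \<in> little_bloch) \<longleftrightarrow>
            asymptotically_conformal_quasicircle \<Gamma> g) \<and>
         (asymptotically_conformal_quasicircle \<Gamma> g \<longleftrightarrow>
            asymptotically_symmetric_embedding g \<and> range g = \<Gamma>)"
proof -
  obtain E h where E: "homeomorphism (closure upper_half_plane) (closure \<Omega>) E h"
      "\<And>z. z \<in> upper_half_plane \<Longrightarrow> E z = G z" and gE: "\<And>x. g x = E (of_real x)"
    using assms(5) unfolding homeomorphic_boundary_extension_def by blast
  have g_eq: "g = (\<lambda>s. E (of_real s))" using gE by auto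
  obtain C k where C: "quasidisk_map E C" and hom: "homeomorphism UNIV \<Gamma> g k"
    using quasidisk_map_intro[OF assms(1,3) E] unfolding g_eq assms(2) by blast
  interpret quasidisk_map E C by (rule C)
  have qc: "quasicircle_through_infinity \<Gamma>"
    using assms(1,2) by (simp add: unbounded_quasidisk_def)
  have rng: "range g = \<Gamma>" using hom by (simp add: homeomorphism_def)
  have dG: "deriv G z = deriv E z" if "0 < Im z" for z
    by (rule deriv_cong_ev[OF eventually_nhds_in_open[OF open_upper, THEN eventually_mono]])
      (use that E(2) in \<open>auto simp: upper_half_plane_def\<close>)
  have qs: "quasisymmetric_embedding g"
    using quasisymmetric hom unfolding g_eq by blast
  have 1: "asymptotically_symmetric_embedding g" if L: "log_branch L (deriv G)" "L \<in> little_bloch" for L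
    unfolding asymptotically_symmetric_embedding_def
  proof (intro conjI qs allI impI)
    fix \<epsilon> t :: real assume \<epsilon>: "0 < \<epsilon>" and t: "0 < t"
    have Lh: "L holomorphic_on {z. 0 < Im z}" and Le: "\<And>z. 0 < Im z \<Longrightarrow> exp (L z) = deriv E z"
      using L(1) dG by (auto simp: log_branch_def upper_half_plane_def)
    obtain \<delta> where \<delta>: "0 < \<delta>" "\<And>x a b. x \<noteq> b \<Longrightarrow> \<bar>x - b\<bar> \<le> \<delta> \<Longrightarrow> \<bar>x - a\<bar> \<le> t * \<bar>x - b\<bar> \<Longrightarrow>
       cmod (E (of_real x) - E (of_real a)) \<le> (1 + \<epsilon>) * t * cmod (E (of_real x) - E (of_real b))"
      using log_deriv_vanishing_imp_asymptotically_symmetric[OF Lh Le little_bloch_vanishing[OF L(2)] \<epsilon> t] by metis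
    show "\<exists>\<delta>>0. \<forall>x a b. distinct [x, a, b] \<longrightarrow> (\<exists>c d. d - c < \<delta> \<and> {x, a, b} \<subseteq> {c..d}) \<longrightarrow>
        \<bar>x - a\<bar> / \<bar>x - b\<bar> \<le> t \<longrightarrow> cmod (g x - g a) / cmod (g x - g b) \<le> (1 + \<epsilon>) * t"
    proof (intro exI[of _ \<delta>] conjI allI impI \<delta>(1))
      fix x a b :: real
      assume xab: "distinct [x, a, b]" and "\<exists>c d. d - c < \<delta> \<and> {x, a, b} \<subseteq> {c..d}" and le: "\<bar>x - a\<bar> / \<bar>x - b\<bar> \<le> t"
      then obtain c d where cd: "d - c < \<delta>" "{x, a, b} \<subseteq> {c..d}" by blast
      have "\<bar>x - b\<bar> \<le> \<delta>" using cd by auto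
      moreover have "\<bar>x - a\<bar> \<le> t * \<bar>x - b\<bar>" using le xab by (simp add: divide_le_eq)
      ultimately have "cmod (g x - g a) \<le> (1 + \<epsilon>) * t * cmod (g x - g b)"
        using \<delta>(2) xab by (simp add: gE)
      moreover have "0 < cmod (g x - g b)" using xab E_real_eq_iff by (simp add: gE)
      ultimately show "cmod (g x - g a) / cmod (g x - g b) \<le> (1 + \<epsilon>) * t"
        by (simp add: pos_divide_le_eq)
    qed
  qed
  have 2: "\<exists>L. log_branch L (deriv G) \<and> L \<in> little_bloch" if ac: "asymptotically_conformal_quasicircle \<Gamma> g"
  proof -
    obtain W where W: "W holomorphic_on {z. 0 < Im z}" "\<And>z. 0 < Im z \<Longrightarrow> exp (W z) = deriv E z"
      using log_deriv_exists by blast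
    have ac': "\<exists>t0>0. \<forall>a b x. a \<noteq> b \<longrightarrow> \<bar>a - b\<bar> \<le> t0 \<longrightarrow> x \<in> closed_segment a b \<longrightarrow>
      cmod (E (of_real a) - E (of_real x)) + cmod (E (of_real x) - E (of_real b)) \<le> (1 + \<epsilon>) * cmod (E (of_real a) - E (of_real b))"
      if "0 < \<epsilon>" for \<epsilon>
      using asymptotically_conformalD[OF ac that] unfolding gE by metis
    have "W \<in> little_bloch"
      using little_blochI[OF W(1) log_deriv_bounds(1)[OF W] asymptotically_conformal_imp_log_deriv_vanishing[OF ac' W]] by blast
    moreover have "log_branch W (deriv G)"
      using W dG by (auto simp: log_branch_def upper_half_plane_def)
    ultimately show ?thesis by blast
  qed
  \<comment> \<open>The implications form a cycle: (1) gives (3) by \<open>1\<close>, (3) gives (2)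
    by \<open>asymptotically_symmetric_imp_conformal\<close>, and (2) gives (1) by \<open>2\<close>.
    The image of \<open>g\<close> is \<open>\<Gamma>\<close> in any case.\<close>
  show ?thesis
    using 1 2 asymptotically_symmetric_imp_conformal[OF qc hom] rng by blast
qed

end
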